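(* Consider the finite-horizon, partially observed stochastic control problem with horizon $L$ described in the context, and let $\overline{J}_k(\mathbf{p}_{k|k-1})$, $1\le k\le L$, be its cost-to-go functions expressed in terms of the predicted belief state $\mathbf{p}_{k|k-1}$ (a probability vector in $\mathbb{R}^n$). Then for $k=L-1,\dots,1$, $$\overline{J}_k(\mathbf{p}_{k|k-1})=\min_{\mathbf{u}_{k-1}\in\mathcal{U}}\Big[\mathbf{p}_{k|k-1}^T\mathbf{h}(\mathbf{p}_{k|k-1},\mathbf{u}_{k-1})+\int \mathbf{1}_n^T\mathbf{r}(\mathbf{y},\mathbf{u}_{k-1})\mathbf{p}_{k|k-1}\;\overline{J}_{k+1}\Big(\frac{\mathbf{P}\,\mathbf{r}(\mathbf{y},\mathbf{u}_{k-1})\,\mathbf{p}_{k|k-1}}{\mathbf{1}_n^T\mathbf{r}(\mathbf{y},\mathbf{u}_{k-1})\,\mathbf{p}_{k|k-1}}\Big)d\mathbf{y}\Big],$$ where $\mathbf{h}(\mathbf{p}_{k|k-1},\mathbf{u}_{k-1})$ is the column vector with components $h(\mathbf{e}_1,\mathbf{p}_{k|k-1},\mathbf{u}_{k-1}),\dots,h(\mathbf{e}_n,\mathbf{p}_{k|k-1},\mathbf{u}_{k-1})$ and $$h(\mathbf{e}_i,\mathbf{p}_{k|k-1},\mathbf{u}_{k-1})=1-\operatorname{tr}\big(\mathbf{G}_k^T\mathbf{G}_k\mathbf{Q}_i^{\mathbf{u}_{k-1}}\big)-\big\|\mathbf{p}_{k|k-1}+\mathbf{G}_k(\mathbf{m}_i^{\mathbf{u}_{k-1}}-\mathbf{y}_{k|k-1})\big\|^2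 .$$ For $k=L$, $$\overline{J}_L(\mathbf{p}_{L|L-1})=\min_{\mathbf{u}_{L-1}\in\mathcal{U}}\Big[\mathbf{p}_{L|L-1}^T\mathbf{h}(\mathbf{p}_{L|L-1},\mathbf{u}_{L-1})\Big].$$
   Context: Model. $\mathbf{e}_1,\dots,\mathbf{e}_n$ are the standard unit vectors of $\mathbb{R}^n$. The state $(\mathbf{x}_k)_{k\ge0}$ is a Markov chain on $\{\mathbf{e}_1,\dots,\mathbf{e}_n\}$ with transition matrix $\mathbf{P}$ whose $(j,i)$ entry is $P(\mathbf{x}_{k+1}=\mathbf{e}_j|\mathbf{x}_k=\mathbf{e}_i)$ (columns sum to $1$); the transition is unaffected by past observations and controls. Controls take values in a finite set $\mathcal{U}$. Given the states up to time $k$ and the past observations and controls, the observation $\mathbf{y}_k$ has density $f(\cdot|\mathbf{x}_k,\mathbf{u}_{k-1})$, where $f(\cdot|\mathbf{e}_i,\mathbf{u})$ is the density of $\mathcal{N}(\mathbf{m}_i^{\mathbf{u}},\mathbf{Q}_i^{\mathbf{u}})$ with $\mathbf{Q}_i^{\mathbf{u}}$ positive definite (dimension depending only on $\mathbf{u}$). Put $\mathcal{M}(\mathbf{u})=[\mathbf{m}_1^{\mathbf{u}},\dots,\mathbf{m}_n^{\mathbf{u}}]$, $\mathbf{r}(\mathbf{y},\mathbf{u})=\operatorname{diag}(f(\mathbf{y}|\mathbf{e}_1,\mathbf{u}),\dots,f(\mathbf{y}|\mathbf{e}_n,\mathbf{u}))$, and let $\mathbf{1}_n$ be the all-ones column vector.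 Information and belief. The controller picks $\mathbf{u}_k=\eta_k(\mathcal{F}_k)\in\mathcal{U}$, $\eta_k$ measurable, where $\mathcal{F}_k=(\mathbf{y}_0,\dots,\mathbf{y}_k,\mathbf{u}_0,\dots,\mathbf{u}_{k-1})$. The predicted belief state $\mathbf{p}_{k|k-1}=(p^i_{k|k-1})_i$ is the conditional distribution of $\mathbf{x}_k$ given $\mathcal{F}_{k-1}$; it evolves by Bayes' rule: $$\mathbf{p}_{k+1|k}=\frac{\mathbf{P}\,\mathbf{r}(\mathbf{y}_k,\mathbf{u}_{k-1})\,\mathbf{p}_{k|k-1}}{\mathbf{1}_n^T\mathbf{r}(\mathbf{y}_k,\mathbf{u}_{k-1})\,\mathbf{p}_{k|k-1}}.$$ Stage cost. At stage $k$ ($1\le k\le L$) the cost is $\operatorname{tr}(\mathbf{\Sigma}_{k|k}(\mathbf{y}_k,\mathbf{u}_{k-1}))$, where $\mathbf{\Sigma}_{k|k}=\operatorname{diag}(\mathbf{p}_{k|k})-\mathbf{p}_{k|k}\mathbf{p}_{k|k}^T$ and $\mathbf{p}_{k|k}$ is the Kalman-like filter $\mathbf{p}_{k|k}=\mathbf{p}_{k|k-1}+\mathbf{G}_k(\mathbf{y}_k-\mathbf{y}_{k|k-1})$, with $\mathbf{y}_{k|k-1}=\mathcal{M}(\mathbf{u}_{k-1})\mathbf{p}_{k|k-1}$, $\mathbf{\Sigma}_{k|k-1}=\operatorname{diag}(\mathbf{p}_{k|k-1})-\mathbf{p}_{k|k-1}\mathbf{p}_{k|k-1}^T$, $\widetilde{\mathbf{Q}}_k=\sum_i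 p^i_{k|k-1}\mathbf{Q}_i^{\mathbf{u}_{k-1}}$ and $\mathbf{G}_k=\mathbf{\Sigma}_{k|k-1}\mathcal{M}^T(\mathbf{u}_{k-1})(\mathcal{M}(\mathbf{u}_{k-1})\mathbf{\Sigma}_{k|k-1}\mathcal{M}^T(\mathbf{u}_{k-1})+\widetilde{\mathbf{Q}}_k)^{-1}$. The total cost to be minimized is $\mathbb{E}\{\sum_{k=1}^L\operatorname{tr}(\mathbf{\Sigma}_{k|k}(\mathbf{y}_k,\mathbf{u}_{k-1}))\}$. Cost-to-go. For a probability vector $\mathbf{p}$, $\overline{J}_k(\mathbf{p})$ is the minimum of the expected remaining cost $\mathbb{E}\{\sum_{t=k}^L\operatorname{tr}(\mathbf{\Sigma}_{t|t}(\mathbf{y}_t,\mathbf{u}_{t-1}))\}$ when the predicted belief at stage $k$ is $\mathbf{p}_{k|k-1}=\mathbf{p}$ (so $\mathbf{x}_k$ has distribution $\mathbf{p}$), over choices of $\mathbf{u}_{k-1}\in\mathcal{U}$ and of subsequent controls $\mathbf{u}_t\in\mathcal{U}$, $k\le t\le L-1$, as measurable functions of $(\mathbf{u}_{k-1},\mathbf{y}_k,\dots,\mathbf{u}_{t-1},\mathbf{y}_t)$. $\|\cdot\|$ is the Euclidean norm. *)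

theory Defs
  imports "HOL-Probability.Probability"
    "Jordan_Normal_Form.Gauss_Jordan_Elimination" "Jordan_Normal_Form.Determinant"
begin

hide_const (open) Finite_Cartesian_Product.vec Finite_Cartesian_Product.mat
  Finite_Cartesian_Product.row Finite_Cartesian_Product.column
  Determinants.det Determinants.trace Finite_Cartesian_Product.transpose
hide_type (open) Finite_Cartesian_Product.vec
no_notation Finite_Cartesian_Product.vec_nth (infixl \<open>$\<close> 90)
no_notation inner (infix \<open>\<bullet>\<close> 70)

section \<open>Vectors and matrices\<close>

text \<open>
  The dimension of an observation depends on the control, so vectors and matrices are those of
  Jordan_Normal_Form, which carry their dimension as data.
\<close>

definition tr :: "real mat \<Rightarrow> real" where
  "tr A = (\<Sum>i<dim_row A. A $$ (i, i))"

definition eucl_norm :: "real vec \<Rightarrow> real" where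
  "eucl_norm v = sqrt (v \<bullet> v)"

definition ones :: "nat \<Rightarrow> real vec" where
  "ones n = vec n (\<lambda>_. 1)"

definition outer :: "real vec \<Rightarrow> real vec \<Rightarrow> real mat" where
  "outer v w = mat (dim_vec v) (dim_vec w) (\<lambda>(i, j). v $ i * w $ j)"

definition pos_def :: "nat \<Rightarrow> real mat \<Rightarrow> bool" where
  "pos_def d A \<longleftrightarrow> A \<in> carrier_mat d d \<and> A\<^sup>T = A \<and>
     (\<forall>x \<in> carrier_vec d. x \<noteq> 0\<^sub>v d \<longrightarrow> x \<bullet> (A *\<^sub>v x) > 0)"

definition minv :: "real mat \<Rightarrow> real mat" where
  "minv A = the (mat_inverse A)"

definition prob_vec :: "nat \<Rightarrow> real vec \<Rightarrow> bool" where
  "prob_vec n p \<longleftrightarrow> p \<in> carrier_vec n \<and> (\<forall>i<n. 0 \<le> p $ i) \<and> (\<Sum>i<n. p $ i) = 1"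

text \<open>
  The Borel structure on the type of all vectors, viewed as the disjoint union of the spaces
  of vectors of length \<open>d\<close>: a set is measurable iff its part in each dimension is Borel.
  The measure \<open>lborel_vec d\<close> is Lebesgue measure on the vectors of length \<open>d\<close>, and it vanishes
  on the vectors of any other length.
\<close>

definition borel_vec :: "real vec measure" where
  "borel_vec = sigma UNIV
     {A. \<forall>d. vec d -` A \<inter> space (\<Pi>\<^sub>M i\<in>{..<d}. (borel :: real measure))
               \<in> sets (\<Pi>\<^sub>M i\<in>{..<d}. (borel :: real measure))}"

definition lborel_vec :: "nat \<Rightarrow> real vec measure" where
  "lborel_vec d = distr (\<Pi>\<^sub>M i\<in>{..<d}. (lborel :: real measure)) borel_vec (vec d)"

definition gaussian_density :: "real vec \<Rightarrow> real mat \<Rightarrow> real vec \<Rightarrow> real" where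
  "gaussian_density m Q y =
     exp (- ((y - m) \<bullet> (minv Q *\<^sub>v (y - m))) / 2) / sqrt ((2 * pi) ^ dim_vec m * det Q)"


section \<open>The controlled model\<close>

text \<open>
  The unit vector \<open>\<^bold>e\<^sub>i\<close> of the state space is represented by its index \<open>i < nstates S\<close>
  (counted from 0). Entry \<open>(j, i)\<close> of \<open>tmat S\<close> is the probability of moving from \<open>i\<close> to \<open>j\<close>.
\<close>

record 'u model =
  nstates :: nat
  tmat :: "real mat"
  ctrls :: "'u set"
  odim :: "'u \<Rightarrow> nat"
  omean :: "nat \<Rightarrow> 'u \<Rightarrow> real vec"
  ocov :: "nat \<Rightarrow> 'u \<Rightarrow> real mat"

definition valid_model :: "'u model \<Rightarrow> bool" where
  "valid_model S \<longleftrightarrow>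
     0 < nstates S \<and>
     tmat S \<in> carrier_mat (nstates S) (nstates S) \<and>
     (\<forall>i<nstates S. prob_vec (nstates S) (col (tmat S) i)) \<and>
     finite (ctrls S) \<and> ctrls S \<noteq> {} \<and>
     (\<forall>u\<in>ctrls S. 0 < odim S u) \<and>
     (\<forall>u\<in>ctrls S. \<forall>i<nstates S. omean S i u \<in> carrier_vec (odim S u)) \<and>
     (\<forall>u\<in>ctrls S. \<forall>i<nstates S. pos_def (odim S u) (ocov S i u))"

definition obs_density :: "'u model \<Rightarrow> nat \<Rightarrow> 'u \<Rightarrow> real vec \<Rightarrow> real" where
  "obs_density S i u y = gaussian_density (omean S i u) (ocov S i u) y"

definition mean_mat :: "'u model \<Rightarrow> 'u \<Rightarrow> real mat" where
  "mean_mat S u = mat_of_cols (odim S u) (map (\<lambda>i. omean S i u) [0..<nstates S])"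

definition lik_mat :: "'u model \<Rightarrow> real vec \<Rightarrow> 'u \<Rightarrow> real mat" where
  "lik_mat S y u = mat_diag (nstates S) (\<lambda>i. obs_density S i u y)"

definition bayes :: "'u model \<Rightarrow> real vec \<Rightarrow> 'u \<Rightarrow> real vec \<Rightarrow> real vec" where
  "bayes S p u y =
     (1 / (ones (nstates S) \<bullet> (lik_mat S y u *\<^sub>v p))) \<cdot>\<^sub>v (tmat S *\<^sub>v (lik_mat S y u *\<^sub>v p))"


section \<open>The Kalman-like filter and the stage cost\<close>

definition belief_cov :: "real vec \<Rightarrow> real mat" where
  "belief_cov p = mat_diag (dim_vec p) (\<lambda>i. p $ i) - outer p p"

definition pred_obs :: "'u model \<Rightarrow> real vec \<Rightarrow> 'u \<Rightarrow> real vec" where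
  "pred_obs S p u = mean_mat S u *\<^sub>v p"

definition avg_cov :: "'u model \<Rightarrow> real vec \<Rightarrow> 'u \<Rightarrow> real mat" where
  "avg_cov S p u =
     mat (odim S u) (odim S u) (\<lambda>(a, b). \<Sum>i<nstates S. p $ i * ocov S i u $$ (a, b))"

definition gain :: "'u model \<Rightarrow> real vec \<Rightarrow> 'u \<Rightarrow> real mat" where
  "gain S p u = belief_cov p * (mean_mat S u)\<^sup>T *
     minv (mean_mat S u * belief_cov p * (mean_mat S u)\<^sup>T + avg_cov S p u)"

definition filtered :: "'u model \<Rightarrow> real vec \<Rightarrow> 'u \<Rightarrow> real vec \<Rightarrow> real vec" where
  "filtered S p u y = p + gain S p u *\<^sub>v (y - pred_obs S p u)"

definition stage_cost :: "'u model \<Rightarrow> real vec \<Rightarrow> 'u \<Rightarrow> real vec \<Rightarrow> real" where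
  "stage_cost S p u y = tr (belief_cov (filtered S p u y))"

definition h_comp :: "'u model \<Rightarrow> nat \<Rightarrow> real vec \<Rightarrow> 'u \<Rightarrow> real" where
  "h_comp S i p u = 1 - tr ((gain S p u)\<^sup>T * gain S p u * ocov S i u)
     - (eucl_norm (p + gain S p u *\<^sub>v (omean S i u - pred_obs S p u)))\<^sup>2"

definition h_vec :: "'u model \<Rightarrow> real vec \<Rightarrow> 'u \<Rightarrow> real vec" where
  "h_vec S p u = vec (nstates S) (\<lambda>i. h_comp S i p u)"


section \<open>Policies and the law of the controlled process\<close>

text \<open>
  A trajectory started at stage \<open>k\<close> maps a stage \<open>s \<ge> k\<close> to the triple
  \<open>(x\<^sub>s, u\<^sub>s\<^sub>-\<^sub>1, y\<^sub>s)\<close>; the controller only sees the pairs \<open>(u\<^sub>s\<^sub>-\<^sub>1, y\<^sub>s)\<close>.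
\<close>

definition obs_space :: "'u model \<Rightarrow> ('u \<times> real vec) measure" where
  "obs_space S = count_space (ctrls S) \<Otimes>\<^sub>M borel_vec"

definition stage_space :: "'u model \<Rightarrow> (nat \<times> 'u \<times> real vec) measure" where
  "stage_space S = count_space {..<nstates S} \<Otimes>\<^sub>M obs_space S"

definition info_space :: "'u model \<Rightarrow> nat \<Rightarrow> nat \<Rightarrow> (nat \<Rightarrow> 'u \<times> real vec) measure" where
  "info_space S k t = (\<Pi>\<^sub>M s\<in>{k..t}. obs_space S)"

definition traj_space :: "'u model \<Rightarrow> nat \<Rightarrow> nat \<Rightarrow> (nat \<Rightarrow> nat \<times> 'u \<times> real vec) measure" where
  "traj_space S k t = (\<Pi>\<^sub>M s\<in>{k..t}. stage_space S)"

definition info :: "nat \<Rightarrow> nat \<Rightarrow> (nat \<Rightarrow> nat \<times> 'u \<times> real vec) \<Rightarrow> nat \<Rightarrow> 'u \<times> real vec" where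
  "info k t \<omega> = (\<lambda>s\<in>{k..t}. snd (\<omega> s))"

text \<open>
  A policy for the stages \<open>k, \<dots>, L\<close> consists of the control \<open>v = u\<^sub>k\<^sub>-\<^sub>1\<close> and of the maps
  \<open>\<eta> t\<close> producing \<open>u\<^sub>t\<close> for \<open>k \<le> t < L\<close>.
\<close>

definition admissible ::
    "'u model \<Rightarrow> nat \<Rightarrow> nat \<Rightarrow> 'u \<Rightarrow> (nat \<Rightarrow> (nat \<Rightarrow> 'u \<times> real vec) \<Rightarrow> 'u) \<Rightarrow> bool" where
  "admissible S L k v \<eta> \<longleftrightarrow> v \<in> ctrls S \<and>
     (\<forall>t\<in>{k..<L}. \<eta> t \<in> info_space S k t \<rightarrow>\<^sub>M count_space (ctrls S))"

definition state_law :: "'u model \<Rightarrow> real vec \<Rightarrow> nat measure" where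
  "state_law S p = point_measure {..<nstates S} (\<lambda>i. ennreal (p $ i))"

definition obs_law :: "'u model \<Rightarrow> nat \<Rightarrow> 'u \<Rightarrow> real vec measure" where
  "obs_law S i u = density (lborel_vec (odim S u)) (\<lambda>y. ennreal (obs_density S i u y))"

text \<open>Law of \<open>(x, u, y)\<close> when \<open>x\<close> has distribution \<open>p\<close> and the control \<open>u\<close> is used for observing \<open>x\<close>.\<close>

definition stage_law :: "'u model \<Rightarrow> real vec \<Rightarrow> 'u \<Rightarrow> (nat \<times> 'u \<times> real vec) measure" where
  "stage_law S p u =
     state_law S p \<bind> (\<lambda>i. distr (obs_law S i u) (stage_space S) (\<lambda>y. (i, u, y)))"

text \<open>Joint law of the stages \<open>k, \<dots>, k + j\<close> when \<open>x\<^sub>k\<close> has distribution \<open>p\<close>.\<close>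

primrec traj_law :: "'u model \<Rightarrow> nat \<Rightarrow> real vec \<Rightarrow> 'u \<Rightarrow>
    (nat \<Rightarrow> (nat \<Rightarrow> 'u \<times> real vec) \<Rightarrow> 'u) \<Rightarrow> nat \<Rightarrow> (nat \<Rightarrow> nat \<times> 'u \<times> real vec) measure" where
  "traj_law S k p v \<eta> 0 =
     distr (stage_law S p v) (traj_space S k k) (\<lambda>z. \<lambda>s\<in>{k}. z)"
| "traj_law S k p v \<eta> (Suc j) =
     traj_law S k p v \<eta> j \<bind> (\<lambda>\<omega>.
       distr (stage_law S (col (tmat S) (fst (\<omega> (k + j)))) (\<eta> (k + j) (info k (k + j) \<omega>)))
         (traj_space S k (k + Suc j)) (\<lambda>z. fun_upd \<omega> (k + Suc j) z))"

text \<open>Predicted belief at stage \<open>k + j\<close> along the trajectory \<open>\<omega>\<close>, when it is \<open>p\<close> at stage \<open>k\<close>.\<close>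

primrec predicted ::
    "'u model \<Rightarrow> nat \<Rightarrow> real vec \<Rightarrow> (nat \<Rightarrow> nat \<times> 'u \<times> real vec) \<Rightarrow> nat \<Rightarrow> real vec" where
  "predicted S k p \<omega> 0 = p"
| "predicted S k p \<omega> (Suc j) =
     (case \<omega> (k + j) of (_, u, y) \<Rightarrow> bayes S (predicted S k p \<omega> j) u y)"

definition remaining_cost ::
    "'u model \<Rightarrow> nat \<Rightarrow> nat \<Rightarrow> real vec \<Rightarrow> (nat \<Rightarrow> nat \<times> 'u \<times> real vec) \<Rightarrow> real" where
  "remaining_cost S L k p \<omega> =
     (\<Sum>t=k..L. case \<omega> t of (_, u, y) \<Rightarrow> stage_cost S (predicted S k p \<omega> (t - k)) u y)"

definition expected_cost :: "'u model \<Rightarrow> nat \<Rightarrow> nat \<Rightarrow> real vec \<Rightarrow> 'u \<Rightarrow>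
    (nat \<Rightarrow> (nat \<Rightarrow> 'u \<times> real vec) \<Rightarrow> 'u) \<Rightarrow> real" where
  "expected_cost S L k p v \<eta> =
     (\<integral>\<omega>. remaining_cost S L k p \<omega> \<partial>traj_law S k p v \<eta> (L - k))"

definition cost_to_go :: "'u model \<Rightarrow> nat \<Rightarrow> nat \<Rightarrow> real vec \<Rightarrow> real" where
  "cost_to_go S L k p = Inf {expected_cost S L k p v \<eta> | v \<eta>. admissible S L k v \<eta>}"

text \<open>
  The expectations exist and the infimum over the policies is attained, so that
  \<open>cost_to_go S L k p\<close> is the minimum of the expected remaining cost.
\<close>

definition cost_to_go_is_min :: "'u model \<Rightarrow> nat \<Rightarrow> nat \<Rightarrow> real vec \<Rightarrow> bool" where
  "cost_to_go_is_min S L k p \<longleftrightarrow>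
     (\<forall>v \<eta>. admissible S L k v \<eta> \<longrightarrow>
        integrable (traj_law S k p v \<eta> (L - k)) (remaining_cost S L k p) \<and>
        cost_to_go S L k p \<le> expected_cost S L k p v \<eta>) \<and>
     (\<exists>v \<eta>. admissible S L k v \<eta> \<and> expected_cost S L k p v \<eta> = cost_to_go S L k p)"

end

theory Submission
  imports Defs
begin

text \<open>
  A Cholesky factor turns Gaussian integrals into integrals against a product of standard normal
  densities, which gives the first two moments of the observations. With them the expected stage cost
  under the belief \<open>p\<close> is \<open>p \<bullet> h_vec S p u\<close>, and the optimality of the linear gain keeps it in
  \<open>[0, 1]\<close>. By Bayes' rule the observations given the past have the law mixed by the predicted
  belief, so the hidden state can be integrated out one stage at a time. Along any policy, the reward
  collected so far plus the optimal value at the current belief then decreases in expectation, and it is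
  constant for a policy that maximizes the one-step value; such a policy exists because the control
  set is finite.
\<close>

section \<open>Cholesky factorization\<close>

text \<open>The stage cost is at most 1 but in general has no lower bound, because the filtered
  belief is affine in a Gaussian observation and may leave the simplex. The squared norm of the
  filtered belief is therefore treated as a nonnegative reward: \<open>ennreal\<close> integrals of
  it need no integrability, so Fubini and composition of kernels apply freely. Returning to real
  costs needs finite totals, and these come from the mean, not from a pointwise bound: a stage
  contributes at most 1 to the mean reward because its mean cost is nonnegative.

  The hidden state is the other obstacle. No conditional distribution is constructed; that the
  belief is the conditional law of the state is expressed as an equality of integrals against
  arbitrary nonnegative functions of the observed history. Keeping beliefs among the probability
  vectors makes every likelihood positive and the matrix inverted in the gain nonsingular, so Bayes'
  rule and the filter hold everywhere, without exceptional null sets.\<close>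

lemma forward_substitution:
  fixes A :: "nat \<Rightarrow> nat \<Rightarrow> real"
  assumes "\<And>i. i < d \<Longrightarrow> A i i \<noteq> 0" and "\<And>i l. i < l \<Longrightarrow> A i l = 0"
  shows "\<exists>x. \<forall>i<d. (\<Sum>l<d. A i l * x l) = b i"
  using assms(1)
proof (induction d)
  case (Suc d)
  then obtain x where x: "\<And>i. i < d \<Longrightarrow> (\<Sum>l<d. A i l * x l) = b i" by auto
  define x' where "x' = x(d := (b d - (\<Sum>l<d. A d l * x l)) / A d d)"
  have "(\<Sum>l<Suc d. A i l * x' l) = b i" if "i < Suc d" for i
  proof -
    have "(\<Sum>l<d. A i l * x' l) = (\<Sum>l<d. A i l * x l)"
      by (intro sum.cong) (auto simp: x'_def)
    then show ?thesis
      using that x[of i] Suc.prems[of d] assms(2)[of i d]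
      by (cases "i = d") (auto simp: x'_def)
  qed
  then show ?case by blast
qed simp

text \<open>This is the transposed system. Fixing the last unknown to \<open>b d / A d d\<close>
  changes the right-hand side of the remaining equations, hence the induction over arbitrary
  \<open>b\<close>.\<close>

lemma backward_substitution:
  fixes A :: "nat \<Rightarrow> nat \<Rightarrow> real"
  assumes "\<And>i. i < d \<Longrightarrow> A i i \<noteq> 0" and "\<And>i l. i < l \<Longrightarrow> A i l = 0"
  shows "\<exists>x. \<forall>l<d. (\<Sum>i<d. A i l * x i) = b l"
  using assms(1)
proof (induction d arbitrary: b)
  case (Suc d)
  from Suc.IH[of "\<lambda>l. b l - A d l * (b d / A d d)"] Suc.prems
  obtain x where x: "\<And>l. l < d \<Longrightarrow> (\<Sum>i<d. A i l * x i) = b l - A d l * (b d / A d d)" by auto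
  define x' where "x' = x(d := b d / A d d)"
  have "(\<Sum>i<Suc d. A i l * x' i) = b l" if "l < Suc d" for l
  proof -
    have "(\<Sum>i<d. A i l * x' i) = (\<Sum>i<d. A i l * x i)"
      by (intro sum.cong) (auto simp: x'_def)
    moreover have "(\<Sum>i<d. A i d * x i) = 0"
      by (intro sum.neutral) (auto simp: assms(2))
    ultimately show ?thesis
      using that x[of l] Suc.prems[of d]
      by (cases "l = d") (auto simp: x'_def)
  qed
  then show ?case by blast
qed simp

text \<open>Bordering: if \<open>A\<close> factors the leading block, the new row solves a
  triangular system with the last column of \<open>Q\<close> on the right, and the new pivot is the
  root of the Schur complement \<open>Q d d - W\<close>. That complement is positive because it is a
  value of the quadratic form.\<close>

lemma cholesky_fun:
  fixes Q :: "nat \<Rightarrow> nat \<Rightarrow> real"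
  assumes "\<And>i j. i < d \<Longrightarrow> j < d \<Longrightarrow> Q i j = Q j i"
    and "\<And>x. \<exists>i<d. x i \<noteq> 0 \<Longrightarrow> (\<Sum>i<d. \<Sum>j<d. x i * Q i j * x j) > 0"
  shows "\<exists>A. (\<forall>i<d. A i i > (0::real)) \<and> (\<forall>i l. i < l \<longrightarrow> A i l = 0) \<and>
    (\<forall>i<d. \<forall>j<d. Q i j = (\<Sum>l<d. A i l * A j l))"
  using assms
proof (induction d)
  case (Suc d)
  have pos: "(\<Sum>i<d. \<Sum>j<d. x i * Q i j * x j) > 0" if "\<exists>i<d. x i \<noteq> 0" for x :: "nat \<Rightarrow> real"
  proof -
    have "(\<Sum>i<d. \<Sum>j<d. x i * Q i j * x j) =
      (\<Sum>i<Suc d. \<Sum>j<Suc d. (x(d := 0)) i * Q i j * (x(d := 0)) j)"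
      by simp
    moreover have "\<dots> > 0"
      using that by (intro Suc.prems(2)) auto
    ultimately show ?thesis by simp
  qed
  have "Q i j = Q j i" if "i < d" "j < d" for i j
    using Suc.prems(1)[of i j] that by simp
  note IH = Suc.IH[OF this pos]
  obtain A where A: "\<And>i. i < d \<Longrightarrow> A i i > 0" "\<And>i l. i < l \<Longrightarrow> A i l = 0"
    "\<And>i j. i < d \<Longrightarrow> j < d \<Longrightarrow> Q i j = (\<Sum>l<d. A i l * A j l)"
    using IH by blast
  have A0: "A i i \<noteq> 0" if "i < d" for i using A(1)[OF that] by simp
  obtain w where w: "\<And>i. i < d \<Longrightarrow> (\<Sum>l<d. A i l * w l) = Q i d"
    using forward_substitution[of d A "\<lambda>i. Q i d"] A0 A(2) by blast
  \<comment> \<open>The leading block is \<open>A\<close> times its transpose, so the two triangular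
    solves make \<open>v\<close> a solution of the block system with the last column of
    \<open>Q\<close> on the right.\<close>
  obtain v where v: "\<And>l. l < d \<Longrightarrow> (\<Sum>i<d. A i l * v i) = w l"
    using backward_substitution[of d A w] A0 A(2) by blast
  define W where "W = (\<Sum>l<d. (w l)\<^sup>2)"
  have vQv: "(\<Sum>i<d. \<Sum>j<d. v i * Q i j * v j) = W"
  proof -
    have "(\<Sum>i<d. \<Sum>j<d. v i * Q i j * v j) =
      (\<Sum>i<d. \<Sum>j<d. \<Sum>l<d. (A i l * v i) * (A j l * v j))"
      by (intro sum.cong refl) (simp add: A(3) sum_distrib_left sum_distrib_right mult_ac)
    also have "\<dots> = (\<Sum>i<d. \<Sum>l<d. \<Sum>j<d. (A i l * v i) * (A j l * v j))"
      by (intro sum.cong refl sum.swap)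
    also have "\<dots> = (\<Sum>l<d. \<Sum>i<d. \<Sum>j<d. (A i l * v i) * (A j l * v j))"
      by (rule sum.swap)
    also have "\<dots> = W"
      unfolding W_def by (intro sum.cong refl) (simp add: sum_product[symmetric] v power2_eq_square)
    finally show ?thesis .
  qed
  have vQ: "(\<Sum>i<d. v i * Q i d) = W"
  proof -
    have "(\<Sum>i<d. v i * Q i d) = (\<Sum>i<d. \<Sum>l<d. (A i l * v i) * w l)"
      by (intro sum.cong refl) (simp add: w[symmetric] sum_distrib_left mult_ac)
    also have "\<dots> = (\<Sum>l<d. \<Sum>i<d. (A i l * v i) * w l)" by (rule sum.swap)
    also have "\<dots> = W"
      unfolding W_def by (intro sum.cong refl) (simp add: sum_distrib_right[symmetric] v power2_eq_square)
    finally show ?thesis .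
  qed
  \<comment> \<open>Among vectors with last coordinate 1 this one minimizes the form, and the
    minimum is the Schur complement.\<close>
  define x where "x = (\<lambda>i. if i < d then - v i else 1)"
  have "0 < (\<Sum>i<Suc d. \<Sum>j<Suc d. x i * Q i j * x j)"
    by (rule Suc.prems(2)) (auto simp: x_def intro!: exI[of _ d])
  also have "\<dots> = (\<Sum>i<d. (\<Sum>j<d. x i * Q i j * x j) + x i * Q i d) + (\<Sum>j<d. Q d j * x j) + Q d d"
    by (simp add: x_def)
  also have "\<dots> = (\<Sum>i<d. \<Sum>j<d. v i * Q i j * v j) - (\<Sum>i<d. v i * Q i d) - (\<Sum>i<d. v i * Q i d) + Q d d"
  proof -
    have "(\<Sum>j<d. Q d j * x j) = - (\<Sum>i<d. v i * Q i d)"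
      unfolding sum_negf[symmetric] by (intro sum.cong refl) (auto simp: x_def Suc.prems(1)[of d])
    moreover have "(\<Sum>i<d. (\<Sum>j<d. x i * Q i j * x j) + x i * Q i d) =
      (\<Sum>i<d. \<Sum>j<d. v i * Q i j * v j) - (\<Sum>i<d. v i * Q i d)"
      unfolding sum_subtractf[symmetric] by (intro sum.cong refl) (auto simp: x_def)
    ultimately show ?thesis by simp
  qed
  finally have c: "Q d d - W > 0" by (simp add: vQv vQ)
  define A' where "A' = (\<lambda>i l. if i < d then A i l else if i = d then
    if l < d then w l else if l = d then sqrt (Q d d - W) else 0 else 0)"
  have "A' i i > 0" if "i < Suc d" for i
    using that c A(1)[of i] by (auto simp: A'_def)
  moreover have "A' i l = 0" if "i < l" for i l
    using that A(2)[of i l] by (auto simp: A'_def)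
  moreover have "Q i j = (\<Sum>l<Suc d. A' i l * A' j l)" if ij: "i < Suc d" "j < Suc d" for i j
  proof -
    have sq: "sqrt (Q d d - W) * sqrt (Q d d - W) = Q d d - W" using c by simp
    consider "i < d" "j < d" | "i < d" "j = d" | "i = d" "j < d" | "i = d" "j = d"
      using ij unfolding less_Suc_eq by blast
    then show ?thesis
    proof cases
      case 3
      then show ?thesis
        using w[of j] Suc.prems(1)[of d j] A(2)[of j d] by (simp add: A'_def mult_ac)
    qed (use A(3)[of i j] A(2)[of i d] A(2)[of j d] w[of i] c sq in
      \<open>auto simp: A'_def W_def power2_eq_square\<close>)
  qed
  ultimately show ?case by blast
qed (auto intro: exI[of _ "\<lambda>_ _. 0"])

section \<open>Gaussian integrals\<close>

lemma vec_measurable [measurable]: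
  "vec d \<in> (\<Pi>\<^sub>M i\<in>{..<d}. (borel :: real measure)) \<rightarrow>\<^sub>M borel_vec"
  unfolding borel_vec_def by (rule measurable_measure_of) auto

lemma space_borel_vec [simp]: "space borel_vec = UNIV"
  by (simp add: borel_vec_def space_measure_of_conv)

text \<open>The sigma-algebra is declared through the maps \<open>vec d\<close>, so measurability
  may be tested in each dimension separately. The target space condition follows because every
  vector is \<open>vec d\<close> of its own coordinates.\<close>

lemma borel_vec_measurableI:
  assumes "\<And>d. (\<lambda>y. f (vec d y)) \<in> (\<Pi>\<^sub>M i\<in>{..<d}. (borel :: real measure)) \<rightarrow>\<^sub>M N"
  shows "f \<in> borel_vec \<rightarrow>\<^sub>M N"
proof (rule measurableI)
  fix v :: "real vec"
  have "(\<lambda>i\<in>{..<dim_vec v}. v $ i) \<in> space (\<Pi>\<^sub>M i\<in>{..<dim_vec v}. (borel :: real measure))"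
    by (auto simp: space_PiM)
  from measurable_space[OF assms this]
  have "f (vec (dim_vec v) (\<lambda>i\<in>{..<dim_vec v}. v $ i)) \<in> space N" .
  also have "vec (dim_vec v) (\<lambda>i\<in>{..<dim_vec v}. v $ i) = v"
    by (intro eq_vecI) auto
  finally show "f v \<in> space N" .
next
  fix B assume B: "B \<in> sets N"
  have "vec d -` (f -` B) \<inter> space (\<Pi>\<^sub>M i\<in>{..<d}. (borel :: real measure))
      \<in> sets (\<Pi>\<^sub>M i\<in>{..<d}. (borel :: real measure))" for d
    using measurable_sets[OF assms[of d] B] by (simp add: vimage_def)
  then show "f -` B \<inter> space borel_vec \<in> sets borel_vec"
    by (simp add: borel_vec_def sets_measure_of_conv space_measure_of_conv)
qed

lemma measurable_vec_index [measurable]: "(\<lambda>y. y $ i) \<in> borel_measurable borel_vec"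
proof (rule borel_vec_measurableI)
  fix d
  show "(\<lambda>y. vec d y $ i) \<in> borel_measurable (\<Pi>\<^sub>M i\<in>{..<d}. (borel :: real measure))"
  proof (cases "i < d")
    case False
    \<comment> \<open>Beyond the length, indexing yields a default that depends on
      \<open>i - d\<close> only, hence a constant in \<open>y\<close>; the lemma can thus be stated
      for every \<open>i\<close>.\<close>
    then have "vec d y $ i = undef_vec (i - d)" for y :: "nat \<Rightarrow> real"
      by transfer (simp add: mk_vec_def)
    then show ?thesis by simp
  qed simp
qed

lemma measurable_borel_vecI:
  assumes "\<And>x. x \<in> space M \<Longrightarrow> f x \<in> carrier_vec n"
    and "\<And>i. i < n \<Longrightarrow> (\<lambda>x. f x $ i) \<in> borel_measurable M"
  shows "f \<in> M \<rightarrow>\<^sub>M borel_vec"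
proof -
  have "(\<lambda>x. vec n (\<lambda>i\<in>{..<n}. f x $ i)) \<in> M \<rightarrow>\<^sub>M borel_vec"
    by (rule measurable_compose[OF measurable_restrict vec_measurable]) (simp add: assms(2))
  also have "?this \<longleftrightarrow> ?thesis"
    by (intro measurable_cong eq_vecI) (auto simp: carrier_vecD[OF assms(1)])
  finally show ?thesis .
qed

lemma vec_measurable_lborel [measurable]:
  "vec d \<in> (\<Pi>\<^sub>M i\<in>{..<d}. (lborel :: real measure)) \<rightarrow>\<^sub>M borel_vec"
  using vec_measurable[of d] by (simp cong: measurable_cong_sets sets_PiM_cong)

lemma sets_lborel_vec [simp, measurable_cong]: "sets (lborel_vec d) = sets borel_vec"
  by (simp add: lborel_vec_def)

lemma space_lborel_vec [simp]: "space (lborel_vec d) = UNIV"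
  by (simp add: lborel_vec_def)

text \<open>Affine change of variables reduced to dimension one by Fubini: with the earlier
  coordinates fixed, the last one is affine in the last variable with slope \<open>A d d\<close>.
  The Jacobian is the product of these slopes.\<close>

lemma nn_integral_triangular:
  fixes A :: "nat \<Rightarrow> nat \<Rightarrow> real"
  assumes "\<And>i. i < d \<Longrightarrow> A i i > 0" and A0: "\<And>i l. i < l \<Longrightarrow> A i l = 0"
    and "F \<in> borel_measurable (\<Pi>\<^sub>M i\<in>{..<d}. (lborel :: real measure))"
  shows "(\<integral>\<^sup>+y. F y \<partial>(\<Pi>\<^sub>M i\<in>{..<d}. (lborel :: real measure))) =
    ennreal (\<Prod>i<d. A i i) *
    (\<integral>\<^sup>+z. F (\<lambda>i\<in>{..<d}. m i + (\<Sum>l<d. A i l * z l)) \<partial>(\<Pi>\<^sub>M i\<in>{..<d}. (lborel :: real measure)))"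
  using assms(1,3)
proof (induction d arbitrary: F)
  case 0
  then show ?case
    by (auto simp: PiM_empty nn_integral_count_space_finite restrict_def)
next
  case (Suc d)
  interpret product_sigma_finite "\<lambda>_::nat. lborel :: real measure" ..
  let ?M = "\<lambda>d. \<Pi>\<^sub>M i\<in>{..<d}. (lborel :: real measure)"
  have ins: "{..<Suc d} = insert d {..<d}" by auto
  note F [measurable] = Suc.prems(2)
  define T where "T = (\<lambda>d z. (\<lambda>i\<in>{..<d}. m i + (\<Sum>l<d. A i l * z l)))"
  have T [measurable]: "T d \<in> ?M d \<rightarrow>\<^sub>M ?M d" for d
    unfolding T_def by measurable
  have FT [measurable]: "(\<lambda>p. F ((fst p)(d := snd p))) \<in> borel_measurable (?M d \<Otimes>\<^sub>M lborel)"
    using measurable_compose[OF measurable_add_dim F[unfolded ins]] by (simp add: split_beta' fun_upd_def)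
  have "(\<lambda>y. \<integral>\<^sup>+t. F (y(d := t)) \<partial>lborel) \<in> borel_measurable (?M d)"
    using FT by (intro lborel.borel_measurable_nn_integral) (simp add: split_beta')
  note IH = Suc.IH[OF Suc.prems(1)[OF less_SucI] this]
  \<comment> \<open>Column \<open>d\<close> vanishes in the rows above \<open>d\<close>, so the new
    variable \<open>s\<close> leaves the earlier coordinates unchanged.\<close>
  have TS: "T (Suc d) (z(d := s)) = (T d z)(d := (m d + (\<Sum>l<d. A d l * z l)) + A d d * s)" for z s
    by (rule ext) (auto simp: T_def A0 restrict_def intro!: sum.cong)
  have "(\<integral>\<^sup>+y. F y \<partial>?M (Suc d)) = (\<integral>\<^sup>+y. (\<integral>\<^sup>+t. F (y(d := t)) \<partial>lborel) \<partial>?M d)"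
    unfolding ins by (rule product_nn_integral_insert) (use F in \<open>auto simp: ins\<close>)
  also have "\<dots> = ennreal (\<Prod>i<d. A i i) * (\<integral>\<^sup>+z. (\<integral>\<^sup>+t. F ((T d z)(d := t)) \<partial>lborel) \<partial>?M d)"
    unfolding T_def by (rule IH)
  also have "(\<integral>\<^sup>+z. (\<integral>\<^sup>+t. F ((T d z)(d := t)) \<partial>lborel) \<partial>?M d) =
    (\<integral>\<^sup>+z. ennreal (A d d) * (\<integral>\<^sup>+s. F (T (Suc d) (z(d := s))) \<partial>lborel) \<partial>?M d)"
  proof (rule nn_integral_cong)
    fix z assume z: "z \<in> space (?M d)"
    have "(\<lambda>t. F ((T d z)(d := t))) \<in> borel_measurable lborel"
      using measurable_compose[OF measurable_Pair1'[OF measurable_space[OF T z]] FT] by simp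
    then show "(\<integral>\<^sup>+t. F ((T d z)(d := t)) \<partial>lborel) =
        ennreal (A d d) * (\<integral>\<^sup>+s. F (T (Suc d) (z(d := s))) \<partial>lborel)"
      unfolding TS using Suc.prems(1)[of d]
      by (subst nn_integral_real_affine[where c = "A d d" and t = "m d + (\<Sum>l<d. A d l * z l)"]) auto
  qed
  also have "\<dots> = ennreal (A d d) * (\<integral>\<^sup>+z. (\<integral>\<^sup>+s. F (T (Suc d) (z(d := s))) \<partial>lborel) \<partial>?M d)"
  proof (rule nn_integral_cmult)
    have "(\<lambda>(z, s). F (T (Suc d) (z(d := s)))) \<in> borel_measurable (?M d \<Otimes>\<^sub>M lborel)"
      using measurable_compose[OF measurable_add_dim measurable_compose[OF T[of "Suc d", unfolded ins] F[unfolded ins]]]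
      by (simp add: split_beta' ins)
    then show "(\<lambda>z. \<integral>\<^sup>+s. F (T (Suc d) (z(d := s))) \<partial>lborel) \<in> borel_measurable (?M d)"
      by (rule lborel.borel_measurable_nn_integral)
  qed
  also have "(\<integral>\<^sup>+z. (\<integral>\<^sup>+s. F (T (Suc d) (z(d := s))) \<partial>lborel) \<partial>?M d) =
    (\<integral>\<^sup>+z. F (T (Suc d) z) \<partial>?M (Suc d))"
    unfolding ins
    by (rule product_nn_integral_insert[symmetric])
      (use measurable_compose[OF T[of "Suc d"] F] in \<open>auto simp: ins\<close>)
  moreover have "ennreal (\<Prod>i<Suc d. A i i) = ennreal (\<Prod>i<d. A i i) * ennreal (A d d)"
    unfolding prod.lessThan_Suc using Suc.prems(1)
    by (intro ennreal_mult prod_nonneg) (auto simp: less_imp_le)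
  ultimately have "(\<integral>\<^sup>+y. F y \<partial>?M (Suc d)) =
      ennreal (\<Prod>i<Suc d. A i i) * (\<integral>\<^sup>+z. F (T (Suc d) z) \<partial>?M (Suc d))"
    by (simp only: mult.assoc)
  then show ?case by (simp only: T_def)
qed

text \<open>Expanding the square leaves the moments of order 0, 1, 2 of the standard normal law,
  which are 1, 0, 1. The exponents stay in the shape \<open>2 * 0\<close>, \<open>2 * 0 + 1\<close>,
  \<open>2 * 1\<close> so as to match the moment formulas.\<close>

lemma nn_integral_std_normal_square:
  assumes "k \<ge> 0"
  shows "(\<integral>\<^sup>+s. ennreal ((k + (c + b * s)\<^sup>2) * std_normal_density s) \<partial>lborel) = ennreal (k + c\<^sup>2 + b\<^sup>2)"
proof -
  have 0: "has_bochner_integral lborel (\<lambda>s. std_normal_density s * s ^ (2 * 0)) (fact (2 * 0) / (2^0 * fact 0))"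
    by (rule std_normal_moment_even)
  have 1: "has_bochner_integral lborel (\<lambda>s. std_normal_density s * s ^ (2 * 0 + 1)) 0"
    by (rule std_normal_moment_odd)
  have 2: "has_bochner_integral lborel (\<lambda>s. std_normal_density s * s ^ (2 * 1)) (fact (2 * 1) / (2^1 * fact 1))"
    by (rule std_normal_moment_even)
  have "has_bochner_integral lborel (\<lambda>s. (k + c\<^sup>2) * (std_normal_density s * s ^ (2 * 0)) +
      2 * c * b * (std_normal_density s * s ^ (2 * 0 + 1)) + b\<^sup>2 * (std_normal_density s * s ^ (2 * 1)))
      ((k + c\<^sup>2) * (fact (2 * 0) / (2^0 * fact 0)) + 2 * c * b * 0 + b\<^sup>2 * (fact (2 * 1) / (2^1 * fact 1)))"
    by (intro has_bochner_integral_add has_bochner_integral_mult_right 0 1 2)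
  also have "(\<lambda>s. (k + c\<^sup>2) * (std_normal_density s * s ^ (2 * 0)) +
      2 * c * b * (std_normal_density s * s ^ (2 * 0 + 1)) + b\<^sup>2 * (std_normal_density s * s ^ (2 * 1))) =
      (\<lambda>s. (k + (c + b * s)\<^sup>2) * std_normal_density s)"
    by (rule ext) (simp add: algebra_simps power2_eq_square)
  finally have I: "has_bochner_integral lborel (\<lambda>s. (k + (c + b * s)\<^sup>2) * std_normal_density s) (k + c\<^sup>2 + b\<^sup>2)"
    by (simp add: fact_numeral)
  then show ?thesis
    using assms
    by (subst nn_integral_eq_integral) (auto simp: has_bochner_integral_iff intro!: AE_I2 mult_nonneg_nonneg add_nonneg_nonneg)
qed

text \<open>The offset \<open>k\<close> makes the induction close: integrating out the last
  coordinate turns its coefficient into an extra \<open>(b d)\<^sup>2\<close> inside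
  \<open>k\<close>.\<close>

lemma nn_integral_std_normal_product:
  fixes d :: nat
  assumes "k \<ge> 0"
  shows "(\<integral>\<^sup>+z. ennreal ((k + (a + (\<Sum>i<d. b i * z i))\<^sup>2) * (\<Prod>i<d. std_normal_density (z i)))
      \<partial>(\<Pi>\<^sub>M i\<in>{..<d}. lborel)) = ennreal (k + a\<^sup>2 + (\<Sum>i<d. (b i)\<^sup>2))"
  using assms
proof (induction d arbitrary: k)
  case 0
  then show ?case by (simp add: PiM_empty nn_integral_count_space_finite)
next
  case (Suc d)
  interpret product_sigma_finite "\<lambda>_::nat. lborel :: real measure" ..
  let ?M = "\<lambda>d. \<Pi>\<^sub>M i\<in>{..<d}. (lborel :: real measure)"
  have ins: "{..<Suc d} = insert d {..<d}" by auto
  have "(\<integral>\<^sup>+z. ennreal ((k + (a + (\<Sum>i<Suc d. b i * z i))\<^sup>2) * (\<Prod>i<Suc d. std_normal_density (z i))) \<partial>?M (Suc d))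
    = (\<integral>\<^sup>+z. (\<integral>\<^sup>+s. ennreal ((k + (a + (\<Sum>i<Suc d. b i * (z(d := s)) i))\<^sup>2) *
        (\<Prod>i<Suc d. std_normal_density ((z(d := s)) i))) \<partial>lborel) \<partial>?M d)"
    unfolding ins by (rule product_nn_integral_insert) auto
  also have "\<dots> = (\<integral>\<^sup>+z. ennreal (((k + (b d)\<^sup>2) + (a + (\<Sum>i<d. b i * z i))\<^sup>2) *
      (\<Prod>i<d. std_normal_density (z i))) \<partial>?M d)"
  proof (rule nn_integral_cong)
    fix z :: "nat \<Rightarrow> real"
    have P: "0 \<le> (\<Prod>i<d. std_normal_density (z i))" by (intro prod_nonneg) auto
    have "(\<integral>\<^sup>+s. ennreal ((k + (a + (\<Sum>i<Suc d. b i * (z(d := s)) i))\<^sup>2) *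
        (\<Prod>i<Suc d. std_normal_density ((z(d := s)) i))) \<partial>lborel) =
      (\<integral>\<^sup>+s. ennreal (\<Prod>i<d. std_normal_density (z i)) *
        ennreal ((k + ((a + (\<Sum>i<d. b i * z i)) + b d * s)\<^sup>2) * std_normal_density s) \<partial>lborel)"
      using P by (intro nn_integral_cong) (simp add: ennreal_mult'[symmetric] mult_ac add_ac)
    also have "\<dots> = ennreal (\<Prod>i<d. std_normal_density (z i)) *
        ennreal (k + (a + (\<Sum>i<d. b i * z i))\<^sup>2 + (b d)\<^sup>2)"
      using Suc.prems by (subst nn_integral_cmult) (auto simp: nn_integral_std_normal_square)
    also have "\<dots> = ennreal (((k + (b d)\<^sup>2) + (a + (\<Sum>i<d. b i * z i))\<^sup>2) *
      (\<Prod>i<d. std_normal_density (z i)))"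
      using P by (simp add: ennreal_mult'[symmetric] mult_ac add_ac)
    finally show "(\<integral>\<^sup>+s. ennreal ((k + (a + (\<Sum>i<Suc d. b i * (z(d := s)) i))\<^sup>2) *
        (\<Prod>i<Suc d. std_normal_density ((z(d := s)) i))) \<partial>lborel) = \<dots>" .
  qed
  also have "\<dots> = ennreal ((k + (b d)\<^sup>2) + a\<^sup>2 + (\<Sum>i<d. (b i)\<^sup>2))"
    using Suc.prems by (intro Suc.IH) auto
  finally show ?case by (simp add: add_ac)
qed

section \<open>Gaussian densities with positive definite covariance\<close>

lemma scalar_prod_mult_mat_vec:
  assumes "Q \<in> carrier_mat d e" "x \<in> carrier_vec d" "y \<in> carrier_vec e"
  shows "x \<bullet> (Q *\<^sub>v y) = (\<Sum>i<d. \<Sum>j<e. x $ i * Q $$ (i, j) * y $ j)"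
  using assms by (auto simp: scalar_prod_def sum_distrib_left mult_ac lessThan_atLeast0 intro!: sum.cong)

lemma minv_inverse:
  assumes A: "A \<in> carrier_mat d d" and det: "det A \<noteq> 0"
  shows "minv A \<in> carrier_mat d d" "A * minv A = 1\<^sub>m d" "minv A * A = 1\<^sub>m d"
proof -
  have "A \<in> Units (ring_mat TYPE(real) d ())"
    by (rule det_non_zero_imp_unit[OF A det])
  then obtain B where "mat_inverse A = Some B"
    using mat_inverse(1)[OF A, where b = "()"] by (cases "mat_inverse A") auto
  then show "minv A \<in> carrier_mat d d" "A * minv A = 1\<^sub>m d" "minv A * A = 1\<^sub>m d"
    using mat_inverse(2)[OF A] by (auto simp: minv_def)
qed

lemma pos_def_cholesky:
  assumes "pos_def d Q"
  obtains A :: "nat \<Rightarrow> nat \<Rightarrow> real" where "\<And>i. i < d \<Longrightarrow> A i i > 0" "\<And>i l. i < l \<Longrightarrow> A i l = 0"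
    "Q = mat d d (\<lambda>(i, j). A i j) * (mat d d (\<lambda>(i, j). A i j))\<^sup>T"
proof -
  have Q: "Q \<in> carrier_mat d d" and sym: "Q\<^sup>T = Q"
    and pos: "\<And>x. x \<in> carrier_vec d \<Longrightarrow> x \<noteq> 0\<^sub>v d \<Longrightarrow> x \<bullet> (Q *\<^sub>v x) > 0"
    using assms by (auto simp: pos_def_def)
  have "Q $$ (i, j) = Q $$ (j, i)" if "i < d" "j < d" for i j
    using arg_cong[OF sym, of "\<lambda>M. M $$ (i, j)"] Q that by auto
  moreover have "(\<Sum>i<d. \<Sum>j<d. x i * Q $$ (i, j) * x j) > 0" if x: "\<exists>i<d. x i \<noteq> 0" for x
  proof -
    have "vec d x \<noteq> 0\<^sub>v d"
    proof
      assume "vec d x = 0\<^sub>v d"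
      then have "\<forall>i<d. x i = 0" by (metis index_vec index_zero_vec(1))
      with x show False by blast
    qed
    from pos[OF _ this] show ?thesis
      using scalar_prod_mult_mat_vec[OF Q, of "vec d x" "vec d x"] by simp
  qed
  ultimately obtain A where A: "\<forall>i<d. A i i > (0::real)" "\<forall>i l. i < l \<longrightarrow> A i l = 0"
    and QA: "\<forall>i<d. \<forall>j<d. Q $$ (i, j) = (\<Sum>l<d. A i l * A j l)"
    using cholesky_fun[of d "\<lambda>i j. Q $$ (i, j)"] by auto
  have "Q = mat d d (\<lambda>(i, j). A i j) * (mat d d (\<lambda>(i, j). A i j))\<^sup>T"
    using Q QA by (intro eq_matI) (auto simp: scalar_prod_def lessThan_atLeast0)
  with A show ?thesis by (intro that) auto
qed

lemma gaussian_density_measurable [measurable]: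
  assumes "m \<in> carrier_vec d"
  shows "gaussian_density m Q \<in> borel_measurable borel_vec"
proof -
  have d: "dim_vec m = d" using assms by simp
  have "(\<lambda>y. y - m) \<in> borel_vec \<rightarrow>\<^sub>M borel_vec"
    by (rule measurable_borel_vecI[of _ _ d]) (simp_all add: d carrier_vecI)
  then have [measurable]: "(\<lambda>y. (y - m) $ i) \<in> borel_measurable borel_vec" for i
    by (rule measurable_compose[OF _ measurable_vec_index])
  have "(y - m) \<bullet> (minv Q *\<^sub>v (y - m)) =
      (\<Sum>i<dim_row (minv Q). (y - m) $ i * (\<Sum>j<d. row (minv Q) i $ j * (y - m) $ j))" for y
    using assms by (simp add: scalar_prod_def lessThan_atLeast0)
  then show ?thesis
    unfolding gaussian_density_def[abs_def] by simp
qed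

text \<open>Substitute \<open>m\<close> plus \<open>B *\<^sub>v z\<close> for \<open>y\<close>,
  where \<open>B\<close> is the Cholesky factor. The exponent becomes that of independent standard
  normals, and the linear form \<open>g\<close> becomes \<open>B\<^sup>T *\<^sub>v g\<close>, whose
  squared norm is the quadratic form of \<open>Q\<close> at \<open>g\<close>. With \<open>k\<close>
  and \<open>a\<close> free, the one formula yields both the total mass and the second moments about
  any point.\<close>

lemma gaussian_moment:
  assumes Q: "pos_def d Q" and m: "m \<in> carrier_vec d" and g: "g \<in> carrier_vec d" and k: "k \<ge> 0"
  shows "(\<integral>\<^sup>+y. ennreal ((k + (a + g \<bullet> (y - m))\<^sup>2) * gaussian_density m Q y) \<partial>lborel_vec d) =
    ennreal (k + a\<^sup>2 + g \<bullet> (Q *\<^sub>v g))"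
proof -
  obtain A :: "nat \<Rightarrow> nat \<Rightarrow> real" where Apos: "\<And>i. i < d \<Longrightarrow> A i i > 0" and A0: "\<And>i l. i < l \<Longrightarrow> A i l = 0"
    and QA: "Q = mat d d (\<lambda>(i, j). A i j) * (mat d d (\<lambda>(i, j). A i j))\<^sup>T"
    using pos_def_cholesky[OF Q] by metis
  define B where "B = mat d d (\<lambda>(i, j). A i j)"
  have B [simp]: "B \<in> carrier_mat d d" "B\<^sup>T \<in> carrier_mat d d" by (auto simp: B_def)
  have QB: "Q = B * B\<^sup>T" using QA by (simp add: B_def)
  define D where "D = (\<Prod>i<d. A i i)"
  have D: "D > 0" unfolding D_def by (intro prod_pos) (auto simp: Apos)
  have detB: "det B = D"
    by (subst det_lower_triangular[of d])
      (auto simp: B_def A0 prod_list_diag_prod D_def lessThan_atLeast0)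
  have detQ: "det Q = D\<^sup>2"
    using det_mult[of B d "B\<^sup>T"] det_transpose[of B d] by (simp add: QB detB power2_eq_square)
  have Qc: "Q \<in> carrier_mat d d" unfolding QB by (rule mult_carrier_mat[OF B])
  have dq: "det Q \<noteq> 0" using detQ D by simp
  note iQ = minv_inverse[OF Qc dq]
  have Binj: "v = w" if "B *\<^sub>v v = B *\<^sub>v w" "v \<in> carrier_vec d" "w \<in> carrier_vec d" for v w
  proof -
    note iB = minv_inverse[OF B(1)]
    have "minv B *\<^sub>v (B *\<^sub>v u) = u" if "u \<in> carrier_vec d" for u
      using that iB D detB by (simp add: assoc_mult_mat_vec[symmetric, of _ d d _ d])
    then show ?thesis using that by metis
  qed
  \<comment> \<open>In effect the inverse of \<open>Q\<close> is factored through the inverses of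
    the two triangular factors. The transpose need not be inverted: \<open>B\<close> is injective,
    which forces \<open>B\<^sup>T *\<^sub>v w\<close> to be \<open>z\<close>.\<close>
  have quad: "(B *\<^sub>v z) \<bullet> (minv Q *\<^sub>v (B *\<^sub>v z)) = z \<bullet> z" if z: "z \<in> carrier_vec d" for z
  proof -
    define w where "w = minv Q *\<^sub>v (B *\<^sub>v z)"
    have w: "w \<in> carrier_vec d"
      unfolding w_def by (rule mult_mat_vec_carrier[OF iQ(1) mult_mat_vec_carrier[OF B(1) z]])
    have "B *\<^sub>v (B\<^sup>T *\<^sub>v w) = Q *\<^sub>v w"
      unfolding QB by (rule assoc_mult_mat_vec[OF B w, symmetric])
    also have "\<dots> = B *\<^sub>v z"
      unfolding w_def assoc_mult_mat_vec[OF Qc iQ(1) mult_mat_vec_carrier[OF B(1) z], symmetric] iQ(2)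
      by (rule one_mult_mat_vec[OF mult_mat_vec_carrier[OF B(1) z]])
    finally have "B\<^sup>T *\<^sub>v w = z"
      by (rule Binj[OF _ mult_mat_vec_carrier[OF B(2) w] z])
    then show ?thesis
      unfolding w_def[symmetric] using transpose_vec_mult_scalar[OF B(1) z w]
        comm_scalar_prod[OF w mult_mat_vec_carrier[OF B(1) z]] by simp
  qed
  define b where "b = B\<^sup>T *\<^sub>v g"
  have b: "b \<in> carrier_vec d" unfolding b_def by (rule mult_mat_vec_carrier[OF B(2) g])
  have bb: "(\<Sum>i<d. (b $ i)\<^sup>2) = g \<bullet> (Q *\<^sub>v g)"
  proof -
    have "(\<Sum>i<d. (b $ i)\<^sup>2) = b \<bullet> b"
      using b by (auto simp: scalar_prod_def power2_eq_square lessThan_atLeast0)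
    also have "\<dots> = g \<bullet> (B *\<^sub>v b)"
      using transpose_vec_mult_scalar[OF B(1) b g] by (simp only: b_def)
    also have "B *\<^sub>v b = Q *\<^sub>v g"
      unfolding QB b_def by (rule assoc_mult_mat_vec[OF B g, symmetric])
    finally show ?thesis .
  qed
  let ?y = "\<lambda>z. vec d (\<lambda>i\<in>{..<d}. m $ i + (\<Sum>l<d. A i l * z l))"
  have ym: "?y z - m = B *\<^sub>v vec d z" for z
    using m by (intro eq_vecI) (auto simp: B_def scalar_prod_def lessThan_atLeast0)
  have gy: "g \<bullet> (?y z - m) = (\<Sum>i<d. b $ i * z i)" for z
  proof -
    have "g \<bullet> (?y z - m) = b \<bullet> vec d z"
      unfolding ym b_def by (rule transpose_vec_mult_scalar[OF B(1) vec_carrier g, symmetric])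
    then show ?thesis
      by (simp add: scalar_prod_def lessThan_atLeast0)
  qed
  \<comment> \<open>The Jacobian \<open>D\<close> equals the root of \<open>det Q\<close> and
    cancels it in the normalization.\<close>
  have dens: "D * gaussian_density m Q (?y z) = (\<Prod>i<d. std_normal_density (z i))" for z
  proof -
    have "(\<Prod>i<d. std_normal_density (z i)) = (1 / sqrt (2 * pi)) ^ d * exp (- (\<Sum>i<d. (z i)\<^sup>2) / 2)"
    proof -
      have "exp (- (\<Sum>i<d. (z i)\<^sup>2) / 2) = (\<Prod>i<d. exp (- (z i)\<^sup>2 / 2))"
        by (simp add: exp_sum[symmetric] sum_negf sum_divide_distrib)
      then show ?thesis
        by (simp add: std_normal_density_def prod_dividef power_one_over)
    qed
    moreover have "gaussian_density m Q (?y z) = exp (- (\<Sum>i<d. (z i)\<^sup>2) / 2) / sqrt ((2 * pi) ^ d * D\<^sup>2)"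
      unfolding gaussian_density_def ym quad[OF vec_carrier] detQ using m
      by (simp add: scalar_prod_def lessThan_atLeast0 power2_eq_square)
    moreover have "sqrt ((2 * pi) ^ d * D\<^sup>2) = sqrt (2 * pi) ^ d * D"
      using D by (simp add: real_sqrt_mult real_sqrt_power power_mult_distrib)
    ultimately show ?thesis
      using D by (simp only: power_one_over) simp
  qed
  let ?F = "\<lambda>y. ennreal ((k + (a + g \<bullet> (y - m))\<^sup>2) * gaussian_density m Q y)"
  have meas [measurable]: "?F \<in> borel_measurable borel_vec"
  proof -
    have "g \<bullet> (y - m) = (\<Sum>j<d. g $ j * (y $ j - m $ j))" for y
      using m by (simp add: scalar_prod_def lessThan_atLeast0)
    moreover have [measurable]: "gaussian_density m Q \<in> borel_measurable borel_vec"
      using m by (rule gaussian_density_measurable)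
    ultimately show ?thesis by simp
  qed
  have measv [measurable]: "(\<lambda>z. ?F (vec d z)) \<in> borel_measurable (\<Pi>\<^sub>M i\<in>{..<d}. (lborel :: real measure))"
    by (rule measurable_compose[OF vec_measurable_lborel meas])
  have [measurable]: "(\<lambda>z. \<lambda>i\<in>{..<d}. m $ i + (\<Sum>l<d. A i l * z l)) \<in>
      (\<Pi>\<^sub>M i\<in>{..<d}. (lborel :: real measure)) \<rightarrow>\<^sub>M (\<Pi>\<^sub>M i\<in>{..<d}. (lborel :: real measure))"
    by measurable
  have "(\<integral>\<^sup>+y. ?F y \<partial>lborel_vec d) = (\<integral>\<^sup>+y. ?F (vec d y) \<partial>(\<Pi>\<^sub>M i\<in>{..<d}. (lborel :: real measure)))"
    unfolding lborel_vec_def by (rule nn_integral_distr[OF vec_measurable_lborel]) (use meas in simp)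
  also have "\<dots> = ennreal D * (\<integral>\<^sup>+z. ?F (?y z) \<partial>(\<Pi>\<^sub>M i\<in>{..<d}. (lborel :: real measure)))"
    unfolding D_def by (rule nn_integral_triangular[where F = "\<lambda>y. ?F (vec d y)"]) (use Apos A0 measv in blast)+
  also have "\<dots> = (\<integral>\<^sup>+z. ennreal D * ?F (?y z) \<partial>(\<Pi>\<^sub>M i\<in>{..<d}. (lborel :: real measure)))"
    by (rule nn_integral_cmult[symmetric], rule measurable_compose[OF _ measv]) measurable
  also have "\<dots> = (\<integral>\<^sup>+z. ennreal ((k + (a + (\<Sum>i<d. b $ i * z i))\<^sup>2) * (\<Prod>i<d. std_normal_density (z i)))
      \<partial>(\<Pi>\<^sub>M i\<in>{..<d}. lborel))"
    unfolding gy dens[symmetric] ennreal_mult'[OF less_imp_le[OF D], symmetric] mult.left_commute[of D] ..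
  also have "\<dots> = ennreal (k + a\<^sup>2 + g \<bullet> (Q *\<^sub>v g))"
    by (simp add: nn_integral_std_normal_product[OF k] bb)
  finally show ?thesis .
qed

lemma gaussian_density_pos:
  assumes "pos_def d Q" "m \<in> carrier_vec d"
  shows "gaussian_density m Q y > 0"
proof -
  obtain A :: "nat \<Rightarrow> nat \<Rightarrow> real" where Apos: "\<And>i. i < d \<Longrightarrow> A i i > 0" and A0: "\<And>i l. i < l \<Longrightarrow> A i l = 0"
    and QA: "Q = mat d d (\<lambda>(i, j). A i j) * (mat d d (\<lambda>(i, j). A i j))\<^sup>T"
    using pos_def_cholesky[OF assms(1)] by metis
  have "det (mat d d (\<lambda>(i, j). A i j)) = (\<Prod>i<d. A i i)"
    by (subst det_lower_triangular[of d])
      (auto simp: A0 prod_list_diag_prod lessThan_atLeast0)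
  moreover have "(\<Prod>i<d. A i i) > 0" by (intro prod_pos) (auto simp: Apos)
  ultimately have "det Q > 0"
    unfolding QA by (subst det_mult[of _ d]) (auto simp: det_transpose[of _ d])
  then show ?thesis by (simp add: gaussian_density_def)
qed

section \<open>Measurability of inverses and of maximizers\<close>

lemma borel_measurable_det:
  fixes A :: "'a \<Rightarrow> real mat"
  assumes c: "\<And>x. x \<in> space N \<Longrightarrow> A x \<in> carrier_mat d d"
    and m: "\<And>i j. i < d \<Longrightarrow> j < d \<Longrightarrow> (\<lambda>x. A x $$ (i, j)) \<in> borel_measurable N"
  shows "(\<lambda>x. det (A x)) \<in> borel_measurable N"
proof -
  have "(\<lambda>x. \<Sum>\<pi>\<in>{\<pi>. \<pi> permutes {0..<d}}. signof \<pi> * (\<Prod>i = 0..<d. A x $$ (i, \<pi> i))) \<in> borel_measurable N"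
  proof (intro borel_measurable_sum borel_measurable_times borel_measurable_const borel_measurable_prod m)
    fix \<pi> i assume "\<pi> \<in> {\<pi>. \<pi> permutes {0..<d}}" "i \<in> {0..<d}"
    then show "\<pi> i < d" using permutes_in_image[of \<pi> "{0..<d}" i] by simp
  qed simp
  also have "?this \<longleftrightarrow> ?thesis"
    by (intro measurable_cong) (simp add: det_def'[OF c])
  finally show ?thesis .
qed

text \<open>Cramer's rule. \<open>mat_inverse\<close> is computed by elimination, whose branching on
  pivots hides how the result depends on the entries; a quotient of determinants is visibly
  measurable in them.\<close>

lemma minv_index:
  assumes A: "A \<in> carrier_mat d d" and det: "det A \<noteq> 0" and ij: "i < d" "j < d"
  shows "minv A $$ (i, j) = cofactor A j i / det A"
proof -
  note iA = minv_inverse[OF A det]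
  note adj = adj_mat[OF A]
  have "adj_mat A = (minv A * A) * adj_mat A"
    unfolding iA(3) using adj(1) by simp
  also have "\<dots> = minv A * (A * adj_mat A)"
    by (rule assoc_mult_mat[OF iA(1) A adj(1)])
  also have "\<dots> = det A \<cdot>\<^sub>m minv A"
    unfolding adj(2) using iA(1) by (simp add: mult_smult_distrib[of _ d d _ d])
  finally have "adj_mat A $$ (i, j) = det A * minv A $$ (i, j)"
    using iA(1) ij by simp
  then show ?thesis
    using det A ij by (simp add: adj_mat_def)
qed

lemma borel_measurable_minv:
  assumes c: "\<And>x. x \<in> space N \<Longrightarrow> A x \<in> carrier_mat d d"
    and det: "\<And>x. x \<in> space N \<Longrightarrow> det (A x) \<noteq> 0"
    and m: "\<And>i j. i < d \<Longrightarrow> j < d \<Longrightarrow> (\<lambda>x. A x $$ (i, j)) \<in> borel_measurable N"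
    and ij: "i < d" "j < d"
  shows "(\<lambda>x. minv (A x) $$ (i, j)) \<in> borel_measurable N"
proof -
  have "(\<lambda>x. det (mat_delete (A x) j i)) \<in> borel_measurable N"
  proof (rule borel_measurable_det)
    show "mat_delete (A x) j i \<in> carrier_mat (d - 1) (d - 1)" if "x \<in> space N" for x
      using mat_delete_carrier[OF c[OF that]] by simp
    fix i' j' assume ij': "i' < d - 1" "j' < d - 1"
    have "(\<lambda>x. A x $$ (if i' < j then i' else Suc i', if j' < i then j' else Suc j')) \<in> borel_measurable N"
      using ij' by (intro m) auto
    also have "?this \<longleftrightarrow> (\<lambda>x. mat_delete (A x) j i $$ (i', j')) \<in> borel_measurable N"
    proof (rule measurable_cong)
      fix x assume "x \<in> space N"
      from carrier_matD[OF c[OF this]] ij'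
      show "A x $$ (if i' < j then i' else Suc i', if j' < i then j' else Suc j') = mat_delete (A x) j i $$ (i', j')"
        by (simp add: mat_delete_def)
    qed
    finally show "(\<lambda>x. mat_delete (A x) j i $$ (i', j')) \<in> borel_measurable N" .
  qed
  moreover have "(\<lambda>x. det (A x)) \<in> borel_measurable N"
    by (rule borel_measurable_det[OF c m])
  ultimately have "(\<lambda>x. cofactor (A x) j i / det (A x)) \<in> borel_measurable N"
    unfolding cofactor_def by measurable
  also have "?this \<longleftrightarrow> ?thesis"
    by (rule measurable_cong) (simp add: minv_index[OF c det ij])
  finally show ?thesis .
qed

lemma borel_measurable_mult_mat:
  fixes A B :: "'a \<Rightarrow> real mat"
  assumes "\<And>x. x \<in> space N \<Longrightarrow> A x \<in> carrier_mat k l" "\<And>x. x \<in> space N \<Longrightarrow> B x \<in> carrier_mat l m"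
    and "\<And>i j. i < k \<Longrightarrow> j < l \<Longrightarrow> (\<lambda>x. A x $$ (i, j)) \<in> borel_measurable N"
    and "\<And>i j. i < l \<Longrightarrow> j < m \<Longrightarrow> (\<lambda>x. B x $$ (i, j)) \<in> borel_measurable N"
    and ij: "i < k" "j < m"
  shows "(\<lambda>x. (A x * B x) $$ (i, j)) \<in> borel_measurable N"
proof -
  have "(\<lambda>x. \<Sum>h<l. A x $$ (i, h) * B x $$ (h, j)) \<in> borel_measurable N"
    using assms by (intro borel_measurable_sum borel_measurable_times) auto
  also have "?this \<longleftrightarrow> ?thesis"
  proof (rule measurable_cong)
    fix x assume "x \<in> space N"
    from carrier_matD[OF assms(1)[OF this]] carrier_matD[OF assms(2)[OF this]] ij
    show "(\<Sum>h<l. A x $$ (i, h) * B x $$ (h, j)) = (A x * B x) $$ (i, j)"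
      by (simp add: scalar_prod_def lessThan_atLeast0)
  qed
  finally show ?thesis .
qed

text \<open>With finitely many candidates, measurable selection is elementary: a new candidate
  replaces the best one so far on the measurable set where it does at least as well. This supplies
  the optimal policy later.\<close>

lemma measurable_argmax:
  fixes f :: "'c \<Rightarrow> 'a \<Rightarrow> ennreal"
  assumes "finite A" "A \<noteq> {}" "\<And>u. u \<in> A \<Longrightarrow> f u \<in> borel_measurable M"
  shows "\<exists>g. g \<in> M \<rightarrow>\<^sub>M count_space A \<and> (\<forall>x\<in>space M. \<forall>u\<in>A. f u x \<le> f (g x) x)"
  using assms
proof (induction A rule: finite_ne_induct)
  case (singleton a)
  then show ?case by (intro exI[of _ "\<lambda>_. a"]) auto
next
  case (insert a A)
  have "\<exists>g. g \<in> M \<rightarrow>\<^sub>M count_space A \<and> (\<forall>x\<in>space M. \<forall>u\<in>A. f u x \<le> f (g x) x)"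
    by (rule insert.IH) (simp add: insert.prems)
  then obtain g where g: "g \<in> M \<rightarrow>\<^sub>M count_space A" and max: "\<And>x u. x \<in> space M \<Longrightarrow> u \<in> A \<Longrightarrow> f u x \<le> f (g x) x"
    by blast
  have g': "g \<in> M \<rightarrow>\<^sub>M count_space (insert a A)"
    by (rule measurable_compose[OF g]) auto
  have fg: "(\<lambda>x. f (g x) x) \<in> borel_measurable M"
    by (rule measurable_compose_countable'[OF _ g]) (simp_all add: insert.prems insert.hyps countable_finite)
  have "{x \<in> space M. f (g x) x \<le> f a x} \<in> sets M"
    using fg insert.prems[of a] by measurable
  then have "(\<lambda>x. if f (g x) x \<le> f a x then a else g x) \<in> M \<rightarrow>\<^sub>M count_space (insert a A)"
    using g' by (intro measurable_If) auto
  moreover have "f u x \<le> f (if f (g x) x \<le> f a x then a else g x) x" if "x \<in> space M" "u \<in> insert a A" for x u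
    using max[OF that(1), of u] that(2) by (auto intro: order_trans)
  ultimately show ?case by blast
qed

text \<open>Translates maximal reward into minimal cost. Finiteness matters because
  \<open>enn2real\<close> sends \<top> to 0 and is monotone only below \<top>.\<close>

lemma Min_diff_enn2real:
  assumes "finite A" "A \<noteq> {}" "\<And>u. u \<in> A \<Longrightarrow> f u < \<top>"
  shows "Min ((\<lambda>u. c - enn2real (f u)) ` A) = c - enn2real (Max (f ` A))"
proof (rule Min_eqI)
  have "Max (f ` A) \<in> f ` A" using assms by (intro Max_in) auto
  then show "c - enn2real (Max (f ` A)) \<in> (\<lambda>u. c - enn2real (f u)) ` A" by auto
  then have fin: "Max (f ` A) < \<top>"
    using \<open>Max (f ` A) \<in> f ` A\<close> assms(3) by auto
  fix y assume "y \<in> (\<lambda>u. c - enn2real (f u)) ` A"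
  then obtain u where "u \<in> A" "y = c - enn2real (f u)" by auto
  then show "c - enn2real (Max (f ` A)) \<le> y"
    using assms(1) fin by (auto intro!: enn2real_mono)
qed (use assms in auto)

section \<open>The Kalman-like filter\<close>

lemma scalar_prod_eq_sum: "v \<in> carrier_vec n \<Longrightarrow> w \<bullet> v = (\<Sum>i<n. w $ i * v $ i)"
  by (auto simp: scalar_prod_def lessThan_atLeast0)

text \<open>The quadratic form of \<open>belief_cov p\<close>, written as a variance.\<close>

definition belief_var :: "nat \<Rightarrow> real vec \<Rightarrow> (nat \<Rightarrow> real) \<Rightarrow> real" where
  "belief_var n p w = (\<Sum>i<n. p $ i * (w i - (\<Sum>j<n. p $ j * w j))\<^sup>2)"

lemma belief_var_nonneg: "prob_vec n p \<Longrightarrow> 0 \<le> belief_var n p w"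
  by (auto simp: belief_var_def prob_vec_def intro!: sum_nonneg)

lemma prob_vec_nonzero:
  assumes "prob_vec n p"
  obtains i where "i < n" "p $ i \<noteq> 0"
proof -
  have "(\<Sum>i<n. p $ i) \<noteq> 0" using assms by (simp add: prob_vec_def)
  then show ?thesis using that by (metis (mono_tags, lifting) lessThan_iff sum.neutral)
qed

lemma sum_centered:
  assumes "prob_vec n p"
  shows "(\<Sum>i<n. p $ i * (w i - (\<Sum>j<n. p $ j * w j))) = 0"
  using assms by (simp add: prob_vec_def right_diff_distrib sum_subtractf sum_distrib_right[symmetric])

text \<open>Bias-variance decomposition: the cross term vanishes by
  \<open>sum_centered\<close>.\<close>

lemma sum_shifted_square:
  assumes "prob_vec n p"
  shows "(\<Sum>i<n. p $ i * (c + (w i - (\<Sum>j<n. p $ j * w j)))\<^sup>2) = c\<^sup>2 + belief_var n p w"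
proof -
  define \<mu> where "\<mu> = (\<Sum>j<n. p $ j * w j)"
  have "(\<Sum>i<n. p $ i * (c + (w i - \<mu>))\<^sup>2) =
      (\<Sum>i<n. c\<^sup>2 * p $ i + 2 * c * (p $ i * (w i - \<mu>)) + p $ i * (w i - \<mu>)\<^sup>2)"
    by (intro sum.cong refl) (simp add: power2_eq_square algebra_simps)
  also have "\<dots> = c\<^sup>2 * (\<Sum>i<n. p $ i) + 2 * c * (\<Sum>i<n. p $ i * (w i - \<mu>)) + belief_var n p w"
    by (simp add: sum.distrib sum_distrib_left belief_var_def \<mu>_def)
  also have "\<dots> = c\<^sup>2 + belief_var n p w"
    using assms sum_centered[OF assms, of w] by (simp add: prob_vec_def \<mu>_def)
  finally show ?thesis by (simp add: \<mu>_def)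
qed

text \<open>The variance of \<open>\<delta>\<^sub>r - w\<close> under \<open>p\<close> is nonnegative.\<close>

lemma belief_cov_unit_bound:
  assumes p: "prob_vec n p" and r: "r < n"
  shows "2 * (p $ r * (w r - (\<Sum>j<n. p $ j * w j))) \<le> p $ r - (p $ r)\<^sup>2 + belief_var n p w"
proof -
  define \<mu> where "\<mu> = (\<Sum>j<n. p $ j * w j)"
  define e where "e = (\<lambda>i. if i = r then 1 else 0 :: real)"
  have p1: "(\<Sum>i<n. p $ i) = 1" using p by (simp add: prob_vec_def)
  have pe: "(\<Sum>i<n. p $ i * (e i * x i)) = p $ r * x r" for x
  proof -
    have "(\<Sum>i<n. p $ i * (e i * x i)) = (\<Sum>i<n. if i = r then p $ r * x r else 0)"
      by (intro sum.cong) (auto simp: e_def)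
    also have "\<dots> = p $ r * x r" using r by simp
    finally show ?thesis .
  qed
  have "0 \<le> (\<Sum>i<n. p $ i * ((e i - p $ r) - (w i - \<mu>))\<^sup>2)"
    using p by (auto simp: prob_vec_def intro!: sum_nonneg)
  also have "\<dots> = (\<Sum>i<n. p $ i * (e i * (1 - 2 * p $ r - 2 * (w i - \<mu>))) + (p $ r)\<^sup>2 * p $ i
      + 2 * p $ r * (p $ i * (w i - \<mu>)) + p $ i * (w i - \<mu>)\<^sup>2)"
    by (intro sum.cong refl) (auto simp: e_def power2_eq_square algebra_simps)
  also have "\<dots> = p $ r * (1 - 2 * p $ r - 2 * (w r - \<mu>)) + (p $ r)\<^sup>2 + belief_var n p w"
    using sum_centered[OF p, of w]
    by (simp add: sum.distrib pe sum_distrib_left[symmetric] p1 belief_var_def flip: \<mu>_def)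
  finally show ?thesis
    by (simp add: \<mu>_def algebra_simps power2_eq_square)
qed

section \<open>The gain as linear regression of the state on the observation\<close>

locale controlled_model =
  fixes S :: "'u model"
  assumes valid: "valid_model S"
begin

abbreviation "n \<equiv> nstates S"

lemma omean_carrier [simp]: "u \<in> ctrls S \<Longrightarrow> i < n \<Longrightarrow> omean S i u \<in> carrier_vec (odim S u)"
  and ocov_pos_def: "u \<in> ctrls S \<Longrightarrow> i < n \<Longrightarrow> pos_def (odim S u) (ocov S i u)"
  and tmat_carrier [simp]: "tmat S \<in> carrier_mat n n"
  and tmat_col: "i < n \<Longrightarrow> prob_vec n (col (tmat S) i)"
  and ctrls_finite [simp]: "finite (ctrls S)"
  and ctrls_nonempty [simp]: "ctrls S \<noteq> {}"
  and n_pos: "0 < n"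
  using valid by (auto simp: valid_model_def)

lemma ocov_carrier [simp]:
  "u \<in> ctrls S \<Longrightarrow> i < n \<Longrightarrow> ocov S i u \<in> carrier_mat (odim S u) (odim S u)"
  using ocov_pos_def[of u i] by (simp add: pos_def_def)

lemma mean_mat_carrier [simp]: "mean_mat S u \<in> carrier_mat (odim S u) n"
  using mat_of_cols_carrier(1)[of "odim S u" "map (\<lambda>i. omean S i u) [0..<n]"]
  by (simp add: mean_mat_def del: mat_of_cols_carrier)

lemma mean_mat_index [simp]: "a < odim S u \<Longrightarrow> i < n \<Longrightarrow> mean_mat S u $$ (a, i) = omean S i u $ a"
  by (simp add: mean_mat_def mat_of_cols_index)

lemma prob_vec_carrier: "prob_vec n p \<Longrightarrow> p \<in> carrier_vec n"
  by (simp add: prob_vec_def)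

lemma belief_cov_carrier: "p \<in> carrier_vec n \<Longrightarrow> belief_cov p \<in> carrier_mat n n"
  by (auto simp: belief_cov_def outer_def mat_diag_def)

text \<open>The right-hand side is the covariance of the indicator of state \<open>i\<close> with
  \<open>w\<close>. In this form the covariance matrix enters the algebra of the gain.\<close>

lemma belief_cov_mult_vec:
  assumes "prob_vec n p" "w \<in> carrier_vec n" "i < n"
  shows "(belief_cov p *\<^sub>v w) $ i = p $ i * (w $ i - (\<Sum>j<n. p $ j * w $ j))"
proof -
  have p: "dim_vec p = n" using assms(1) by (simp add: prob_vec_def)
  have "(belief_cov p *\<^sub>v w) $ i = (\<Sum>j<n. (if i = j then p $ j else 0) * w $ j - p $ i * (p $ j * w $ j))"
    using assms(2,3) p
    by (auto simp: belief_cov_def outer_def mat_diag_def scalar_prod_def lessThan_atLeast0 algebra_simps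
        intro!: sum.cong)
  also have "\<dots> = (\<Sum>j<n. (if i = j then p $ j * w $ j else 0)) - p $ i * (\<Sum>j<n. p $ j * w $ j)"
    unfolding sum_subtractf sum_distrib_left
    by (intro arg_cong2[where f = "(-)"] sum.cong) auto
  also have "\<dots> = p $ i * (w $ i - (\<Sum>j<n. p $ j * w $ j))"
    using assms(3) by (simp add: algebra_simps)
  finally show ?thesis .
qed

text \<open>The matrix inverted in \<open>gain\<close>: the covariance of the observation around its
  prediction.\<close>

definition innov_cov :: "real vec \<Rightarrow> 'u \<Rightarrow> real mat" where
  "innov_cov p u = mean_mat S u * belief_cov p * (mean_mat S u)\<^sup>T + avg_cov S p u"

lemma gain_alt: "gain S p u = belief_cov p * (mean_mat S u)\<^sup>T * minv (innov_cov p u)"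
  by (simp add: gain_def innov_cov_def)

lemma avg_cov_carrier [simp]: "avg_cov S p u \<in> carrier_mat (odim S u) (odim S u)"
  by (simp add: avg_cov_def)

lemma innov_cov_carrier [simp]: "innov_cov p u \<in> carrier_mat (odim S u) (odim S u)"
  unfolding innov_cov_def by (rule add_carrier_mat) simp

lemma mean_mat_transpose_mult:
  assumes "x \<in> carrier_vec (odim S u)" "u \<in> ctrls S" "i < n"
  shows "((mean_mat S u)\<^sup>T *\<^sub>v x) $ i = omean S i u \<bullet> x"
  using assms by (auto simp: mean_mat_def scalar_prod_def mat_of_cols_index intro!: sum.cong)

lemma avg_cov_form:
  assumes "u \<in> ctrls S" "x \<in> carrier_vec (odim S u)"
  shows "x \<bullet> (avg_cov S p u *\<^sub>v x) = (\<Sum>i<n. p $ i * (x \<bullet> (ocov S i u *\<^sub>v x)))"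
proof -
  let ?d = "odim S u"
  have "x \<bullet> (avg_cov S p u *\<^sub>v x) =
      (\<Sum>a<?d. \<Sum>b<?d. \<Sum>i<n. p $ i * (x $ a * ocov S i u $$ (a, b) * x $ b))"
    unfolding scalar_prod_mult_mat_vec[OF avg_cov_carrier assms(2) assms(2)]
    by (intro sum.cong refl) (simp add: avg_cov_def sum_distrib_left sum_distrib_right mult_ac)
  also have "\<dots> = (\<Sum>a<?d. \<Sum>i<n. \<Sum>b<?d. p $ i * (x $ a * ocov S i u $$ (a, b) * x $ b))"
    by (intro sum.cong refl sum.swap)
  also have "\<dots> = (\<Sum>i<n. \<Sum>a<?d. \<Sum>b<?d. p $ i * (x $ a * ocov S i u $$ (a, b) * x $ b))"
    by (rule sum.swap)
  also have "\<dots> = (\<Sum>i<n. p $ i * (x \<bullet> (ocov S i u *\<^sub>v x)))"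
    using assms by (intro sum.cong refl) (simp add: scalar_prod_mult_mat_vec[of _ ?d ?d] sum_distrib_left)
  finally show ?thesis .
qed

text \<open>Law of total variance for the scalar observation along \<open>x\<close>: the variance of
  the conditional mean plus the mean of the conditional variance.\<close>

lemma innov_cov_mult:
  assumes p: "prob_vec n p" and u: "u \<in> ctrls S" and x: "x \<in> carrier_vec (odim S u)"
  shows "x \<bullet> (innov_cov p u *\<^sub>v x) =
    belief_var n p (\<lambda>i. omean S i u \<bullet> x) + (\<Sum>i<n. p $ i * (x \<bullet> (ocov S i u *\<^sub>v x)))"
proof -
  let ?M = "mean_mat S u" and ?d = "odim S u"
  define w where "w = ?M\<^sup>T *\<^sub>v x"
  have MT: "?M\<^sup>T \<in> carrier_mat n ?d" by simp
  have w: "w \<in> carrier_vec n" unfolding w_def by (rule mult_mat_vec_carrier[OF MT x])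
  have wi: "w $ i = omean S i u \<bullet> x" if "i < n" for i
    unfolding w_def by (rule mean_mat_transpose_mult[OF x u that])
  have C: "belief_cov p \<in> carrier_mat n n" by (rule belief_cov_carrier[OF prob_vec_carrier[OF p]])
  have Cw: "belief_cov p *\<^sub>v w \<in> carrier_vec n" by (rule mult_mat_vec_carrier[OF C w])
  have MC: "?M * belief_cov p \<in> carrier_mat ?d n" by (rule mult_carrier_mat[OF mean_mat_carrier C])
  have MCM: "?M * belief_cov p * ?M\<^sup>T \<in> carrier_mat ?d ?d" by (rule mult_carrier_mat[OF MC MT])
  have *: "(?M * belief_cov p * ?M\<^sup>T) *\<^sub>v x = ?M *\<^sub>v (belief_cov p *\<^sub>v w)"
    unfolding w_def assoc_mult_mat_vec[OF MC MT x]
    by (rule assoc_mult_mat_vec[OF mean_mat_carrier C mult_mat_vec_carrier[OF MT x]])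
  have "x \<bullet> ((?M * belief_cov p * ?M\<^sup>T) *\<^sub>v x) = w \<bullet> (belief_cov p *\<^sub>v w)"
    unfolding * using transpose_vec_mult_scalar[OF mean_mat_carrier Cw x] by (simp add: w_def)
  also have "\<dots> = (\<Sum>i<n. w $ i * (belief_cov p *\<^sub>v w) $ i)"
    by (rule scalar_prod_eq_sum[OF Cw])
  also have "\<dots> = (\<Sum>i<n. (omean S i u \<bullet> x) * (p $ i * ((omean S i u \<bullet> x) - (\<Sum>j<n. p $ j * (omean S j u \<bullet> x)))))"
  proof -
    have "(\<Sum>j<n. p $ j * w $ j) = (\<Sum>j<n. p $ j * (omean S j u \<bullet> x))"
      by (intro sum.cong) (auto simp: wi)
    then show ?thesis
      by (intro sum.cong) (auto simp: belief_cov_mult_vec[OF p w] wi simp del: index_mult_mat_vec)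
  qed
  also have "\<dots> = belief_var n p (\<lambda>i. omean S i u \<bullet> x)"
  proof -
    define v where "v = (\<lambda>i. omean S i u \<bullet> x)"
    define \<mu> where "\<mu> = (\<Sum>j<n. p $ j * v j)"
    have "(\<Sum>i<n. v i * (p $ i * (v i - \<mu>))) = (\<Sum>i<n. p $ i * (v i - \<mu>)\<^sup>2 + \<mu> * (p $ i * (v i - \<mu>)))"
      by (intro sum.cong refl) (simp add: power2_eq_square algebra_simps)
    also have "\<dots> = belief_var n p v"
      using sum_centered[OF p, of v] unfolding sum.distrib sum_distrib_left[symmetric] belief_var_def \<mu>_def
      by simp
    finally show ?thesis unfolding v_def \<mu>_def .
  qed
  finally have "x \<bullet> ((?M * belief_cov p * ?M\<^sup>T) *\<^sub>v x) = belief_var n p (\<lambda>i. omean S i u \<bullet> x)" .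
  moreover have "x \<bullet> (innov_cov p u *\<^sub>v x) =
      x \<bullet> ((?M * belief_cov p * ?M\<^sup>T) *\<^sub>v x) + x \<bullet> (avg_cov S p u *\<^sub>v x)"
    unfolding innov_cov_def add_mult_distrib_mat_vec[OF MCM avg_cov_carrier x]
    by (rule scalar_prod_add_distrib[OF x mult_mat_vec_carrier[OF MCM x] mult_mat_vec_carrier[OF avg_cov_carrier x]])
  ultimately show ?thesis by (simp add: avg_cov_form[OF u x])
qed

lemma avg_form_pos:
  assumes p: "prob_vec n p" and u: "u \<in> ctrls S" and x: "x \<in> carrier_vec (odim S u)"
  shows "0 \<le> (\<Sum>i<n. p $ i * (x \<bullet> (ocov S i u *\<^sub>v x)))"
    and "x \<noteq> 0\<^sub>v (odim S u) \<Longrightarrow> 0 < (\<Sum>i<n. p $ i * (x \<bullet> (ocov S i u *\<^sub>v x)))"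
proof -
  have pi: "0 \<le> p $ i" if "i < n" for i using p that by (simp add: prob_vec_def)
  show pos: "0 < (\<Sum>i<n. p $ i * (x \<bullet> (ocov S i u *\<^sub>v x)))" if nz: "x \<noteq> 0\<^sub>v (odim S u)"
  proof -
    have Q: "0 < x \<bullet> (ocov S i u *\<^sub>v x)" if "i < n" for i
      using ocov_pos_def[OF u that] x nz by (simp add: pos_def_def)
    obtain i where i: "i < n" "p $ i \<noteq> 0" by (rule prob_vec_nonzero[OF p])
    have "0 < p $ i * (x \<bullet> (ocov S i u *\<^sub>v x))"
      using i pi[of i] Q[of i] by simp
    then show ?thesis
      using i pi Q by (intro sum_pos2[of _ i]) (auto simp: less_imp_le)
  qed
  show "0 \<le> (\<Sum>i<n. p $ i * (x \<bullet> (ocov S i u *\<^sub>v x)))"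
  proof (cases "x = 0\<^sub>v (odim S u)")
    case True
    then have "x \<bullet> (ocov S i u *\<^sub>v x) = 0" if "i < n" for i
      unfolding scalar_prod_mult_mat_vec[OF ocov_carrier[OF u that] x x]
      by (intro sum.neutral ballI) (simp add: True)
    then show ?thesis by simp
  qed (use pos in simp)
qed

text \<open>A kernel vector would make the form vanish, but its noise part is strictly positive
  since some state has positive weight.\<close>

lemma innov_cov_det:
  assumes p: "prob_vec n p" and u: "u \<in> ctrls S"
  shows "det (innov_cov p u) \<noteq> 0"
proof
  assume "det (innov_cov p u) = 0"
  then obtain x where x: "x \<in> carrier_vec (odim S u)" "x \<noteq> 0\<^sub>v (odim S u)"
    and "innov_cov p u *\<^sub>v x = 0\<^sub>v (odim S u)"
    using det_0_iff_vec_prod_zero[OF innov_cov_carrier] by blast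
  then have "x \<bullet> (innov_cov p u *\<^sub>v x) = 0" by simp
  then show False
    using innov_cov_mult[OF p u x(1)] avg_form_pos(2)[OF p u x]
      belief_var_nonneg[OF p, of "\<lambda>i. omean S i u \<bullet> x"] by linarith
qed

lemma gain_carrier [simp]:
  assumes "prob_vec n p" "u \<in> ctrls S"
  shows "gain S p u \<in> carrier_mat n (odim S u)"
  unfolding gain_alt
  by (rule mult_carrier_mat[OF mult_carrier_mat[OF belief_cov_carrier[OF prob_vec_carrier[OF assms(1)]]]
      minv_inverse(1)[OF innov_cov_carrier innov_cov_det[OF assms]]]) simp

text \<open>The normal equations of the regression: multiplying the gain by \<open>innov_cov\<close>
  cancels the inverse, so the variance of the estimate equals its covariance with the indicator of
  state \<open>r\<close>.\<close>

lemma gain_innov_cov: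
  assumes p: "prob_vec n p" and u: "u \<in> ctrls S" and r: "r < n"
  defines "g \<equiv> row (gain S p u) r"
  shows "g \<bullet> (innov_cov p u *\<^sub>v g) =
    p $ r * (omean S r u \<bullet> g - (\<Sum>j<n. p $ j * (omean S j u \<bullet> g)))"
proof -
  let ?M = "mean_mat S u" and ?d = "odim S u"
  have MT: "?M\<^sup>T \<in> carrier_mat n ?d" by simp
  have C: "belief_cov p \<in> carrier_mat n n" by (rule belief_cov_carrier[OF prob_vec_carrier[OF p]])
  note iI = minv_inverse[OF innov_cov_carrier innov_cov_det[OF p u]]
  have g: "g \<in> carrier_vec ?d"
    unfolding g_def using gain_carrier[OF p u] by (metis carrier_matD(2) row_carrier)
  have CM: "belief_cov p * ?M\<^sup>T \<in> carrier_mat n ?d" by (rule mult_carrier_mat[OF C MT])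
  have "gain S p u * innov_cov p u = belief_cov p * ?M\<^sup>T * (minv (innov_cov p u) * innov_cov p u)"
    unfolding gain_alt by (rule assoc_mult_mat[OF CM iI(1) innov_cov_carrier])
  also have "\<dots> = belief_cov p * ?M\<^sup>T" unfolding iI(3) by (rule right_mult_one_mat[OF CM])
  finally have GI: "gain S p u * innov_cov p u = belief_cov p * ?M\<^sup>T" .
  have "g \<bullet> (innov_cov p u *\<^sub>v g) = (gain S p u *\<^sub>v (innov_cov p u *\<^sub>v g)) $ r"
    unfolding g_def using r gain_carrier[OF p u] by simp
  also have "\<dots> = ((belief_cov p * ?M\<^sup>T) *\<^sub>v g) $ r"
    unfolding GI[symmetric] assoc_mult_mat_vec[OF gain_carrier[OF p u] innov_cov_carrier g] ..
  also have "\<dots> = (belief_cov p *\<^sub>v (?M\<^sup>T *\<^sub>v g)) $ r"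
    unfolding assoc_mult_mat_vec[OF C MT g] ..
  also have "\<dots> = p $ r * (omean S r u \<bullet> g - (\<Sum>j<n. p $ j * (omean S j u \<bullet> g)))"
    unfolding belief_cov_mult_vec[OF p mult_mat_vec_carrier[OF MT g] r]
    unfolding mean_mat_transpose_mult[OF g u r]
    by (intro arg_cong[where f = "\<lambda>t. p $ r * (omean S r u \<bullet> g - t)"] sum.cong refl)
      (simp add: mean_mat_transpose_mult[OF g u] del: index_mult_mat_vec)
  finally show ?thesis .
qed

text \<open>The variance explained by a linear estimate cannot exceed the prior variance of the
  indicator of \<open>r\<close>. By the normal equations, \<open>belief_cov_unit_bound\<close>
  bounds twice the total variance of the estimate by the prior variance plus
  \<open>belief_var\<close>; subtracting \<open>belief_var\<close> and one copy of the nonnegative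
  noise term gives the claim.\<close>

lemma gain_form_le:
  assumes p: "prob_vec n p" and u: "u \<in> ctrls S" and r: "r < n"
  defines "g \<equiv> row (gain S p u) r"
  shows "belief_var n p (\<lambda>i. omean S i u \<bullet> g) + (\<Sum>i<n. p $ i * (g \<bullet> (ocov S i u *\<^sub>v g)))
    \<le> p $ r - (p $ r)\<^sup>2"
proof -
  have g: "g \<in> carrier_vec (odim S u)"
    unfolding g_def using gain_carrier[OF p u] by (metis carrier_matD(2) row_carrier)
  show ?thesis
    using gain_innov_cov[OF p u r] belief_cov_unit_bound[OF p r, of "\<lambda>i. omean S i u \<bullet> g"]
      innov_cov_mult[OF p u g] avg_form_pos(1)[OF p u g]
    by (simp add: g_def)
qed

section \<open>Filtered belief: total mass and mean squared norm\<close>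

definition filt_sq :: "real vec \<Rightarrow> 'u \<Rightarrow> real vec \<Rightarrow> real" where
  "filt_sq p u y = (\<Sum>r<n. (filtered S p u y $ r)\<^sup>2)"

lemma filt_sq_nonneg [simp]: "0 \<le> filt_sq p u y"
  by (simp add: filt_sq_def sum_nonneg)

lemma pred_obs_dim [simp]: "dim_vec (pred_obs S p u) = odim S u"
  by (simp add: pred_obs_def mean_mat_def)

lemma pred_obs_carrier: "pred_obs S p u \<in> carrier_vec (odim S u)"
  by (rule carrier_vecI) simp

lemma gain_dim [simp]:
  assumes "prob_vec n p" "u \<in> ctrls S"
  shows "dim_row (gain S p u) = n" "dim_col (gain S p u) = odim S u"
  using gain_carrier[OF assms] by auto

lemma filtered_dim [simp]: "prob_vec n p \<Longrightarrow> u \<in> ctrls S \<Longrightarrow> dim_vec (filtered S p u y) = n"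
  by (simp add: filtered_def)

lemma filtered_index:
  assumes "prob_vec n p" "u \<in> ctrls S" "r < n"
  shows "filtered S p u y $ r = p $ r + row (gain S p u) r \<bullet> (y - pred_obs S p u)"
  using assms by (simp add: filtered_def)

lemma row_gain_carrier: "prob_vec n p \<Longrightarrow> u \<in> ctrls S \<Longrightarrow> row (gain S p u) r \<in> carrier_vec (odim S u)"
  by (rule carrier_vecI) simp

lemma diff_carrier_vec: "v \<in> carrier_vec d \<Longrightarrow> (y :: real vec) - v \<in> carrier_vec d"
  by (rule carrier_vecI) simp

text \<open>Each column of the gain is \<open>belief_cov p\<close> applied to some vector, and the
  entries of such a product sum to zero. Hence the filter preserves total mass 1, although single
  entries may become negative.\<close>

lemma sum_gain_col:
  assumes p: "prob_vec n p" and u: "u \<in> ctrls S" and a: "a < odim S u"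
  shows "(\<Sum>r<n. gain S p u $$ (r, a)) = 0"
proof -
  define X where "X = (mean_mat S u)\<^sup>T * minv (innov_cov p u)"
  have MT: "(mean_mat S u)\<^sup>T \<in> carrier_mat n (odim S u)" by simp
  have C: "belief_cov p \<in> carrier_mat n n" by (rule belief_cov_carrier[OF prob_vec_carrier[OF p]])
  note iI = minv_inverse[OF innov_cov_carrier innov_cov_det[OF p u]]
  have X: "X \<in> carrier_mat n (odim S u)" unfolding X_def by (rule mult_carrier_mat[OF MT iI(1)])
  have G: "gain S p u = belief_cov p * X"
    unfolding gain_alt X_def by (rule assoc_mult_mat[OF C MT iI(1)])
  have xc: "col X a \<in> carrier_vec n" using X a by (metis carrier_matD(1) col_dim)
  have "gain S p u $$ (r, a) = p $ r * (col X a $ r - (\<Sum>j<n. p $ j * col X a $ j))" if "r < n" for r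
  proof -
    have "gain S p u $$ (r, a) = (belief_cov p *\<^sub>v col X a) $ r"
      unfolding G using X C a that by auto
    then show ?thesis unfolding belief_cov_mult_vec[OF p xc that] .
  qed
  then show ?thesis
    using sum_centered[OF p, of "\<lambda>r. col X a $ r"] by simp
qed

lemma sum_filtered:
  assumes p: "prob_vec n p" and u: "u \<in> ctrls S"
  shows "(\<Sum>r<n. filtered S p u y $ r) = 1"
proof -
  define v where "v = y - pred_obs S p u"
  have v: "v \<in> carrier_vec (odim S u)" unfolding v_def by (rule diff_carrier_vec[OF pred_obs_carrier])
  have "(\<Sum>r<n. row (gain S p u) r \<bullet> v) = (\<Sum>r<n. \<Sum>a<odim S u. gain S p u $$ (r, a) * v $ a)"
    using p u by (intro sum.cong refl) (simp add: scalar_prod_eq_sum[OF v])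
  also have "\<dots> = (\<Sum>a<odim S u. \<Sum>r<n. gain S p u $$ (r, a) * v $ a)" by (rule sum.swap)
  also have "\<dots> = 0"
    by (rule sum.neutral, rule ballI)
      (simp only: sum_distrib_right[symmetric] sum_gain_col[OF p u] lessThan_iff mult_zero_left)
  finally show ?thesis
    using p u by (simp add: filtered_index sum.distrib prob_vec_def v_def)
qed

text \<open>The trace is the sum of the filtered entries minus the sum of their squares, and the
  first sum is 1.\<close>

lemma stage_cost_eq:
  assumes p: "prob_vec n p" and u: "u \<in> ctrls S"
  shows "stage_cost S p u y = 1 - filt_sq p u y"
proof -
  have "stage_cost S p u y = (\<Sum>r<n. filtered S p u y $ r - (filtered S p u y $ r)\<^sup>2)"
    using p u by (auto simp: stage_cost_def tr_def belief_cov_def outer_def mat_diag_def power2_eq_square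
        intro!: sum.cong)
  then show ?thesis
    by (simp add: sum_subtractf sum_filtered[OF p u] filt_sq_def)
qed

lemma obs_density_measurable [measurable]:
  "u \<in> ctrls S \<Longrightarrow> i < n \<Longrightarrow> obs_density S i u \<in> borel_measurable borel_vec"
  unfolding obs_density_def[abs_def] by (rule gaussian_density_measurable[OF omean_carrier])

lemma obs_density_pos: "u \<in> ctrls S \<Longrightarrow> i < n \<Longrightarrow> 0 < obs_density S i u y"
  unfolding obs_density_def by (rule gaussian_density_pos[OF ocov_pos_def omean_carrier])

lemma sets_obs_law [simp, measurable_cong]: "sets (obs_law S i u) = sets borel_vec"
  by (simp add: obs_law_def)

lemma space_obs_law [simp]: "space (obs_law S i u) = UNIV"
  by (simp add: obs_law_def)

lemma nn_integral_obs_law: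
  assumes "u \<in> ctrls S" "i < n" "F \<in> borel_measurable borel_vec"
  shows "(\<integral>\<^sup>+y. F y \<partial>obs_law S i u) = (\<integral>\<^sup>+y. ennreal (obs_density S i u y) * F y \<partial>lborel_vec (odim S u))"
  unfolding obs_law_def using assms by (intro nn_integral_density) auto

lemma obs_law_moment:
  assumes u: "u \<in> ctrls S" and i: "i < n" and g: "g \<in> carrier_vec (odim S u)" and k: "0 \<le> k"
  shows "(\<integral>\<^sup>+y. ennreal (k + (a + g \<bullet> (y - omean S i u))\<^sup>2) \<partial>obs_law S i u) =
    ennreal (k + a\<^sup>2 + g \<bullet> (ocov S i u *\<^sub>v g))"
proof -
  note m = omean_carrier[OF u i]
  have "g \<bullet> (y - omean S i u) = (\<Sum>j<odim S u. g $ j * (y $ j - omean S i u $ j))" for y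
    using m by (simp add: scalar_prod_eq_sum[OF diff_carrier_vec[OF m]])
  then have [measurable]: "(\<lambda>y. g \<bullet> (y - omean S i u)) \<in> borel_measurable borel_vec" by simp
  have "(\<integral>\<^sup>+y. ennreal (k + (a + g \<bullet> (y - omean S i u))\<^sup>2) \<partial>obs_law S i u) =
    (\<integral>\<^sup>+y. ennreal ((k + (a + g \<bullet> (y - omean S i u))\<^sup>2) * obs_density S i u y) \<partial>lborel_vec (odim S u))"
    unfolding mult.commute[of _ "obs_density S i u _"] ennreal_mult'[OF less_imp_le[OF obs_density_pos[OF u i]]]
    by (rule nn_integral_obs_law[OF u i]) measurable
  also have "\<dots> = ennreal (k + a\<^sup>2 + g \<bullet> (ocov S i u *\<^sub>v g))"
    unfolding obs_density_def by (rule gaussian_moment[OF ocov_pos_def[OF u i] m g k])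
  finally show ?thesis .
qed

lemma prob_space_obs_law:
  assumes u: "u \<in> ctrls S" and i: "i < n"
  shows "prob_space (obs_law S i u)"
proof (rule prob_spaceI)
  have "ocov S i u *\<^sub>v 0\<^sub>v (odim S u) \<in> carrier_vec (odim S u)"
    by (rule mult_mat_vec_carrier[OF ocov_carrier[OF u i]]) simp
  then have "(0\<^sub>v (odim S u) :: real vec) \<bullet> (ocov S i u *\<^sub>v 0\<^sub>v (odim S u)) = 0" by simp
  moreover have "(0\<^sub>v (odim S u) :: real vec) \<bullet> (y - omean S i u) = 0" for y
    using omean_carrier[OF u i] by (intro scalar_prod_left_zero[OF diff_carrier_vec])
  \<comment> \<open>With \<open>g = 0\<close>, \<open>k = 1\<close>, \<open>a = 0\<close> the moment
    formula integrates the constant 1.\<close>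
  ultimately show "emeasure (obs_law S i u) (space (obs_law S i u)) = 1"
    using obs_law_moment[OF u i, of "0\<^sub>v (odim S u)" 1 0] by simp
qed

lemma ocov_form_nonneg:
  assumes "u \<in> ctrls S" "i < n" "g \<in> carrier_vec (odim S u)"
  shows "0 \<le> g \<bullet> (ocov S i u *\<^sub>v g)"
  using ocov_pos_def[OF assms(1,2)] assms(3)
  by (cases "g = 0\<^sub>v (odim S u)")
    (auto simp: pos_def_def less_imp_le scalar_prod_mult_mat_vec[OF ocov_carrier[OF assms(1,2)]])

lemma obs_law_filt_sq:
  assumes p: "prob_vec n p" and u: "u \<in> ctrls S" and i: "i < n"
  shows "(\<integral>\<^sup>+y. ennreal (filt_sq p u y) \<partial>obs_law S i u) = ennreal (\<Sum>r<n.
    (p $ r + row (gain S p u) r \<bullet> (omean S i u - pred_obs S p u))\<^sup>2 +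
    row (gain S p u) r \<bullet> (ocov S i u *\<^sub>v row (gain S p u) r))" (is "_ = ennreal (\<Sum>r<n. ?a r + ?b r)")
proof -
  define c where "c = (\<lambda>r. p $ r + row (gain S p u) r \<bullet> (omean S i u - pred_obs S p u))"
  note g = row_gain_carrier[OF p u]
  note m = omean_carrier[OF u i]
  \<comment> \<open>Recentering at the true conditional mean separates a bias \<open>c r\<close>,
    fixed given the state, from the gain acting on the noise.\<close>
  have split: "filtered S p u y $ r = c r + row (gain S p u) r \<bullet> (y - omean S i u)" if "r < n" for r y
  proof -
    have "y - pred_obs S p u = (omean S i u - pred_obs S p u) + (y - omean S i u)"
      using carrier_vecD[OF m] by (intro eq_vecI) auto
    then show ?thesis
      unfolding filtered_index[OF p u that] c_def
      by (simp add: scalar_prod_add_distrib[OF g diff_carrier_vec[OF pred_obs_carrier] diff_carrier_vec[OF m]])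
  qed
  have b: "0 \<le> ?b r" for r
    by (rule ocov_form_nonneg[OF u i g])
  have "g \<bullet> (y - omean S i u) = (\<Sum>j<odim S u. g $ j * (y $ j - omean S i u $ j))" for y g
    using m by (simp add: scalar_prod_eq_sum[OF diff_carrier_vec[OF m]])
  then have [measurable]: "(\<lambda>y. g \<bullet> (y - omean S i u)) \<in> borel_measurable borel_vec" for g by simp
  have "(\<integral>\<^sup>+y. ennreal (filt_sq p u y) \<partial>obs_law S i u) =
      (\<integral>\<^sup>+y. (\<Sum>r<n. ennreal (0 + (c r + row (gain S p u) r \<bullet> (y - omean S i u))\<^sup>2)) \<partial>obs_law S i u)"
    by (intro nn_integral_cong) (simp add: filt_sq_def split)
  also have "\<dots> = (\<Sum>r<n. \<integral>\<^sup>+y. ennreal (0 + (c r + row (gain S p u) r \<bullet> (y - omean S i u))\<^sup>2) \<partial>obs_law S i u)"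
    by (rule nn_integral_sum) measurable
  also have "\<dots> = (\<Sum>r<n. ennreal (?a r + ?b r))"
    by (intro sum.cong refl) (simp add: obs_law_moment[OF u i g order_refl, simplified] c_def)
  also have "\<dots> = ennreal (\<Sum>r<n. ?a r + ?b r)"
    by (rule sum_ennreal) (use b in simp)
  finally show ?thesis .
qed

text \<open>The trace term is the sum over the rows of the gain of the quadratic form of the noise
  covariance, and the norm term collects the squared biases. Together they are the mean squared norm
  of the filtered belief given state \<open>i\<close>.\<close>

lemma h_comp_eq:
  assumes p: "prob_vec n p" and u: "u \<in> ctrls S" and i: "i < n"
  shows "1 - h_comp S i p u = (\<Sum>r<n.
    (p $ r + row (gain S p u) r \<bullet> (omean S i u - pred_obs S p u))\<^sup>2 +
    row (gain S p u) r \<bullet> (ocov S i u *\<^sub>v row (gain S p u) r))"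
proof -
  let ?d = "odim S u" and ?Q = "ocov S i u" and ?G = "gain S p u"
  note G = gain_carrier[OF p u]
  define v where "v = p + ?G *\<^sub>v (omean S i u - pred_obs S p u)"
  have v: "v \<in> carrier_vec n" unfolding v_def using p u by (intro carrier_vecI) simp
  have "(eucl_norm v)\<^sup>2 = (\<Sum>r<n. (v $ r)\<^sup>2)"
    by (simp add: eucl_norm_def scalar_prod_eq_sum[OF v] sum_nonneg power2_eq_square[symmetric])
  also have "\<dots> = (\<Sum>r<n. (p $ r + row ?G r \<bullet> (omean S i u - pred_obs S p u))\<^sup>2)"
    using p u by (intro sum.cong refl) (simp add: v_def)
  finally have 1: "(eucl_norm v)\<^sup>2 = (\<Sum>r<n. (p $ r + row ?G r \<bullet> (omean S i u - pred_obs S p u))\<^sup>2)" .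
  have GG: "?G\<^sup>T * ?G \<in> carrier_mat ?d ?d" using G by (metis mult_carrier_mat transpose_carrier_mat)
  have "tr (?G\<^sup>T * ?G * ?Q) = (\<Sum>a<?d. \<Sum>b<?d. \<Sum>r<n. ?G $$ (r, b) * ?Q $$ (b, a) * ?G $$ (r, a))"
  proof -
    have "(?G\<^sup>T * ?G * ?Q) $$ (a, a) = (\<Sum>b<?d. \<Sum>r<n. ?G $$ (r, b) * ?Q $$ (b, a) * ?G $$ (r, a))"
      if "a < ?d" for a
    proof -
      have "(?G\<^sup>T * ?G * ?Q) $$ (a, a) = (\<Sum>b<?d. (?G\<^sup>T * ?G) $$ (a, b) * ?Q $$ (b, a))"
        using that GG ocov_carrier[OF u i] p u
        by (simp add: scalar_prod_def lessThan_atLeast0)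
      also have "\<dots> = (\<Sum>b<?d. \<Sum>r<n. ?G $$ (r, b) * ?Q $$ (b, a) * ?G $$ (r, a))"
        using that p u
        by (intro sum.cong refl)
          (simp add: scalar_prod_def lessThan_atLeast0 sum_distrib_left sum_distrib_right mult_ac)
      finally show ?thesis .
    qed
    then show ?thesis using p u by (simp add: tr_def)
  qed
  also have "\<dots> = (\<Sum>b<?d. \<Sum>a<?d. \<Sum>r<n. ?G $$ (r, b) * ?Q $$ (b, a) * ?G $$ (r, a))"
    by (rule sum.swap)
  also have "\<dots> = (\<Sum>b<?d. \<Sum>r<n. \<Sum>a<?d. ?G $$ (r, b) * ?Q $$ (b, a) * ?G $$ (r, a))"
    by (intro sum.cong refl sum.swap)
  also have "\<dots> = (\<Sum>r<n. \<Sum>b<?d. \<Sum>a<?d. ?G $$ (r, b) * ?Q $$ (b, a) * ?G $$ (r, a))"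
    by (rule sum.swap)
  also have "\<dots> = (\<Sum>r<n. row ?G r \<bullet> (?Q *\<^sub>v row ?G r))"
    using p u
    by (intro sum.cong refl)
      (simp add: scalar_prod_mult_mat_vec[OF ocov_carrier[OF u i] row_gain_carrier[OF p u] row_gain_carrier[OF p u]])
  finally have 2: "tr (?G\<^sup>T * ?G * ?Q) = (\<Sum>r<n. row ?G r \<bullet> (?Q *\<^sub>v row ?G r))" .
  show ?thesis
    using 1 2 by (simp add: h_comp_def v_def[symmetric] sum.distrib)
qed

lemma obs_law_filt_sq_h:
  assumes "prob_vec n p" "u \<in> ctrls S" "i < n"
  shows "(\<integral>\<^sup>+y. ennreal (filt_sq p u y) \<partial>obs_law S i u) = ennreal (1 - h_comp S i p u)"
  using obs_law_filt_sq[OF assms] h_comp_eq[OF assms] by simp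

lemma scalar_h_vec:
  "p \<bullet> h_vec S p u = (\<Sum>i<n. p $ i * h_comp S i p u)"
  by (simp add: h_vec_def scalar_prod_def lessThan_atLeast0)

text \<open>Averaged over the state, row \<open>r\<close> contributes the square of
  \<open>p $ r\<close> plus a term that \<open>gain_form_le\<close> bounds by the prior variance
  \<open>p $ r - (p $ r)\<^sup>2\<close>. The sum over \<open>r\<close> is then at most the total
  mass 1. This is the mean bound on the reward, which is not bounded pointwise in general.\<close>

lemma h_vec_nonneg:
  assumes p: "prob_vec n p" and u: "u \<in> ctrls S"
  shows "0 \<le> p \<bullet> h_vec S p u"
proof -
  let ?g = "\<lambda>r. row (gain S p u) r"
  note g = row_gain_carrier[OF p u]
  have p1: "(\<Sum>i<n. p $ i) = 1" using p by (simp add: prob_vec_def)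
  \<comment> \<open>The predicted observation is the mean of the state-dependent means under
    \<open>p\<close>, so the deviation is a centered function of the state.\<close>
  have dev: "?g r \<bullet> (omean S i u - pred_obs S p u) =
      omean S i u \<bullet> ?g r - (\<Sum>j<n. p $ j * (omean S j u \<bullet> ?g r))" if "i < n" for i r
  proof -
    have pc: "p \<in> carrier_vec n" using p by (rule prob_vec_carrier)
    have "?g r \<bullet> pred_obs S p u = ((mean_mat S u)\<^sup>T *\<^sub>v ?g r) \<bullet> p"
      unfolding pred_obs_def by (rule transpose_vec_mult_scalar[OF mean_mat_carrier pc g, symmetric])
    also have "\<dots> = (\<Sum>j<n. p $ j * (omean S j u \<bullet> ?g r))"
      unfolding scalar_prod_eq_sum[OF pc]
      by (intro sum.cong refl) (simp add: mean_mat_transpose_mult[OF g u] mult.commute del: index_mult_mat_vec)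
    finally have 1: "?g r \<bullet> pred_obs S p u = (\<Sum>j<n. p $ j * (omean S j u \<bullet> ?g r))" .
    show ?thesis
      unfolding scalar_prod_minus_distrib[OF g omean_carrier[OF u that] pred_obs_carrier] 1
      using comm_scalar_prod[OF g omean_carrier[OF u that]] by simp
  qed
  have "1 - p \<bullet> h_vec S p u = (\<Sum>i<n. p $ i * (1 - h_comp S i p u))"
    by (simp add: scalar_h_vec right_diff_distrib sum_subtractf p1)
  also have "\<dots> = (\<Sum>i<n. \<Sum>r<n. p $ i *
      (p $ r + (omean S i u \<bullet> ?g r - (\<Sum>j<n. p $ j * (omean S j u \<bullet> ?g r))))\<^sup>2 +
      p $ i * (?g r \<bullet> (ocov S i u *\<^sub>v ?g r)))"
    by (intro sum.cong refl) (simp add: h_comp_eq[OF p u] dev sum_distrib_left distrib_left)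
  also have "\<dots> = (\<Sum>r<n. \<Sum>i<n. p $ i *
      (p $ r + (omean S i u \<bullet> ?g r - (\<Sum>j<n. p $ j * (omean S j u \<bullet> ?g r))))\<^sup>2 +
      p $ i * (?g r \<bullet> (ocov S i u *\<^sub>v ?g r)))"
    by (rule sum.swap)
  also have "\<dots> = (\<Sum>r<n. (p $ r)\<^sup>2 + (belief_var n p (\<lambda>i. omean S i u \<bullet> ?g r) +
      (\<Sum>i<n. p $ i * (?g r \<bullet> (ocov S i u *\<^sub>v ?g r)))))"
    by (simp add: sum.distrib sum_shifted_square[OF p] add.assoc)
  also have "\<dots> \<le> (\<Sum>r<n. (p $ r)\<^sup>2 + (p $ r - (p $ r)\<^sup>2))"
    by (intro sum_mono add_left_mono gain_form_le[OF p u]) simp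
  also have "\<dots> = 1" using p1 by simp
  finally show ?thesis by simp
qed

section \<open>Bayes' rule\<close>

text \<open>Measurability in the belief is only claimed on probability vectors: there
  \<open>innov_cov\<close> is known to be nonsingular, and Bayes' rule stays among them.\<close>

definition belief_space :: "real vec measure" where
  "belief_space = restrict_space borel_vec {p. prob_vec n p}"

lemma space_belief_space [simp]: "space belief_space = {p. prob_vec n p}"
  by (simp add: belief_space_def space_restrict_space)

lemma measurable_belief_index [measurable]: "(\<lambda>p. p $ i) \<in> borel_measurable belief_space"
  unfolding belief_space_def by (rule measurable_restrict_space1) measurable

lemma measurable_belief_spaceI:
  assumes "\<And>x. x \<in> space M \<Longrightarrow> prob_vec n (f x)"
    and "\<And>i. i < n \<Longrightarrow> (\<lambda>x. f x $ i) \<in> borel_measurable M"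
  shows "f \<in> M \<rightarrow>\<^sub>M belief_space"
  unfolding belief_space_def
  by (rule measurable_restrict_space2)
    (use assms prob_vec_carrier in \<open>auto intro!: measurable_borel_vecI[of _ _ n]\<close>)

lemma gain_measurable:
  assumes u: "u \<in> ctrls S" and ra: "r < n" "a < odim S u"
  shows "(\<lambda>p. gain S p u $$ (r, a)) \<in> borel_measurable belief_space"
proof -
  let ?d = "odim S u" and ?M = "mean_mat S u"
  have C: "belief_cov p \<in> carrier_mat n n" if "prob_vec n p" for p
    by (rule belief_cov_carrier[OF prob_vec_carrier[OF that]])
  have MT: "?M\<^sup>T \<in> carrier_mat n ?d" by simp
  have mC: "(\<lambda>p. belief_cov p $$ (i, j)) \<in> borel_measurable belief_space" if "i < n" "j < n" for i j
  proof -
    have "(\<lambda>p. (if i = j then p $ j else 0) - p $ i * p $ j) \<in> borel_measurable belief_space"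
      by measurable
    also have "?this \<longleftrightarrow> ?thesis"
      by (rule measurable_cong)
        (use that in \<open>auto simp: belief_cov_def mat_diag_def outer_def prob_vec_def\<close>)
    finally show ?thesis .
  qed
  have mMC: "(\<lambda>p. (?M * belief_cov p) $$ (i, j)) \<in> borel_measurable belief_space" if "i < ?d" "j < n" for i j
    by (rule borel_measurable_mult_mat[of _ _ ?d n _ n]) (use that C mC in \<open>auto simp del: index_mult_mat\<close>)
  have mMCM: "(\<lambda>p. (?M * belief_cov p * ?M\<^sup>T) $$ (i, j)) \<in> borel_measurable belief_space"
    if "i < ?d" "j < ?d" for i j
    by (rule borel_measurable_mult_mat[of _ _ ?d n _ ?d])
      (use that mMC mult_carrier_mat[OF mean_mat_carrier C] in \<open>auto simp del: index_mult_mat\<close>)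
  have mI: "(\<lambda>p. innov_cov p u $$ (i, j)) \<in> borel_measurable belief_space" if "i < ?d" "j < ?d" for i j
  proof -
    have "(\<lambda>p. (?M * belief_cov p * ?M\<^sup>T) $$ (i, j) + (\<Sum>l<n. p $ l * ocov S l u $$ (i, j)))
        \<in> borel_measurable belief_space"
      using mMCM[OF that] by measurable
    also have "?this \<longleftrightarrow> ?thesis"
      by (rule measurable_cong)
        (use that in \<open>simp add: innov_cov_def avg_cov_def del: index_mult_mat(1)\<close>)
    finally show ?thesis .
  qed
  have mK: "(\<lambda>p. minv (innov_cov p u) $$ (i, j)) \<in> borel_measurable belief_space" if "i < ?d" "j < ?d" for i j
    by (rule borel_measurable_minv[of _ _ ?d]) (use that mI innov_cov_det u in auto)
  have mCM: "(\<lambda>p. (belief_cov p * ?M\<^sup>T) $$ (i, j)) \<in> borel_measurable belief_space" if "i < n" "j < ?d" for i j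
    by (rule borel_measurable_mult_mat[of _ _ n n _ ?d]) (use that C mC in \<open>auto simp del: index_mult_mat\<close>)
  show ?thesis
    unfolding gain_alt
    by (rule borel_measurable_mult_mat[of _ _ n ?d _ ?d])
      (use ra mCM mK mult_carrier_mat[OF C MT] minv_inverse(1)[OF innov_cov_carrier innov_cov_det] u
        in \<open>auto simp del: index_mult_mat\<close>)
qed

lemma filt_sq_measurable:
  assumes u: "u \<in> ctrls S"
  shows "(\<lambda>(p, y). filt_sq p u y) \<in> borel_measurable (belief_space \<Otimes>\<^sub>M borel_vec)"
proof -
  note [measurable] = gain_measurable[OF u]
  have "(\<lambda>(p, y). \<Sum>r<n. (p $ r + (\<Sum>a<odim S u. gain S p u $$ (r, a) *
      (y $ a - (\<Sum>i<n. mean_mat S u $$ (a, i) * p $ i))))\<^sup>2) \<in> borel_measurable (belief_space \<Otimes>\<^sub>M borel_vec)"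
    unfolding split_beta'
    by (intro borel_measurable_sum borel_measurable_power borel_measurable_add borel_measurable_times
        borel_measurable_diff measurable_compose[OF measurable_fst] measurable_compose[OF measurable_snd]
        gain_measurable[OF u] measurable_belief_index measurable_vec_index borel_measurable_const) auto
  also have "?this \<longleftrightarrow> ?thesis"
  proof (rule measurable_cong)
    fix z :: "real vec \<times> real vec" assume "z \<in> space (belief_space \<Otimes>\<^sub>M borel_vec)"
    then obtain p y where z: "z = (p, y)" and p: "prob_vec n p"
      by (auto simp: space_pair_measure)
    have "pred_obs S p u $ a = (\<Sum>i<n. mean_mat S u $$ (a, i) * p $ i)" if "a < odim S u" for a
      using that prob_vec_carrier[OF p]
      by (simp add: pred_obs_def scalar_prod_eq_sum[OF prob_vec_carrier[OF p]] carrier_matD[OF mean_mat_carrier]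
          del: mean_mat_index)
    then have "filtered S p u y $ r = p $ r + (\<Sum>a<odim S u. gain S p u $$ (r, a) *
      (y $ a - (\<Sum>i<n. mean_mat S u $$ (a, i) * p $ i)))" if "r < n" for r
      using that p u
      by (simp add: filtered_index scalar_prod_eq_sum[OF diff_carrier_vec[OF pred_obs_carrier]] del: mean_mat_index)
    then show "(case z of (p, y) \<Rightarrow> \<Sum>r<n. (p $ r + (\<Sum>a<odim S u. gain S p u $$ (r, a) *
      (y $ a - (\<Sum>i<n. mean_mat S u $$ (a, i) * p $ i))))\<^sup>2) = (case z of (p, y) \<Rightarrow> filt_sq p u y)"
      by (simp add: z filt_sq_def)
  qed
  finally show ?thesis .
qed

section \<open>Predictive likelihood and posterior\<close>

definition lik :: "real vec \<Rightarrow> 'u \<Rightarrow> real vec \<Rightarrow> real" where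
  "lik p u y = (\<Sum>i<n. p $ i * obs_density S i u y)"

lemma lik_mat_mult: 
  assumes "prob_vec n p"
  shows "lik_mat S y u *\<^sub>v p \<in> carrier_vec n"
    and "i < n \<Longrightarrow> (lik_mat S y u *\<^sub>v p) $ i = p $ i * obs_density S i u y"
proof -
  have L: "lik_mat S y u \<in> carrier_mat n n" by (simp add: lik_mat_def)
  show "lik_mat S y u *\<^sub>v p \<in> carrier_vec n"
    by (rule mult_mat_vec_carrier[OF L prob_vec_carrier[OF assms]])
  assume i: "i < n"
  have "(lik_mat S y u *\<^sub>v p) $ i = (\<Sum>j<n. (if i = j then obs_density S j u y else 0) * p $ j)"
    using i by (simp add: scalar_prod_eq_sum[OF prob_vec_carrier[OF assms]] carrier_matD[OF L])
      (simp add: lik_mat_def mat_diag_def)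
  also have "\<dots> = (\<Sum>j<n. if i = j then p $ j * obs_density S j u y else 0)"
    by (intro sum.cong) auto
  finally show "(lik_mat S y u *\<^sub>v p) $ i = p $ i * obs_density S i u y" using i by simp
qed

lemma ones_lik: "prob_vec n p \<Longrightarrow> ones n \<bullet> (lik_mat S y u *\<^sub>v p) = lik p u y"
  by (simp add: scalar_prod_eq_sum[OF lik_mat_mult(1)] ones_def lik_mat_mult(2) lik_def del: index_mult_mat_vec)

text \<open>Gaussian densities are positive everywhere and some state has positive weight, so the
  Bayes denominator vanishes for no observation.\<close>

lemma lik_pos:
  assumes p: "prob_vec n p" and u: "u \<in> ctrls S"
  shows "0 < lik p u y"
proof -
  obtain i where i: "i < n" "p $ i \<noteq> 0" by (rule prob_vec_nonzero[OF p])
  have pi: "0 \<le> p $ i" if "i < n" for i using p that by (simp add: prob_vec_def)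
  have "0 < p $ i"
    using i(2) pi[OF i(1)] by (simp add: order_less_le)
  then have "0 < p $ i * obs_density S i u y"
    using obs_density_pos[OF u i(1), of y] by simp
  then show ?thesis
    unfolding lik_def using i pi obs_density_pos[OF u]
    by (intro sum_pos2[of _ i]) (auto simp: less_imp_le)
qed

lemma bayes_index:
  assumes p: "prob_vec n p" and j: "j < n"
  shows "bayes S p u y $ j = (\<Sum>i<n. tmat S $$ (j, i) * (p $ i * obs_density S i u y)) / lik p u y"
proof -
  define w where "w = lik_mat S y u *\<^sub>v p"
  have w: "w \<in> carrier_vec n" "\<And>i. i < n \<Longrightarrow> w $ i = p $ i * obs_density S i u y"
    using lik_mat_mult[OF p] by (auto simp: w_def simp del: index_mult_mat_vec)
  have "(tmat S *\<^sub>v w) $ j = (\<Sum>i<n. tmat S $$ (j, i) * (p $ i * obs_density S i u y))"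
    using j by (simp add: scalar_prod_eq_sum[OF w(1)] carrier_matD[OF tmat_carrier] w(2))
  then show ?thesis
    using j unfolding bayes_def ones_lik[OF p] unfolding w_def[symmetric]
    by (simp add: carrier_matD[OF tmat_carrier] del: index_mult_mat_vec(1))
qed

lemma tmat_nonneg: "i < n \<Longrightarrow> j < n \<Longrightarrow> 0 \<le> tmat S $$ (j, i)"
  using tmat_col[of i] carrier_matD[OF tmat_carrier] by (simp add: prob_vec_def)

lemma tmat_sum: "i < n \<Longrightarrow> (\<Sum>j<n. tmat S $$ (j, i)) = 1"
  using tmat_col[of i] carrier_matD[OF tmat_carrier] by (simp add: prob_vec_def)

lemma bayes_prob_vec:
  assumes p: "prob_vec n p" and u: "u \<in> ctrls S"
  shows "prob_vec n (bayes S p u y)"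
proof -
  have dim: "bayes S p u y \<in> carrier_vec n"
    by (rule carrier_vecI) (simp add: bayes_def carrier_matD[OF tmat_carrier])
  have "(\<Sum>j<n. \<Sum>i<n. tmat S $$ (j, i) * (p $ i * obs_density S i u y)) =
      (\<Sum>i<n. \<Sum>j<n. tmat S $$ (j, i) * (p $ i * obs_density S i u y))"
    by (rule sum.swap)
  also have "\<dots> = lik p u y"
    by (simp add: sum_distrib_right[symmetric] tmat_sum lik_def)
  finally have "(\<Sum>j<n. bayes S p u y $ j) = 1"
    using lik_pos[OF p u, of y] by (simp add: bayes_index[OF p] sum_divide_distrib[symmetric])
  moreover have "0 \<le> bayes S p u y $ j" if "j < n" for j
    unfolding bayes_index[OF p that]
    using lik_pos[OF p u, of y] obs_density_pos[OF u] tmat_nonneg that p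
    by (intro divide_nonneg_nonneg sum_nonneg mult_nonneg_nonneg) (auto simp: less_imp_le prob_vec_def)
  ultimately show ?thesis using dim by (simp add: prob_vec_def)
qed

lemma lik_measurable:
  assumes u: "u \<in> ctrls S"
  shows "(\<lambda>(p, y). lik p u y) \<in> borel_measurable (belief_space \<Otimes>\<^sub>M borel_vec)"
  unfolding lik_def split_beta'
  by (intro borel_measurable_sum borel_measurable_times measurable_compose[OF measurable_fst]
      measurable_compose[OF measurable_snd] measurable_belief_index obs_density_measurable[OF u]) auto

lemma bayes_measurable:
  assumes u: "u \<in> ctrls S"
  shows "(\<lambda>(p, y). bayes S p u y) \<in> belief_space \<Otimes>\<^sub>M borel_vec \<rightarrow>\<^sub>M belief_space"
proof (rule measurable_belief_spaceI)
  fix z :: "real vec \<times> real vec" assume "z \<in> space (belief_space \<Otimes>\<^sub>M borel_vec)"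
  then show "prob_vec n (case z of (p, y) \<Rightarrow> bayes S p u y)"
    by (auto simp: space_pair_measure bayes_prob_vec u)
next
  fix j assume j: "j < n"
  have "(\<lambda>(p, y). (\<Sum>i<n. tmat S $$ (j, i) * (p $ i * obs_density S i u y)) / lik p u y)
      \<in> borel_measurable (belief_space \<Otimes>\<^sub>M borel_vec)"
    unfolding split_beta'
    by (intro borel_measurable_divide borel_measurable_sum borel_measurable_times borel_measurable_const
        measurable_compose[OF measurable_fst] measurable_compose[OF measurable_snd]
        measurable_belief_index obs_density_measurable[OF u] lik_measurable[OF u, unfolded split_beta']) auto
  also have "?this \<longleftrightarrow> (\<lambda>z. (case z of (p, y) \<Rightarrow> bayes S p u y) $ j) \<in> borel_measurable (belief_space \<Otimes>\<^sub>M borel_vec)"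
    by (rule measurable_cong) (auto simp: space_pair_measure bayes_index j)
  finally show "(\<lambda>z. (case z of (p, y) \<Rightarrow> bayes S p u y) $ j) \<in> borel_measurable (belief_space \<Otimes>\<^sub>M borel_vec)" .
qed

text \<open>Predictive law of the observation, with the hidden state averaged out.\<close>

definition mix_law :: "real vec \<Rightarrow> 'u \<Rightarrow> real vec measure" where
  "mix_law p u = density (lborel_vec (odim S u)) (\<lambda>y. ennreal (lik p u y))"

lemma sets_mix_law [simp, measurable_cong]: "sets (mix_law p u) = sets borel_vec"
  by (simp add: mix_law_def)

lemma space_mix_law [simp]: "space (mix_law p u) = UNIV"
  by (simp add: mix_law_def)

lemma lik_measurable1 [measurable]: "u \<in> ctrls S \<Longrightarrow> lik p u \<in> borel_measurable borel_vec"
  unfolding lik_def[abs_def]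
  by (intro borel_measurable_sum borel_measurable_times borel_measurable_const obs_density_measurable) auto

lemma nn_integral_mix_law_lborel:
  assumes "u \<in> ctrls S" "F \<in> borel_measurable borel_vec"
  shows "(\<integral>\<^sup>+y. F y \<partial>mix_law p u) = (\<integral>\<^sup>+y. ennreal (lik p u y) * F y \<partial>lborel_vec (odim S u))"
  unfolding mix_law_def using assms by (intro nn_integral_density) auto

lemma nn_integral_mix_law:
  assumes p: "prob_vec n p" and u: "u \<in> ctrls S" and F: "F \<in> borel_measurable borel_vec"
  shows "(\<integral>\<^sup>+y. F y \<partial>mix_law p u) = (\<Sum>i<n. ennreal (p $ i) * (\<integral>\<^sup>+y. F y \<partial>obs_law S i u))"
proof -
  have pi: "0 \<le> p $ i" if "i < n" for i using p that by (simp add: prob_vec_def)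
  have d: "0 \<le> obs_density S i u y" if "i < n" for i y using obs_density_pos[OF u that, of y] by simp
  have "(\<integral>\<^sup>+y. F y \<partial>mix_law p u) = (\<integral>\<^sup>+y. (\<Sum>i<n. ennreal (p $ i) * (ennreal (obs_density S i u y) * F y))
      \<partial>lborel_vec (odim S u))"
    unfolding nn_integral_mix_law_lborel[OF u F] lik_def
  proof (rule nn_integral_cong)
    fix y
    have "ennreal (\<Sum>i<n. p $ i * obs_density S i u y) = (\<Sum>i<n. ennreal (p $ i) * ennreal (obs_density S i u y))"
      using pi d by (subst sum_ennreal[symmetric]) (auto simp: ennreal_mult intro!: sum.cong)
    then show "ennreal (\<Sum>i<n. p $ i * obs_density S i u y) * F y =
        (\<Sum>i<n. ennreal (p $ i) * (ennreal (obs_density S i u y) * F y))"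
      by (simp add: sum_distrib_right mult.assoc)
  qed
  also have "\<dots> = (\<Sum>i<n. \<integral>\<^sup>+y. ennreal (p $ i) * (ennreal (obs_density S i u y) * F y) \<partial>lborel_vec (odim S u))"
    using F obs_density_measurable[OF u] by (intro nn_integral_sum) auto
  also have "\<dots> = (\<Sum>i<n. ennreal (p $ i) * (\<integral>\<^sup>+y. F y \<partial>obs_law S i u))"
    using F obs_density_measurable[OF u]
    by (intro sum.cong refl) (auto simp: nn_integral_cmult nn_integral_obs_law[OF u])
  finally show ?thesis .
qed

lemma prob_space_mix_law:
  assumes p: "prob_vec n p" and u: "u \<in> ctrls S"
  shows "prob_space (mix_law p u)"
proof (rule prob_spaceI)
  have pi: "0 \<le> p $ i" if "i < n" for i using p that by (simp add: prob_vec_def)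
  have "emeasure (mix_law p u) (space (mix_law p u)) = (\<integral>\<^sup>+y. 1 \<partial>mix_law p u)" by simp
  also have "\<dots> = (\<Sum>i<n. ennreal (p $ i))"
  proof -
    have "(\<integral>\<^sup>+y. 1 \<partial>obs_law S i u) = 1" if "i < n" for i
      using prob_space.emeasure_space_1[OF prob_space_obs_law[OF u that]] by simp
    then show ?thesis by (subst nn_integral_mix_law[OF p u]) auto
  qed
  also have "\<dots> = ennreal (\<Sum>i<n. p $ i)" using pi by (intro sum_ennreal) auto
  finally show "emeasure (mix_law p u) (space (mix_law p u)) = 1"
    using p by (simp add: prob_vec_def)
qed

text \<open>Two factorizations of the joint law of an observation and the next state: draw the
  state, its observation and the transition, or draw the observation from the predictive law and
  then the next state from the updated belief. Stating it for a family \<open>F\<close> indexed by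
  the next state is what lets it be iterated along a trajectory.\<close>

lemma bayes_rule:
  assumes p: "prob_vec n p" and u: "u \<in> ctrls S"
    and F: "\<And>j. j < n \<Longrightarrow> F j \<in> borel_measurable borel_vec"
  shows "(\<Sum>i<n. ennreal (p $ i) * (\<integral>\<^sup>+y. (\<Sum>j<n. ennreal (tmat S $$ (j, i)) * F j y) \<partial>obs_law S i u)) =
    (\<integral>\<^sup>+y. (\<Sum>j<n. ennreal (bayes S p u y $ j) * F j y) \<partial>mix_law p u)"
proof -
  let ?M = "lborel_vec (odim S u)"
  have pi: "0 \<le> p $ i" if "i < n" for i using p that by (simp add: prob_vec_def)
  have d: "0 \<le> obs_density S i u y" if "i < n" for i y using obs_density_pos[OF u that, of y] by simp
  note [measurable] = F obs_density_measurable[OF u]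
  have bm [measurable]: "(\<lambda>y. bayes S p u y $ j) \<in> borel_measurable borel_vec" for j
    using measurable_compose[OF measurable_Pair1' measurable_compose[OF bayes_measurable[OF u] measurable_belief_index], of p j] p
    by simp
  have "(\<Sum>i<n. ennreal (p $ i) * (\<integral>\<^sup>+y. (\<Sum>j<n. ennreal (tmat S $$ (j, i)) * F j y) \<partial>obs_law S i u)) =
      (\<Sum>i<n. \<integral>\<^sup>+y. ennreal (p $ i) * (ennreal (obs_density S i u y) *
        (\<Sum>j<n. ennreal (tmat S $$ (j, i)) * F j y)) \<partial>?M)"
    by (intro sum.cong refl) (auto simp: nn_integral_obs_law[OF u] nn_integral_cmult)
  also have "\<dots> = (\<integral>\<^sup>+y. (\<Sum>i<n. ennreal (p $ i) * (ennreal (obs_density S i u y) *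
        (\<Sum>j<n. ennreal (tmat S $$ (j, i)) * F j y))) \<partial>?M)"
    by (rule nn_integral_sum[symmetric]) auto
  also have "\<dots> = (\<integral>\<^sup>+y. ennreal (lik p u y) * (\<Sum>j<n. ennreal (bayes S p u y $ j) * F j y) \<partial>?M)"
  proof (rule nn_integral_cong)
    fix y
    have "(\<Sum>i<n. ennreal (p $ i) * (ennreal (obs_density S i u y) * (\<Sum>j<n. ennreal (tmat S $$ (j, i)) * F j y))) =
        (\<Sum>i<n. \<Sum>j<n. ennreal (tmat S $$ (j, i) * (p $ i * obs_density S i u y)) * F j y)"
      using pi d tmat_nonneg
      by (intro sum.cong refl) (auto simp: sum_distrib_left ennreal_mult mult_ac intro!: sum.cong)
    also have "\<dots> = (\<Sum>j<n. \<Sum>i<n. ennreal (tmat S $$ (j, i) * (p $ i * obs_density S i u y)) * F j y)"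
      by (rule sum.swap)
    also have "\<dots> = (\<Sum>j<n. ennreal (\<Sum>i<n. tmat S $$ (j, i) * (p $ i * obs_density S i u y)) * F j y)"
      using pi d tmat_nonneg
      by (intro sum.cong refl, unfold sum_distrib_right[symmetric], subst sum_ennreal)
        (auto intro!: mult_nonneg_nonneg)
    \<comment> \<open>Multiplication by the likelihood cancels the denominator of the
      posterior.\<close>
    also have "\<dots> = (\<Sum>j<n. ennreal (lik p u y * bayes S p u y $ j) * F j y)"
      using lik_pos[OF p u, of y] by (intro sum.cong refl) (simp add: bayes_index[OF p])
    also have "\<dots> = ennreal (lik p u y) * (\<Sum>j<n. ennreal (bayes S p u y $ j) * F j y)"
      using lik_pos[OF p u, of y] by (simp add: sum_distrib_left ennreal_mult' mult.assoc)
    finally show "(\<Sum>i<n. ennreal (p $ i) * (ennreal (obs_density S i u y) * (\<Sum>j<n. ennreal (tmat S $$ (j, i)) * F j y))) =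
        ennreal (lik p u y) * (\<Sum>j<n. ennreal (bayes S p u y $ j) * F j y)" .
  qed
  also have "\<dots> = (\<integral>\<^sup>+y. (\<Sum>j<n. ennreal (bayes S p u y $ j) * F j y) \<partial>mix_law p u)"
    by (rule nn_integral_mix_law_lborel[symmetric, OF u]) auto
  finally show ?thesis .
qed

section \<open>The value functions\<close>

lemma h_comp_le_1:
  assumes p: "prob_vec n p" and u: "u \<in> ctrls S" and i: "i < n"
  shows "h_comp S i p u \<le> 1"
proof -
  have "0 \<le> 1 - h_comp S i p u"
    unfolding h_comp_eq[OF p u i]
    by (intro sum_nonneg add_nonneg_nonneg ocov_form_nonneg[OF u i row_gain_carrier[OF p u]]) simp
  then show ?thesis by simp
qed

lemma h_vec_le_1:
  assumes p: "prob_vec n p" and u: "u \<in> ctrls S"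
  shows "p \<bullet> h_vec S p u \<le> 1"
proof -
  have "p \<bullet> h_vec S p u \<le> (\<Sum>i<n. p $ i * 1)"
    unfolding scalar_h_vec using p h_comp_le_1[OF p u]
    by (intro sum_mono mult_left_mono) (auto simp: prob_vec_def)
  then show ?thesis using p by (simp add: prob_vec_def)
qed

lemma filt_sq_measurable1:
  assumes "u \<in> ctrls S" "prob_vec n p"
  shows "(\<lambda>y. filt_sq p u y) \<in> borel_measurable borel_vec"
  using measurable_compose[OF measurable_Pair1' filt_sq_measurable[OF assms(1)], of p] assms(2) by simp

lemma mix_law_filt_sq:
  assumes p: "prob_vec n p" and u: "u \<in> ctrls S"
  shows "(\<integral>\<^sup>+y. ennreal (filt_sq p u y) \<partial>mix_law p u) = ennreal (1 - p \<bullet> h_vec S p u)"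
proof -
  have "(\<integral>\<^sup>+y. ennreal (filt_sq p u y) \<partial>mix_law p u) = (\<Sum>i<n. ennreal (p $ i) * ennreal (1 - h_comp S i p u))"
    using filt_sq_measurable1[OF u p]
    by (subst nn_integral_mix_law[OF p u]) (auto simp: obs_law_filt_sq_h[OF p u])
  also have "\<dots> = (\<Sum>i<n. ennreal (p $ i * (1 - h_comp S i p u)))"
    using p by (intro sum.cong refl) (simp add: ennreal_mult' prob_vec_def)
  also have "\<dots> = ennreal (\<Sum>i<n. p $ i * (1 - h_comp S i p u))"
    using p h_comp_le_1[OF p u] by (intro sum_ennreal) (simp add: prob_vec_def)
  also have "(\<Sum>i<n. p $ i * (1 - h_comp S i p u)) = 1 - p \<bullet> h_vec S p u"
    using p by (simp add: scalar_h_vec right_diff_distrib sum_subtractf prob_vec_def)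
  finally show ?thesis .
qed

text \<open>
  Since the stage cost is \<open>1\<close> minus the squared norm of the filtered belief, minimizing the cost over
  \<open>m\<close> stages means maximizing a nonnegative reward, whose optimal value is \<open>value_fn m\<close>.
\<close>

primrec value_fn :: "nat \<Rightarrow> real vec \<Rightarrow> ennreal" where
  "value_fn 0 = (\<lambda>p. 0)"
| "value_fn (Suc m) = (\<lambda>p. Max ((\<lambda>u.
     \<integral>\<^sup>+y. (ennreal (filt_sq p u y) + value_fn m (bayes S p u y)) \<partial>mix_law p u) ` ctrls S))"

text \<open>The Q-function of dynamic programming: control \<open>u\<close> at the present stage,
  then optimal behaviour for \<open>m\<close> more stages.\<close>

definition action_value :: "nat \<Rightarrow> real vec \<Rightarrow> 'u \<Rightarrow> ennreal" where
  "action_value m p u = (\<integral>\<^sup>+y. (ennreal (filt_sq p u y) + value_fn m (bayes S p u y)) \<partial>mix_law p u)"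

lemma value_fn_Suc: "value_fn (Suc m) p = Max (action_value m p ` ctrls S)"
  by (simp add: action_value_def[abs_def])

lemma action_value_le: "u \<in> ctrls S \<Longrightarrow> action_value m p u \<le> value_fn (Suc m) p"
  unfolding value_fn_Suc by (intro Max_ge) auto

lemma integrand_measurable:
  assumes u: "u \<in> ctrls S" and V: "value_fn m \<in> borel_measurable belief_space"
  shows "(\<lambda>(p, y). ennreal (filt_sq p u y) + value_fn m (bayes S p u y)) \<in> borel_measurable (belief_space \<Otimes>\<^sub>M borel_vec)"
  using filt_sq_measurable[OF u] measurable_compose[OF bayes_measurable[OF u] V]
  unfolding split_beta' by measurable

text \<open>The measure \<open>mix_law p u\<close> itself varies with \<open>p\<close>. Writing it
  as a finite mixture of the fixed laws \<open>obs_law S i u\<close> leaves parameter integrals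
  against fixed measures. Measurability of \<open>value_fn m\<close> is a premise here because it is
  proved by induction through this lemma.\<close>

lemma action_value_measurable_aux:
  assumes u: "u \<in> ctrls S" and V: "value_fn m \<in> borel_measurable belief_space"
  shows "(\<lambda>p. action_value m p u) \<in> borel_measurable belief_space"
proof -
  note F = integrand_measurable[OF u V]
  have I: "(\<lambda>p. \<integral>\<^sup>+y. (ennreal (filt_sq p u y) + value_fn m (bayes S p u y)) \<partial>obs_law S i u)
      \<in> borel_measurable belief_space" if i: "i < n" for i
  proof -
    interpret prob_space "obs_law S i u" by (rule prob_space_obs_law[OF u i])
    show ?thesis
      by (rule borel_measurable_nn_integral)
        (use F in \<open>simp cong: measurable_cong_sets sets_pair_measure_cong\<close>)
  qed
  have "(\<lambda>p. \<Sum>i<n. ennreal (p $ i) *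
      (\<integral>\<^sup>+y. (ennreal (filt_sq p u y) + value_fn m (bayes S p u y)) \<partial>obs_law S i u)) \<in> borel_measurable belief_space"
    by (intro borel_measurable_sum borel_measurable_times_ennreal measurable_compose[OF measurable_belief_index]
        measurable_ennreal I) auto
  also have "?this \<longleftrightarrow> ?thesis"
  proof (rule measurable_cong)
    fix p assume "p \<in> space belief_space"
    then have p: "prob_vec n p" by simp
    have "(\<lambda>y. ennreal (filt_sq p u y) + value_fn m (bayes S p u y)) \<in> borel_measurable borel_vec"
      using measurable_compose[OF measurable_Pair1' F, of p] p by simp
    then show "(\<Sum>i<n. ennreal (p $ i) *
      (\<integral>\<^sup>+y. (ennreal (filt_sq p u y) + value_fn m (bayes S p u y)) \<partial>obs_law S i u)) = action_value m p u"
      unfolding action_value_def by (rule nn_integral_mix_law[OF p u, symmetric])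
  qed
  finally show ?thesis .
qed

lemma value_fn_measurable: "value_fn m \<in> borel_measurable belief_space"
proof (induction m)
  case (Suc m)
  have "value_fn (Suc m) = (\<lambda>p. Max ((\<lambda>u. action_value m p u) ` ctrls S))"
    by (rule ext) (rule value_fn_Suc)
  then show ?case
    using action_value_measurable_aux[OF _ Suc] by (simp add: borel_measurable_Max del: value_fn.simps)
qed simp

lemmas action_value_measurable = action_value_measurable_aux[OF _ value_fn_measurable]

lemma value_bayes_measurable:
  assumes "u \<in> ctrls S" "prob_vec n p"
  shows "(\<lambda>y. value_fn m (bayes S p u y)) \<in> borel_measurable borel_vec"
  using measurable_compose[OF measurable_Pair1' measurable_compose[OF bayes_measurable[OF assms(1)] value_fn_measurable], of p m] assms(2)
  by simp

lemma action_value_split: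
  assumes p: "prob_vec n p" and u: "u \<in> ctrls S"
  shows "action_value m p u = ennreal (1 - p \<bullet> h_vec S p u) + (\<integral>\<^sup>+y. value_fn m (bayes S p u y) \<partial>mix_law p u)"
  unfolding action_value_def using filt_sq_measurable1[OF u p] value_bayes_measurable[OF u p]
  by (subst nn_integral_add) (auto simp: mix_law_filt_sq[OF p u])

lemma nn_integral_mix_law_bound:
  assumes p: "prob_vec n p" and u: "u \<in> ctrls S" and le: "\<And>y. f y \<le> (c :: ennreal)"
  shows "(\<integral>\<^sup>+y. f y \<partial>mix_law p u) \<le> c"
proof -
  interpret prob_space "mix_law p u" by (rule prob_space_mix_law[OF p u])
  have "(\<integral>\<^sup>+y. f y \<partial>mix_law p u) \<le> (\<integral>\<^sup>+y. c \<partial>mix_law p u)"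
    by (intro nn_integral_mono le)
  also have "\<dots> = c" using emeasure_space_1 by simp
  finally show ?thesis .
qed

lemma action_value_bound_aux:
  assumes p: "prob_vec n p" and u: "u \<in> ctrls S"
    and V: "\<And>q. prob_vec n q \<Longrightarrow> value_fn m q \<le> of_nat m"
  shows "action_value m p u \<le> of_nat (Suc m)"
proof -
  have "(\<integral>\<^sup>+y. value_fn m (bayes S p u y) \<partial>mix_law p u) \<le> of_nat m"
    by (rule nn_integral_mix_law_bound[OF p u V[OF bayes_prob_vec[OF p u]]])
  moreover have "ennreal (1 - p \<bullet> h_vec S p u) \<le> 1"
    using h_vec_nonneg[OF p u] by simp
  ultimately show ?thesis
    unfolding action_value_split[OF p u] by (simp add: add_mono)
qed

text \<open>Each stage adds at most 1 to the mean reward, by \<open>h_vec_nonneg\<close>. Finiteness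
  of every value function is what later allows subtraction in the reals.\<close>

lemma value_fn_bound: "prob_vec n p \<Longrightarrow> value_fn m p \<le> of_nat m"
proof (induction m arbitrary: p)
  case (Suc m)
  then show ?case
    unfolding value_fn_Suc by (intro Max.boundedI) (auto intro: action_value_bound_aux simp del: of_nat_Suc)
qed simp

lemma value_fn_finite: "prob_vec n p \<Longrightarrow> value_fn m p < \<top>"
  by (rule le_less_trans[OF value_fn_bound of_nat_less_top])

lemma action_value_finite: "prob_vec n p \<Longrightarrow> u \<in> ctrls S \<Longrightarrow> action_value m p u < \<top>"
  using action_value_le[of u m p] value_fn_finite[of p "Suc m"] by (rule le_less_trans)

section \<open>The law of the controlled process\<close>

lemma measurable_Pair_ctrl [measurable]:
  assumes "U \<in> N \<rightarrow>\<^sub>M count_space (ctrls S)" "Y \<in> N \<rightarrow>\<^sub>M borel_vec"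
  shows "(\<lambda>x. (U x, Y x)) \<in> N \<rightarrow>\<^sub>M obs_space S"
  unfolding obs_space_def using assms by measurable

lemma measurable_stage:
  assumes "i < n" "u \<in> ctrls S"
  shows "(\<lambda>y. (i, u, y)) \<in> borel_vec \<rightarrow>\<^sub>M stage_space S"
  unfolding stage_space_def obs_space_def using assms
  by (intro measurable_Pair) auto

lemma measurable_state_fst: "fst \<in> stage_space S \<rightarrow>\<^sub>M count_space {..<n}"
  unfolding stage_space_def by measurable

lemma measurable_obs_snd: "snd \<in> stage_space S \<rightarrow>\<^sub>M obs_space S"
  unfolding stage_space_def by measurable

lemma measurable_ctrl_fst: "fst \<in> obs_space S \<rightarrow>\<^sub>M count_space (ctrls S)"
  unfolding obs_space_def by measurable

lemma measurable_obsv_snd: "snd \<in> obs_space S \<rightarrow>\<^sub>M borel_vec"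
  unfolding obs_space_def by measurable

lemma prob_space_stage_distr:
  assumes "i < n" "u \<in> ctrls S"
  shows "prob_space (distr (obs_law S i u) (stage_space S) (\<lambda>y. (i, u, y)))"
  using measurable_stage[OF assms]
  by (intro prob_space.prob_space_distr prob_space_obs_law assms) (simp cong: measurable_cong_sets)

lemma space_state_law [simp]: "space (state_law S p) = {..<n}"
  by (simp add: state_law_def space_point_measure)

lemma stage_kernel:
  assumes "u \<in> ctrls S"
  shows "(\<lambda>i. distr (obs_law S i u) (stage_space S) (\<lambda>y. (i, u, y))) \<in> state_law S p \<rightarrow>\<^sub>M prob_algebra (stage_space S)"
  unfolding state_law_def measurable_point_measure_eq1
  using prob_space_stage_distr[OF _ assms] by (auto simp: space_prob_algebra)

lemma nn_integral_stage_law: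
  assumes p: "prob_vec n p" and u: "u \<in> ctrls S" and g: "g \<in> borel_measurable (stage_space S)"
  shows "(\<integral>\<^sup>+z. g z \<partial>stage_law S p u) = (\<Sum>i<n. ennreal (p $ i) * (\<integral>\<^sup>+y. g (i, u, y) \<partial>obs_law S i u))"
proof -
  have "(\<integral>\<^sup>+z. g z \<partial>stage_law S p u) =
      (\<integral>\<^sup>+i. \<integral>\<^sup>+z. g z \<partial>distr (obs_law S i u) (stage_space S) (\<lambda>y. (i, u, y)) \<partial>state_law S p)"
    unfolding stage_law_def
    by (rule nn_integral_bind[OF g measurable_prob_algebraD[OF stage_kernel[OF u]]])
  also have "\<dots> = (\<Sum>i<n. ennreal (p $ i) *
      (\<integral>\<^sup>+z. g z \<partial>distr (obs_law S i u) (stage_space S) (\<lambda>y. (i, u, y))))"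
    unfolding state_law_def by (rule nn_integral_point_measure_finite) simp
  also have "\<dots> = (\<Sum>i<n. ennreal (p $ i) * (\<integral>\<^sup>+y. g (i, u, y) \<partial>obs_law S i u))"
  proof (intro sum.cong refl arg_cong2[where f = "(*)"])
    fix i assume "i \<in> {..<n}"
    then have "(\<lambda>y. (i, u, y)) \<in> obs_law S i u \<rightarrow>\<^sub>M stage_space S"
      using measurable_stage[OF _ u, of i] by (simp cong: measurable_cong_sets)
    then show "(\<integral>\<^sup>+z. g z \<partial>distr (obs_law S i u) (stage_space S) (\<lambda>y. (i, u, y))) =
        (\<integral>\<^sup>+y. g (i, u, y) \<partial>obs_law S i u)"
      by (rule nn_integral_distr) (use g in simp)
  qed
  finally show ?thesis .
qed

lemma prob_space_state_law:
  assumes p: "prob_vec n p"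
  shows "prob_space (state_law S p)"
proof (rule prob_spaceI)
  have "emeasure (state_law S p) (space (state_law S p)) = (\<Sum>i<n. ennreal (p $ i))"
    by (simp add: space_state_law) (simp add: state_law_def emeasure_point_measure_finite)
  also have "\<dots> = ennreal (\<Sum>i<n. p $ i)"
    using p by (intro sum_ennreal) (simp add: prob_vec_def)
  finally show "emeasure (state_law S p) (space (state_law S p)) = 1"
    using p by (simp add: prob_vec_def)
qed

lemma stage_law_prob_algebra:
  assumes p: "prob_vec n p" and u: "u \<in> ctrls S"
  shows "stage_law S p u \<in> space (prob_algebra (stage_space S))"
proof -
  interpret prob_space "state_law S p" by (rule prob_space_state_law[OF p])
  have "prob_space (stage_law S p u)"
    unfolding stage_law_def
    using stage_kernel[OF u, of p] prob_space_stage_distr[OF _ u]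
    by (intro prob_space_bind[where S = "stage_space S"] measurable_prob_algebraD) auto
  moreover have "sets (stage_law S p u) = sets (stage_space S)"
    unfolding stage_law_def by (rule sets_bind) (use n_pos in auto)
  ultimately show ?thesis by (simp add: space_prob_algebra)
qed

section \<open>Observed history and the belief computed from it\<close>

lemma info_measurable: "info k t \<in> traj_space S k t \<rightarrow>\<^sub>M info_space S k t"
  unfolding info_def[abs_def] info_space_def traj_space_def
  by (rule measurable_restrict, rule measurable_compose[OF _ measurable_obs_snd],
      rule measurable_component_singleton)

lemma info_upd:
  "k \<le> Suc t \<Longrightarrow> info k (Suc t) (\<tau>(Suc t := (i, u, y))) = (info k t \<tau>)(Suc t := (u, y))"
  by (auto simp: info_def restrict_def fun_eq_iff)

lemma info_space_upd:
  assumes "k \<le> Suc t" "f \<in> N \<rightarrow>\<^sub>M info_space S k t" "U \<in> N \<rightarrow>\<^sub>M count_space (ctrls S)" "Y \<in> N \<rightarrow>\<^sub>M borel_vec"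
  shows "(\<lambda>x. (f x)(Suc t := (U x, Y x))) \<in> N \<rightarrow>\<^sub>M info_space S k (Suc t)"
  unfolding info_space_def
  by (rule measurable_fun_upd[where J = "{k..t}"])
    (use assms in \<open>auto simp: info_space_def intro: measurable_Pair_ctrl\<close>)

text \<open>\<open>predicted\<close> reads a trajectory that still contains the hidden states. This
  version reads the observed history only, so it can be used by a policy and is measurable on
  \<open>info_space\<close>.\<close>

primrec belief :: "nat \<Rightarrow> real vec \<Rightarrow> (nat \<Rightarrow> 'u \<times> real vec) \<Rightarrow> nat \<Rightarrow> real vec" where
  "belief k p \<iota> 0 = p"
| "belief k p \<iota> (Suc j) = bayes S (belief k p \<iota> j) (fst (\<iota> (k + j))) (snd (\<iota> (k + j)))"

text \<open>The belief of index \<open>j\<close> uses the observations before stage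
  \<open>k + j\<close> only, which is why a history up to \<open>t\<close> suffices for
  \<open>k + j \<le> Suc t\<close>.\<close>

lemma predicted_eq_belief: "k + j \<le> Suc t \<Longrightarrow> predicted S k p \<tau> j = belief k p (info k t \<tau>) j"
  by (induction j) (auto simp: info_def split: prod.splits)

lemma belief_upd: "k + j \<le> s \<Longrightarrow> belief k p (\<iota>(s := z)) j = belief k p \<iota> j"
  by (induction j) auto

lemma measurable_info_component:
  assumes "s \<in> {k..t}"
  shows "(\<lambda>\<iota>. fst (\<iota> s)) \<in> info_space S k t \<rightarrow>\<^sub>M count_space (ctrls S)"
    and "(\<lambda>\<iota>. snd (\<iota> s)) \<in> info_space S k t \<rightarrow>\<^sub>M borel_vec"
  unfolding info_space_def
  using measurable_compose[OF measurable_component_singleton[OF assms] measurable_ctrl_fst]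
    measurable_compose[OF measurable_component_singleton[OF assms] measurable_obsv_snd] by auto

text \<open>No structure on controls is available, so the control is frozen: for each of the
  finitely many values the map is measurable, and the pieces are glued along the measurable choice
  \<open>U\<close>.\<close>

lemma measurable_belief_step:
  assumes "b \<in> N \<rightarrow>\<^sub>M belief_space" "U \<in> N \<rightarrow>\<^sub>M count_space (ctrls S)" "Y \<in> N \<rightarrow>\<^sub>M borel_vec"
  shows "(\<lambda>x. bayes S (b x) (U x) (Y x)) \<in> N \<rightarrow>\<^sub>M belief_space"
proof (rule measurable_compose_countable'[where f = "\<lambda>u x. bayes S (b x) u (Y x)", OF _ assms(2)])
  fix u assume u: "u \<in> ctrls S"
  show "(\<lambda>x. bayes S (b x) u (Y x)) \<in> N \<rightarrow>\<^sub>M belief_space"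
    using measurable_compose[OF measurable_Pair[OF assms(1,3)] bayes_measurable[OF u]] by simp
qed (simp add: countable_finite)

lemma measurable_belief:
  assumes p: "prob_vec n p"
  shows "k + j \<le> Suc t \<Longrightarrow> (\<lambda>\<iota>. belief k p \<iota> j) \<in> info_space S k t \<rightarrow>\<^sub>M belief_space"
proof (induction j)
  case (Suc j)
  then show ?case
    unfolding belief.simps
    by (intro measurable_belief_step measurable_info_component) auto
qed (simp add: p)

end

locale controlled_policy = controlled_model S for S :: "'u model" +
  fixes k L :: nat and p :: "real vec" and v :: 'u
    and \<eta> :: "nat \<Rightarrow> (nat \<Rightarrow> 'u \<times> real vec) \<Rightarrow> 'u"
  assumes p: "prob_vec (nstates S) p" and adm: "admissible S L k v \<eta>"
begin

abbreviation "\<mu> \<equiv> traj_law S k p v \<eta>"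

lemma v: "v \<in> ctrls S"
  using adm by (simp add: admissible_def)

lemma policy_measurable: "k \<le> t \<Longrightarrow> t < L \<Longrightarrow> \<eta> t \<in> info_space S k t \<rightarrow>\<^sub>M count_space (ctrls S)"
  using adm by (simp add: admissible_def)

section \<open>The trajectory law as an iterated kernel\<close>

definition step_law :: "nat \<Rightarrow> (nat \<Rightarrow> nat \<times> 'u \<times> real vec) \<Rightarrow> (nat \<times> 'u \<times> real vec) measure" where
  "step_law t \<tau> = stage_law S (col (tmat S) (fst (\<tau> t))) (\<eta> t (info k t \<tau>))"

lemma step_law_measurable:
  assumes t: "k \<le> t" "t < L"
  shows "step_law t \<in> traj_space S k t \<rightarrow>\<^sub>M prob_algebra (stage_space S)"
proof -
  have x: "(\<lambda>\<tau>. fst (\<tau> t)) \<in> traj_space S k t \<rightarrow>\<^sub>M count_space {..<n}"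
    unfolding traj_space_def
    by (rule measurable_compose[OF _ measurable_state_fst], rule measurable_component_singleton)
      (use t in auto)
  have u: "(\<lambda>\<tau>. \<eta> t (info k t \<tau>)) \<in> traj_space S k t \<rightarrow>\<^sub>M count_space (ctrls S)"
    by (rule measurable_compose[OF info_measurable policy_measurable[OF t]])
  have K: "stage_law S (col (tmat S) i) w \<in> space (prob_algebra (stage_space S))" if "i < n" "w \<in> ctrls S" for i w
    using that tmat_col by (intro stage_law_prob_algebra)
  have "(\<lambda>\<tau>. stage_law S (col (tmat S) i) (\<eta> t (info k t \<tau>))) \<in> traj_space S k t \<rightarrow>\<^sub>M prob_algebra (stage_space S)"
    if "i < n" for i
    by (rule measurable_compose[OF u]) (use K[OF that] in auto)
  then show ?thesis
    unfolding step_law_def[abs_def]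
    by (intro measurable_compose_countable'[where f = "\<lambda>i \<tau>. stage_law S (col (tmat S) i) (\<eta> t (info k t \<tau>))", OF _ x]) auto
qed

lemma traj_upd_measurable:
  assumes "k \<le> Suc t"
  shows "(\<lambda>(\<tau>, z). \<tau>(Suc t := z)) \<in> traj_space S k t \<Otimes>\<^sub>M stage_space S \<rightarrow>\<^sub>M traj_space S k (Suc t)"
proof -
  have "{k..Suc t} = insert (Suc t) {k..t}" using assms by auto
  then show ?thesis
    unfolding traj_space_def by (simp add: measurable_add_dim)
qed

lemma step_kernel:
  assumes t: "k \<le> t" "t < L"
  shows "(\<lambda>\<tau>. distr (step_law t \<tau>) (traj_space S k (Suc t)) (\<lambda>z. \<tau>(Suc t := z)))
    \<in> traj_space S k t \<rightarrow>\<^sub>M prob_algebra (traj_space S k (Suc t))"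
proof (rule measurable_prob_algebraI)
  show "(\<lambda>\<tau>. distr (step_law t \<tau>) (traj_space S k (Suc t)) (\<lambda>z. \<tau>(Suc t := z)))
    \<in> traj_space S k t \<rightarrow>\<^sub>M subprob_algebra (traj_space S k (Suc t))"
    using t by (intro measurable_distr2[OF traj_upd_measurable measurable_prob_algebraD[OF step_law_measurable]]) auto
  fix \<tau> assume \<tau>: "\<tau> \<in> space (traj_space S k t)"
  from measurable_space[OF step_law_measurable[OF t] \<tau>]
  have P: "prob_space (step_law t \<tau>)" and s: "sets (step_law t \<tau>) = sets (stage_space S)"
    by (auto simp: space_prob_algebra)
  have "(\<lambda>z. \<tau>(Suc t := z)) \<in> step_law t \<tau> \<rightarrow>\<^sub>M traj_space S k (Suc t)"
    using measurable_compose[OF measurable_Pair1'[OF \<tau>] traj_upd_measurable[of t]] t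
    by (simp add: measurable_cong_sets[OF s refl])
  then show "prob_space (distr (step_law t \<tau>) (traj_space S k (Suc t)) (\<lambda>z. \<tau>(Suc t := z)))"
    by (rule prob_space.prob_space_distr[OF P])
qed

lemma traj_law_Suc:
  "\<mu> (Suc j) = \<mu> j \<bind> (\<lambda>\<tau>. distr (step_law (k + j) \<tau>) (traj_space S k (Suc (k + j))) (\<lambda>z. \<tau>(Suc (k + j) := z)))"
  by (simp add: step_law_def)

lemma traj_law_prob: "k + j \<le> L \<Longrightarrow> \<mu> j \<in> space (prob_algebra (traj_space S k (k + j)))"
proof (induction j)
  case 0
  have K: "prob_space (stage_law S p v)" and s: "sets (stage_law S p v) = sets (stage_space S)"
    using stage_law_prob_algebra[OF p v] by (auto simp: space_prob_algebra)
  have "(\<lambda>z. \<lambda>s\<in>{k}. z) \<in> stage_space S \<rightarrow>\<^sub>M traj_space S k k"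
    unfolding traj_space_def atLeastAtMost_singleton by (rule measurable_restrict) simp
  then have "prob_space (distr (stage_law S p v) (traj_space S k k) (\<lambda>z. \<lambda>s\<in>{k}. z))"
    by (intro prob_space.prob_space_distr[OF K]) (simp add: measurable_cong_sets[OF s refl])
  then show ?case by (simp add: space_prob_algebra)
next
  case (Suc j)
  then have M: "prob_space (\<mu> j)" and s: "sets (\<mu> j) = sets (traj_space S k (k + j))"
    by (auto simp: space_prob_algebra)
  have "(\<lambda>\<tau>. distr (step_law (k + j) \<tau>) (traj_space S k (Suc (k + j))) (\<lambda>z. \<tau>(Suc (k + j) := z)))
    \<in> \<mu> j \<rightarrow>\<^sub>M prob_algebra (traj_space S k (Suc (k + j)))"
    using step_kernel[of "k + j"] Suc.prems by (simp add: measurable_cong_sets[OF s refl])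
  then show ?case
    unfolding traj_law_Suc add_Suc_right
    by (intro measurable_space[OF measurable_bind_prob_space])
      (use Suc in \<open>simp_all add: measurable_cong_sets[OF s refl]\<close>)
qed

lemma sets_traj_law: "k + j \<le> L \<Longrightarrow> sets (\<mu> j) = sets (traj_space S k (k + j))"
  using traj_law_prob[of j] by (simp add: space_prob_algebra)

lemma space_traj_law: "k + j \<le> L \<Longrightarrow> space (\<mu> j) = space (traj_space S k (k + j))"
  using sets_traj_law[of j] by (rule sets_eq_imp_space_eq)

lemma prob_space_traj_law: "k + j \<le> L \<Longrightarrow> prob_space (\<mu> j)"
  using traj_law_prob[of j] by (simp add: space_prob_algebra)

lemma measurable_state_info:
  assumes H: "\<And>i. i < n \<Longrightarrow> H i \<in> borel_measurable (info_space S k t)" and t: "k \<le> t"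
  shows "(\<lambda>\<tau>. (H (fst (\<tau> t)) (info k t \<tau>) :: ennreal)) \<in> borel_measurable (traj_space S k t)"
proof (rule measurable_compose_countable'[where f = "\<lambda>i \<tau>. H i (info k t \<tau>)" and I = "{..<n}"])
  show "(\<lambda>\<tau>. fst (\<tau> t)) \<in> traj_space S k t \<rightarrow>\<^sub>M count_space {..<n}"
    unfolding traj_space_def
    by (rule measurable_compose[OF _ measurable_state_fst], rule measurable_component_singleton)
      (use t in auto)
qed (auto intro: measurable_compose[OF info_measurable] H)

text \<open>Mean of \<open>H\<close> one stage later, given that the next state is \<open>i\<close>.
  Apart from \<open>i\<close> it depends on the observed history alone, so it is an admissible test
  function for \<open>state_updated\<close>.\<close>

definition push :: "nat \<Rightarrow> nat \<Rightarrow> ((nat \<Rightarrow> 'u \<times> real vec) \<Rightarrow> ennreal) \<Rightarrow> (nat \<Rightarrow> 'u \<times> real vec) \<Rightarrow> ennreal" where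
  "push t i H \<iota> = (\<integral>\<^sup>+y. H (\<iota>(Suc t := (\<eta> t \<iota>, y))) \<partial>obs_law S i (\<eta> t \<iota>))"

text \<open>The integrating measure varies with the history only through the control, so freezing
  the control leaves an integral against a fixed law.\<close>

lemma push_measurable:
  assumes t: "k \<le> t" "t < L" and i: "i < n" and H: "H \<in> borel_measurable (info_space S k (Suc t))"
  shows "push t i H \<in> borel_measurable (info_space S k t)"
  unfolding push_def[abs_def]
proof (rule measurable_compose_countable'[where
      f = "\<lambda>u \<iota>. \<integral>\<^sup>+y. H (\<iota>(Suc t := (u, y))) \<partial>obs_law S i u" and I = "ctrls S"])
  fix u assume u: "u \<in> ctrls S"
  interpret prob_space "obs_law S i u" by (rule prob_space_obs_law[OF u i])
  have "(\<lambda>z. (fst z)(Suc t := (u, snd z))) \<in> info_space S k t \<Otimes>\<^sub>M borel_vec \<rightarrow>\<^sub>M info_space S k (Suc t)"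
    by (rule info_space_upd) (use t u in auto)
  from measurable_compose[OF this H]
  have "(\<lambda>z. H ((fst z)(Suc t := (u, snd z)))) \<in> borel_measurable (info_space S k t \<Otimes>\<^sub>M obs_law S i u)"
    by (simp cong: measurable_cong_sets sets_pair_measure_cong)
  then show "(\<lambda>\<iota>. \<integral>\<^sup>+y. H (\<iota>(Suc t := (u, y))) \<partial>obs_law S i u) \<in> borel_measurable (info_space S k t)"
    by (intro borel_measurable_nn_integral) (simp add: split_beta')
qed (use policy_measurable[OF t] in \<open>simp_all add: countable_finite\<close>)

lemma upd_measurable:
  assumes t: "k \<le> t" "t < L" and \<iota>: "\<iota> \<in> space (info_space S k t)"
    and H: "H \<in> borel_measurable (info_space S k (Suc t))" and u: "u \<in> ctrls S"
  shows "(\<lambda>y. (H (\<iota>(Suc t := (u, y))) :: ennreal)) \<in> borel_measurable borel_vec"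
  by (rule measurable_compose[OF info_space_upd H]) (use t \<iota> u in auto)

lemma traj_space_info:
  assumes "k + j \<le> L" "\<tau> \<in> space (\<mu> j)"
  shows "info k (k + j) \<tau> \<in> space (info_space S k (k + j))"
  using assms measurable_space[OF info_measurable] by (simp add: space_traj_law)

lemma traj_space_state:
  assumes "k + j \<le> L" "\<tau> \<in> space (\<mu> j)"
  shows "fst (\<tau> (k + j)) < n"
proof -
  have "\<tau> (k + j) \<in> space (stage_space S)"
    using assms by (auto simp: space_traj_law traj_space_def space_PiM)
  then show ?thesis
    using measurable_space[OF measurable_state_fst] by auto
qed

lemma policy_in_ctrls:
  assumes "k \<le> t" "t < L" "\<iota> \<in> space (info_space S k t)"
  shows "\<eta> t \<iota> \<in> ctrls S"
  using measurable_space[OF policy_measurable[OF assms(1,2)] assms(3)] by simp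

lemma belief_prob:
  assumes "\<iota> \<in> space (info_space S k (k + j))"
  shows "prob_vec n (belief k p \<iota> (Suc j))"
  using measurable_space[OF measurable_belief[OF p, of k "Suc j" "k + j"] assms] by simp

text \<open>The tower property over the last stage. The new state is drawn from a column of
  \<open>tmat S\<close>, and everything else about the new stage is absorbed into
  \<open>push\<close>; the current state survives only as the column index.\<close>

lemma nn_step:
  assumes j: "k + Suc j \<le> L"
    and H: "\<And>i. i < n \<Longrightarrow> H i \<in> borel_measurable (info_space S k (Suc (k + j)))"
  shows "(\<integral>\<^sup>+\<tau>. H (fst (\<tau> (Suc (k + j)))) (info k (Suc (k + j)) \<tau>) \<partial>\<mu> (Suc j)) =
    (\<integral>\<^sup>+\<tau>. (\<Sum>i<n. ennreal (tmat S $$ (i, fst (\<tau> (k + j)))) * push (k + j) i (H i) (info k (k + j) \<tau>)) \<partial>\<mu> j)"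
proof -
  define t where "t = k + j"
  have t: "k \<le> t" "t < L" and j': "k + j \<le> L" using j by (auto simp: t_def)
  define g where "g = (\<lambda>\<tau>. H (fst (\<tau> (Suc t))) (info k (Suc t) \<tau>))"
  have g: "g \<in> borel_measurable (traj_space S k (Suc t))"
    unfolding g_def by (rule measurable_state_info) (use H t in \<open>auto simp: t_def\<close>)
  have K: "(\<lambda>\<tau>. distr (step_law t \<tau>) (traj_space S k (Suc t)) (\<lambda>z. \<tau>(Suc t := z)))
      \<in> \<mu> j \<rightarrow>\<^sub>M subprob_algebra (traj_space S k (Suc t))"
    using measurable_prob_algebraD[OF step_kernel[OF t]]
    by (simp add: measurable_cong_sets[OF sets_traj_law[OF j'] refl] t_def)
  have "(\<integral>\<^sup>+\<tau>. g \<tau> \<partial>\<mu> (Suc j)) =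
      (\<integral>\<^sup>+\<tau>. \<integral>\<^sup>+\<tau>'. g \<tau>' \<partial>distr (step_law t \<tau>) (traj_space S k (Suc t)) (\<lambda>z. \<tau>(Suc t := z)) \<partial>\<mu> j)"
    unfolding traj_law_Suc t_def[symmetric] by (rule nn_integral_bind[OF g K])
  also have "\<dots> = (\<integral>\<^sup>+\<tau>. (\<Sum>i<n. ennreal (tmat S $$ (i, fst (\<tau> t))) * push t i (H i) (info k t \<tau>)) \<partial>\<mu> j)"
  proof (rule nn_integral_cong)
    fix \<tau> assume \<tau>: "\<tau> \<in> space (\<mu> j)"
    have \<tau>': "\<tau> \<in> space (traj_space S k t)" using \<tau> space_traj_law[OF j'] by (simp add: t_def)
    have x: "fst (\<tau> t) < n" using traj_space_state[OF j' \<tau>] by (simp add: t_def)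
    have u: "\<eta> t (info k t \<tau>) \<in> ctrls S"
      using policy_in_ctrls[OF t] traj_space_info[OF j' \<tau>] by (simp add: t_def)
    have s: "sets (step_law t \<tau>) = sets (stage_space S)"
      using measurable_space[OF step_law_measurable[OF t] \<tau>'] by (simp add: space_prob_algebra)
    have m: "(\<lambda>z. \<tau>(Suc t := z)) \<in> stage_space S \<rightarrow>\<^sub>M traj_space S k (Suc t)"
      using measurable_compose[OF measurable_Pair1'[OF \<tau>'] traj_upd_measurable[of t]] t by simp
    then have m': "(\<lambda>z. \<tau>(Suc t := z)) \<in> step_law t \<tau> \<rightarrow>\<^sub>M traj_space S k (Suc t)"
      by (simp add: measurable_cong_sets[OF s refl])
    have "(\<integral>\<^sup>+\<tau>'. g \<tau>' \<partial>distr (step_law t \<tau>) (traj_space S k (Suc t)) (\<lambda>z. \<tau>(Suc t := z))) =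
        (\<integral>\<^sup>+z. g (\<tau>(Suc t := z)) \<partial>step_law t \<tau>)"
      by (rule nn_integral_distr[OF m']) (use g in simp)
    also have "\<dots> = (\<Sum>i<n. ennreal (col (tmat S) (fst (\<tau> t)) $ i) *
        (\<integral>\<^sup>+y. g (\<tau>(Suc t := (i, \<eta> t (info k t \<tau>), y))) \<partial>obs_law S i (\<eta> t (info k t \<tau>))))"
      unfolding step_law_def
      by (rule nn_integral_stage_law[OF tmat_col[OF x] u measurable_compose[OF m g]])
    also have "\<dots> = (\<Sum>i<n. ennreal (tmat S $$ (i, fst (\<tau> t))) * push t i (H i) (info k t \<tau>))"
      using x t carrier_matD[OF tmat_carrier]
      by (intro sum.cong refl) (simp add: push_def g_def info_upd)
    finally show "(\<integral>\<^sup>+\<tau>'. g \<tau>' \<partial>distr (step_law t \<tau>) (traj_space S k (Suc t)) (\<lambda>z. \<tau>(Suc t := z))) =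
        (\<Sum>i<n. ennreal (tmat S $$ (i, fst (\<tau> t))) * push t i (H i) (info k t \<tau>))" .
  qed
  finally show ?thesis unfolding g_def t_def .
qed

lemma init_measurable: "(\<lambda>y. \<lambda>s\<in>{k}. (v, y)) \<in> borel_vec \<rightarrow>\<^sub>M info_space S k k"
  unfolding info_space_def atLeastAtMost_singleton
  by (rule measurable_restrict, rule measurable_Pair_ctrl) (use v in auto)

lemma nn_init:
  assumes H: "\<And>i. i < n \<Longrightarrow> H i \<in> borel_measurable (info_space S k k)"
  shows "(\<integral>\<^sup>+\<tau>. H (fst (\<tau> k)) (info k k \<tau>) \<partial>\<mu> 0) =
    (\<Sum>i<n. ennreal (p $ i) * (\<integral>\<^sup>+y. H i (\<lambda>s\<in>{k}. (v, y)) \<partial>obs_law S i v))"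
proof -
  have i: "info k k (\<lambda>s\<in>{k}. (i, v, y)) = (\<lambda>s\<in>{k}. (v, y))" for i y
    by (auto simp: info_def restrict_def fun_eq_iff)
  have s: "sets (stage_law S p v) = sets (stage_space S)"
    using stage_law_prob_algebra[OF p v] by (simp add: space_prob_algebra)
  have g: "(\<lambda>\<tau>. H (fst (\<tau> k)) (info k k \<tau>)) \<in> borel_measurable (traj_space S k k)"
    by (rule measurable_state_info[OF H]) auto
  have m: "(\<lambda>z. \<lambda>s\<in>{k}. z) \<in> stage_space S \<rightarrow>\<^sub>M traj_space S k k"
    unfolding traj_space_def atLeastAtMost_singleton by (rule measurable_restrict) simp
  then have m': "(\<lambda>z. \<lambda>s\<in>{k}. z) \<in> stage_law S p v \<rightarrow>\<^sub>M traj_space S k k"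
    by (simp add: measurable_cong_sets[OF s refl])
  have "(\<integral>\<^sup>+\<tau>. H (fst (\<tau> k)) (info k k \<tau>) \<partial>\<mu> 0) =
      (\<integral>\<^sup>+z. H (fst ((\<lambda>s\<in>{k}. z) k)) (info k k (\<lambda>s\<in>{k}. z)) \<partial>stage_law S p v)"
    unfolding traj_law.simps by (rule nn_integral_distr[OF m']) (use g in simp)
  also have "\<dots> = (\<Sum>i<n. ennreal (p $ i) *
      (\<integral>\<^sup>+y. H (fst ((\<lambda>s\<in>{k}. (i, v, y)) k)) (info k k (\<lambda>s\<in>{k}. (i, v, y))) \<partial>obs_law S i v))"
    by (rule nn_integral_stage_law[OF p v measurable_compose[OF m g]])
  finally show ?thesis by (simp add: i)
qed

lemma nn_init_obs:
  assumes g: "g \<in> borel_measurable (info_space S k k)"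
  shows "(\<integral>\<^sup>+\<tau>. g (info k k \<tau>) \<partial>\<mu> 0) = (\<integral>\<^sup>+y. g (\<lambda>s\<in>{k}. (v, y)) \<partial>mix_law p v)"
  using nn_init[of "\<lambda>_. g"] g nn_integral_mix_law[OF p v measurable_compose[OF init_measurable g]] by simp

text \<open>
  Integrating out the hidden state: given the observations, the next state may be drawn from the
  predicted belief instead of from the current state.
\<close>

definition state_updated :: "nat \<Rightarrow> bool" where
  "state_updated j \<longleftrightarrow> (\<forall>G. (\<forall>i<n. G i \<in> borel_measurable (info_space S k (k + j))) \<longrightarrow>
     (\<integral>\<^sup>+\<tau>. (\<Sum>i<n. ennreal (tmat S $$ (i, fst (\<tau> (k + j)))) * G i (info k (k + j) \<tau>)) \<partial>\<mu> j) =
     (\<integral>\<^sup>+\<tau>. (\<Sum>i<n. ennreal (belief k p (info k (k + j) \<tau>) (Suc j) $ i) * G i (info k (k + j) \<tau>)) \<partial>\<mu> j))"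

lemma state_updatedD:
  assumes "state_updated j" "\<And>i. i < n \<Longrightarrow> G i \<in> borel_measurable (info_space S k (k + j))"
  shows "(\<integral>\<^sup>+\<tau>. (\<Sum>i<n. ennreal (tmat S $$ (i, fst (\<tau> (k + j)))) * G i (info k (k + j) \<tau>)) \<partial>\<mu> j) =
     (\<integral>\<^sup>+\<tau>. (\<Sum>i<n. ennreal (belief k p (info k (k + j) \<tau>) (Suc j) $ i) * G i (info k (k + j) \<tau>)) \<partial>\<mu> j)"
  using assms unfolding state_updated_def by blast

text \<open>Once the column of \<open>tmat S\<close> may be replaced by the belief, the sum over the
  next state is exactly the predictive law. The replacement is a premise because the induction that
  establishes it uses this lemma one stage earlier.\<close>

lemma obs_step_aux:
  assumes upd: "state_updated j" and j: "k + Suc j \<le> L"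
    and g: "g \<in> borel_measurable (info_space S k (Suc (k + j)))"
  shows "(\<integral>\<^sup>+\<tau>. g (info k (Suc (k + j)) \<tau>) \<partial>\<mu> (Suc j)) =
    (\<integral>\<^sup>+\<tau>. (\<integral>\<^sup>+y. g ((info k (k + j) \<tau>)(Suc (k + j) := (\<eta> (k + j) (info k (k + j) \<tau>), y)))
      \<partial>mix_law (belief k p (info k (k + j) \<tau>) (Suc j)) (\<eta> (k + j) (info k (k + j) \<tau>))) \<partial>\<mu> j)"
proof -
  let ?t = "k + j"
  have t: "k \<le> ?t" "?t < L" and j': "?t \<le> L" using j by auto
  have "(\<integral>\<^sup>+\<tau>. g (info k (Suc ?t) \<tau>) \<partial>\<mu> (Suc j)) =
      (\<integral>\<^sup>+\<tau>. (\<Sum>i<n. ennreal (tmat S $$ (i, fst (\<tau> ?t))) * push ?t i g (info k ?t \<tau>)) \<partial>\<mu> j)"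
    using nn_step[OF j, of "\<lambda>_. g"] g by simp
  also have "\<dots> = (\<integral>\<^sup>+\<tau>. (\<Sum>i<n. ennreal (belief k p (info k ?t \<tau>) (Suc j) $ i) * push ?t i g (info k ?t \<tau>)) \<partial>\<mu> j)"
    by (rule state_updatedD[OF upd push_measurable[OF t _ g]])
  also have "\<dots> = (\<integral>\<^sup>+\<tau>. (\<integral>\<^sup>+y. g ((info k ?t \<tau>)(Suc ?t := (\<eta> ?t (info k ?t \<tau>), y)))
      \<partial>mix_law (belief k p (info k ?t \<tau>) (Suc j)) (\<eta> ?t (info k ?t \<tau>))) \<partial>\<mu> j)"
  proof (rule nn_integral_cong)
    fix \<tau> assume \<tau>: "\<tau> \<in> space (\<mu> j)"
    note \<iota> = traj_space_info[OF j' \<tau>]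
    note u = policy_in_ctrls[OF t \<iota>]
    show "(\<Sum>i<n. ennreal (belief k p (info k ?t \<tau>) (Suc j) $ i) * push ?t i g (info k ?t \<tau>)) =
      (\<integral>\<^sup>+y. g ((info k ?t \<tau>)(Suc ?t := (\<eta> ?t (info k ?t \<tau>), y)))
        \<partial>mix_law (belief k p (info k ?t \<tau>) (Suc j)) (\<eta> ?t (info k ?t \<tau>)))"
      unfolding push_def
      by (rule nn_integral_mix_law[OF belief_prob[OF \<iota>] u upd_measurable[OF t \<iota> g u], symmetric])
  qed
  finally show ?thesis .
qed

lemma belief_index_measurable:
  assumes "k + j \<le> Suc t"
  shows "(\<lambda>\<iota>. belief k p \<iota> j $ i) \<in> borel_measurable (info_space S k t)"
  by (rule measurable_compose[OF measurable_belief[OF p assms] measurable_belief_index])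

text \<open>Bayes' rule iterated: \<open>nn_step\<close> moves the integral back one stage, the
  induction hypothesis replaces the transition weights by the belief, \<open>bayes_rule\<close>
  updates that belief for each history, and \<open>obs_step_aux\<close> read backwards restores the
  integral at the later stage.\<close>

lemma state_updated_all: "k + j \<le> L \<Longrightarrow> state_updated j"
proof (induction j)
  case 0
  show ?case
    unfolding state_updated_def
  proof (intro allI impI)
    fix G :: "nat \<Rightarrow> (nat \<Rightarrow> 'u \<times> real vec) \<Rightarrow> ennreal"
    assume "\<forall>i<n. G i \<in> borel_measurable (info_space S k (k + 0))"
    then have G: "\<And>i. i < n \<Longrightarrow> G i \<in> borel_measurable (info_space S k k)" by simp
    let ?\<iota> = "\<lambda>y. \<lambda>s\<in>{k}. (v, y)"
    have "(\<integral>\<^sup>+\<tau>. (\<Sum>i<n. ennreal (tmat S $$ (i, fst (\<tau> k))) * G i (info k k \<tau>)) \<partial>\<mu> 0) =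
        (\<Sum>l<n. ennreal (p $ l) * (\<integral>\<^sup>+y. (\<Sum>i<n. ennreal (tmat S $$ (i, l)) * G i (?\<iota> y)) \<partial>obs_law S l v))"
      by (rule nn_init) (use G in auto)
    also have "\<dots> = (\<integral>\<^sup>+y. (\<Sum>i<n. ennreal (bayes S p v y $ i) * G i (?\<iota> y)) \<partial>mix_law p v)"
      by (rule bayes_rule[OF p v measurable_compose[OF init_measurable G]])
    also have "\<dots> = (\<integral>\<^sup>+y. (\<Sum>i<n. ennreal (belief k p (?\<iota> y) (Suc 0) $ i) * G i (?\<iota> y)) \<partial>mix_law p v)"
      by simp
    also have "\<dots> = (\<integral>\<^sup>+\<tau>. (\<Sum>i<n. ennreal (belief k p (info k k \<tau>) (Suc 0) $ i) * G i (info k k \<tau>)) \<partial>\<mu> 0)"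
      by (rule nn_init_obs[symmetric])
        (intro borel_measurable_sum borel_measurable_times_ennreal measurable_compose[OF belief_index_measurable]
          measurable_ennreal G, auto)
    finally show "(\<integral>\<^sup>+\<tau>. (\<Sum>i<n. ennreal (tmat S $$ (i, fst (\<tau> (k + 0)))) * G i (info k (k + 0) \<tau>)) \<partial>\<mu> 0) =
        (\<integral>\<^sup>+\<tau>. (\<Sum>i<n. ennreal (belief k p (info k (k + 0) \<tau>) (Suc 0) $ i) * G i (info k (k + 0) \<tau>)) \<partial>\<mu> 0)"
      unfolding add_0_right .
  qed
next
  case (Suc j)
  let ?t = "k + j"
  have t: "k \<le> ?t" "?t < L" and j': "?t \<le> L" using Suc.prems by auto
  have upd: "state_updated j" using Suc by simp
  show ?case
    unfolding state_updated_def
  proof (intro allI impI)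
    fix G :: "nat \<Rightarrow> (nat \<Rightarrow> 'u \<times> real vec) \<Rightarrow> ennreal"
    assume "\<forall>i<n. G i \<in> borel_measurable (info_space S k (k + Suc j))"
    then have G: "\<And>i. i < n \<Longrightarrow> G i \<in> borel_measurable (info_space S k (Suc ?t))" by simp
    \<comment> \<open>Averaging over the state after next, given next state \<open>l\<close>, brings
      the integrand into the form that \<open>nn_step\<close> accepts.\<close>
    define H where "H = (\<lambda>l \<iota>. \<Sum>i<n. ennreal (tmat S $$ (i, l)) * G i \<iota>)"
    have H: "H l \<in> borel_measurable (info_space S k (Suc ?t))" for l
      unfolding H_def using G by (intro borel_measurable_sum borel_measurable_times_ennreal) auto
    have "(\<integral>\<^sup>+\<tau>. H (fst (\<tau> (Suc ?t))) (info k (Suc ?t) \<tau>) \<partial>\<mu> (Suc j)) =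
        (\<integral>\<^sup>+\<tau>. (\<Sum>l<n. ennreal (tmat S $$ (l, fst (\<tau> ?t))) * push ?t l (H l) (info k ?t \<tau>)) \<partial>\<mu> j)"
      by (rule nn_step[OF Suc.prems H])
    also have "\<dots> = (\<integral>\<^sup>+\<tau>. (\<Sum>l<n. ennreal (belief k p (info k ?t \<tau>) (Suc j) $ l) * push ?t l (H l) (info k ?t \<tau>)) \<partial>\<mu> j)"
      by (rule state_updatedD[OF upd push_measurable[OF t _ H]])
    also have "\<dots> = (\<integral>\<^sup>+\<tau>. (\<integral>\<^sup>+y. (\<lambda>\<iota>. \<Sum>i<n. ennreal (belief k p \<iota> (Suc (Suc j)) $ i) * G i \<iota>)
        ((info k ?t \<tau>)(Suc ?t := (\<eta> ?t (info k ?t \<tau>), y)))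
        \<partial>mix_law (belief k p (info k ?t \<tau>) (Suc j)) (\<eta> ?t (info k ?t \<tau>))) \<partial>\<mu> j)"
    proof (rule nn_integral_cong)
      fix \<tau> assume \<tau>: "\<tau> \<in> space (\<mu> j)"
      define \<iota> where "\<iota> = info k ?t \<tau>"
      have \<iota>: "\<iota> \<in> space (info_space S k ?t)"
        unfolding \<iota>_def by (rule traj_space_info[OF j' \<tau>])
      note u = policy_in_ctrls[OF t \<iota>]
      \<comment> \<open>Overwriting entry \<open>Suc ?t\<close> does not affect the belief of index
        \<open>Suc j\<close>, which reads earlier entries only; the belief of the next index adds
        just the overwritten pair.\<close>
      have b: "bayes S (belief k p \<iota> (Suc j)) (\<eta> ?t \<iota>) y =
          belief k p (\<iota>(Suc ?t := (\<eta> ?t \<iota>, y))) (Suc (Suc j))" for y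
        unfolding belief.simps(2)[of k p _ "Suc j"] by (simp add: belief_upd del: belief.simps)
      have "(\<Sum>l<n. ennreal (belief k p \<iota> (Suc j) $ l) * push ?t l (H l) \<iota>) =
        (\<integral>\<^sup>+y. (\<Sum>i<n. ennreal (bayes S (belief k p \<iota> (Suc j)) (\<eta> ?t \<iota>) y $ i) *
          G i (\<iota>(Suc ?t := (\<eta> ?t \<iota>, y)))) \<partial>mix_law (belief k p \<iota> (Suc j)) (\<eta> ?t \<iota>))"
        unfolding push_def H_def
        by (rule bayes_rule[OF belief_prob[OF \<iota>] u upd_measurable[OF t \<iota> G u]])
      then show "(\<Sum>l<n. ennreal (belief k p (info k ?t \<tau>) (Suc j) $ l) * push ?t l (H l) (info k ?t \<tau>)) =
        (\<integral>\<^sup>+y. (\<lambda>\<iota>. \<Sum>i<n. ennreal (belief k p \<iota> (Suc (Suc j)) $ i) * G i \<iota>)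
        ((info k ?t \<tau>)(Suc ?t := (\<eta> ?t (info k ?t \<tau>), y)))
        \<partial>mix_law (belief k p (info k ?t \<tau>) (Suc j)) (\<eta> ?t (info k ?t \<tau>)))"
        unfolding b unfolding \<iota>_def .
    qed
    also have "\<dots> = (\<integral>\<^sup>+\<tau>. (\<lambda>\<iota>. \<Sum>i<n. ennreal (belief k p \<iota> (Suc (Suc j)) $ i) * G i \<iota>)
        (info k (Suc ?t) \<tau>) \<partial>\<mu> (Suc j))"
      by (rule obs_step_aux[OF upd Suc.prems, symmetric])
        (intro borel_measurable_sum borel_measurable_times_ennreal measurable_compose[OF belief_index_measurable]
          measurable_ennreal G, auto)
    finally show "(\<integral>\<^sup>+\<tau>. (\<Sum>i<n. ennreal (tmat S $$ (i, fst (\<tau> (k + Suc j)))) * G i (info k (k + Suc j) \<tau>)) \<partial>\<mu> (Suc j)) =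
        (\<integral>\<^sup>+\<tau>. (\<Sum>i<n. ennreal (belief k p (info k (k + Suc j) \<tau>) (Suc (Suc j)) $ i) * G i (info k (k + Suc j) \<tau>)) \<partial>\<mu> (Suc j))"
      unfolding add_Suc_right H_def .
  qed
qed

lemmas obs_step = obs_step_aux[OF state_updated_all]

section \<open>Verification\<close>

definition reward :: "(nat \<Rightarrow> 'u \<times> real vec) \<Rightarrow> nat \<Rightarrow> ennreal" where
  "reward \<iota> s = ennreal (filt_sq (belief k p \<iota> s) (fst (\<iota> (k + s))) (snd (\<iota> (k + s))))"

lemma reward_measurable:
  assumes "k + s \<le> t"
  shows "(\<lambda>\<iota>. reward \<iota> s) \<in> borel_measurable (info_space S k t)"
  unfolding reward_def
proof (rule measurable_compose_countable'[where f = "\<lambda>u \<iota>. ennreal (filt_sq (belief k p \<iota> s) u (snd (\<iota> (k + s))))"])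
  have ks: "k + s \<in> {k..t}" using assms by simp
  show "(\<lambda>\<iota>. fst (\<iota> (k + s))) \<in> info_space S k t \<rightarrow>\<^sub>M count_space (ctrls S)"
    by (rule measurable_info_component(1)[OF ks])
  fix u assume u: "u \<in> ctrls S"
  have "(\<lambda>\<iota>. (belief k p \<iota> s, snd (\<iota> (k + s)))) \<in> info_space S k t \<rightarrow>\<^sub>M belief_space \<Otimes>\<^sub>M borel_vec"
    by (intro measurable_Pair measurable_belief[OF p] measurable_info_component(2)[OF ks]) (use assms in simp)
  from measurable_compose[OF this filt_sq_measurable[OF u]]
  show "(\<lambda>\<iota>. ennreal (filt_sq (belief k p \<iota> s) u (snd (\<iota> (k + s))))) \<in> borel_measurable (info_space S k t)"
    by simp
qed (simp add: countable_finite)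

lemma value_belief_measurable:
  assumes "k + j \<le> Suc t"
  shows "(\<lambda>\<iota>. value_fn m (belief k p \<iota> j)) \<in> borel_measurable (info_space S k t)"
  by (rule measurable_compose[OF measurable_belief[OF p assms] value_fn_measurable])

text \<open>Stage \<open>k + j\<close> has already been observed: \<open>j + 1\<close> rewards are
  collected, the current belief has index \<open>Suc j\<close>, and \<open>m\<close> counts the
  stages still to come.\<close>

definition total_reward :: "nat \<Rightarrow> nat \<Rightarrow> (nat \<Rightarrow> 'u \<times> real vec) \<Rightarrow> ennreal" where
  "total_reward j m \<iota> = (\<Sum>s\<le>j. reward \<iota> s) + value_fn m (belief k p \<iota> (Suc j))"

lemma total_measurable:
  "k + j \<le> t \<Longrightarrow> total_reward j m \<in> borel_measurable (info_space S k t)"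
  unfolding total_reward_def[abs_def]
  by (intro borel_measurable_add borel_measurable_sum reward_measurable value_belief_measurable) auto

lemma nn_integral_total_0: "(\<integral>\<^sup>+\<tau>. total_reward 0 m (info k k \<tau>) \<partial>\<mu> 0) = action_value m p v"
  by (subst nn_init_obs) (auto simp: total_measurable total_reward_def reward_def action_value_def)

lemma nn_integral_total_Suc:
  assumes j: "k + Suc j \<le> L"
  shows "(\<integral>\<^sup>+\<tau>. total_reward (Suc j) m (info k (Suc (k + j)) \<tau>) \<partial>\<mu> (Suc j)) =
    (\<integral>\<^sup>+\<tau>. (\<Sum>s\<le>j. reward (info k (k + j) \<tau>) s) +
      action_value m (belief k p (info k (k + j) \<tau>) (Suc j)) (\<eta> (k + j) (info k (k + j) \<tau>)) \<partial>\<mu> j)"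
proof -
  let ?t = "k + j"
  have t: "k \<le> ?t" "?t < L" and j': "?t \<le> L" using j by auto
  have "(\<integral>\<^sup>+\<tau>. total_reward (Suc j) m (info k (Suc ?t) \<tau>) \<partial>\<mu> (Suc j)) =
    (\<integral>\<^sup>+\<tau>. (\<integral>\<^sup>+y. total_reward (Suc j) m ((info k ?t \<tau>)(Suc ?t := (\<eta> ?t (info k ?t \<tau>), y)))
      \<partial>mix_law (belief k p (info k ?t \<tau>) (Suc j)) (\<eta> ?t (info k ?t \<tau>))) \<partial>\<mu> j)"
    by (rule obs_step[OF j' j total_measurable]) simp
  also have "\<dots> = (\<integral>\<^sup>+\<tau>. (\<Sum>s\<le>j. reward (info k ?t \<tau>) s) +
      action_value m (belief k p (info k ?t \<tau>) (Suc j)) (\<eta> ?t (info k ?t \<tau>)) \<partial>\<mu> j)"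
  proof (rule nn_integral_cong)
    fix \<tau> assume \<tau>: "\<tau> \<in> space (\<mu> j)"
    define \<iota> where "\<iota> = info k ?t \<tau>"
    have \<iota>: "\<iota> \<in> space (info_space S k ?t)"
      unfolding \<iota>_def by (rule traj_space_info[OF j' \<tau>])
    define b u where "b = belief k p \<iota> (Suc j)" and "u = \<eta> ?t \<iota>"
    have b: "prob_vec n b" unfolding b_def by (rule belief_prob[OF \<iota>])
    have u: "u \<in> ctrls S" unfolding u_def by (rule policy_in_ctrls[OF t \<iota>])
    interpret prob_space "mix_law b u" by (rule prob_space_mix_law[OF b u])
    have r: "reward (\<iota>(Suc ?t := z)) s = reward \<iota> s" if "s \<le> j" for s z
      using that by (simp add: reward_def belief_upd)
    have b1: "belief k p (\<iota>(Suc ?t := z)) (Suc j) = b" for z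
      unfolding b_def by (rule belief_upd) simp
    have b2: "belief k p (\<iota>(Suc ?t := z)) (Suc (Suc j)) = bayes S b (fst z) (snd z)" for z
      unfolding belief.simps(2)[of k p _ "Suc j"] b1 by simp
    have "total_reward (Suc j) m (\<iota>(Suc ?t := (u, y))) = (\<Sum>s\<le>j. reward \<iota> s) +
        (ennreal (filt_sq b u y) + value_fn m (bayes S b u y))" for y
    proof -
      have "reward (\<iota>(Suc ?t := (u, y))) (Suc j) = ennreal (filt_sq b u y)"
        unfolding reward_def b1 by simp
      then show ?thesis
        unfolding total_reward_def b2 by (simp add: r add.assoc)
    qed
    then have "(\<integral>\<^sup>+y. total_reward (Suc j) m (\<iota>(Suc ?t := (u, y))) \<partial>mix_law b u) =
        (\<Sum>s\<le>j. reward \<iota> s) + action_value m b u"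
      unfolding action_value_def
      using filt_sq_measurable1[OF u b] value_bayes_measurable[OF u b] emeasure_space_1
      by (simp add: nn_integral_add)
    then show "(\<integral>\<^sup>+y. total_reward (Suc j) m ((info k ?t \<tau>)(Suc ?t := (\<eta> ?t (info k ?t \<tau>), y)))
      \<partial>mix_law (belief k p (info k ?t \<tau>) (Suc j)) (\<eta> ?t (info k ?t \<tau>))) =
      (\<Sum>s\<le>j. reward (info k ?t \<tau>) s) +
      action_value m (belief k p (info k ?t \<tau>) (Suc j)) (\<eta> ?t (info k ?t \<tau>))"
      unfolding b_def u_def \<iota>_def .
  qed
  finally show ?thesis .
qed

text \<open>The supermartingale inequality: an actual control achieves at most the maximal one-step
  value. The bound is an \<open>action_value\<close> because the first control \<open>v\<close> is
  already fixed at \<open>j = 0\<close>.\<close>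

lemma nn_integral_total_le:
  "k + j \<le> L \<Longrightarrow> (\<integral>\<^sup>+\<tau>. total_reward j (L - k - j) (info k (k + j) \<tau>) \<partial>\<mu> j) \<le> action_value (L - k) p v"
proof (induction j)
  case 0
  then show ?case using nn_integral_total_0[of "L - k"] by (simp del: traj_law.simps)
next
  case (Suc j)
  have t: "k \<le> k + j" "k + j < L" "k + j \<le> L" using Suc.prems by auto
  \<comment> \<open>One more stage to go makes the value function a maximum over controls, which
    dominates the \<open>action_value\<close> of the policy.\<close>
  have m: "L - k - j = Suc (L - k - Suc j)" using Suc.prems by simp
  have "(\<integral>\<^sup>+\<tau>. total_reward (Suc j) (L - k - Suc j) (info k (Suc (k + j)) \<tau>) \<partial>\<mu> (Suc j)) \<le>
      (\<integral>\<^sup>+\<tau>. total_reward j (L - k - j) (info k (k + j) \<tau>) \<partial>\<mu> j)"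
    unfolding nn_integral_total_Suc[OF Suc.prems] unfolding total_reward_def m
    by (intro nn_integral_mono add_left_mono action_value_le policy_in_ctrls[OF t(1,2)] traj_space_info[OF t(3)])
  also have "\<dots> \<le> action_value (L - k) p v" by (rule Suc.IH[OF t(3)])
  finally show ?case by simp
qed

text \<open>A maximizing control turns the only inequality of the previous argument into an
  equality. The belief index \<open>Suc (t - k)\<close> occurs because \<open>\<eta> t\<close>
  chooses the control under which stage \<open>t + 1\<close> is observed.\<close>

lemma nn_integral_total_eq:
  assumes greedy: "\<And>t \<iota>. k \<le> t \<Longrightarrow> t < L \<Longrightarrow> \<iota> \<in> space (info_space S k t) \<Longrightarrow>
    action_value (L - Suc t) (belief k p \<iota> (Suc (t - k))) (\<eta> t \<iota>) = value_fn (L - t) (belief k p \<iota> (Suc (t - k)))"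
  shows "k + j \<le> L \<Longrightarrow> (\<integral>\<^sup>+\<tau>. total_reward j (L - k - j) (info k (k + j) \<tau>) \<partial>\<mu> j) = action_value (L - k) p v"
proof (induction j)
  case 0
  then show ?case using nn_integral_total_0[of "L - k"] by (simp del: traj_law.simps)
next
  case (Suc j)
  have t: "k \<le> k + j" "k + j < L" "k + j \<le> L" using Suc.prems by auto
  have "(\<integral>\<^sup>+\<tau>. total_reward (Suc j) (L - k - Suc j) (info k (Suc (k + j)) \<tau>) \<partial>\<mu> (Suc j)) =
      (\<integral>\<^sup>+\<tau>. total_reward j (L - k - j) (info k (k + j) \<tau>) \<partial>\<mu> j)"
    unfolding nn_integral_total_Suc[OF Suc.prems] unfolding total_reward_def
    using greedy[OF t(1,2) traj_space_info[OF t(3)]] by (intro nn_integral_cong) (simp del: belief.simps)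
  then show ?case using Suc.IH[OF t(3)] by simp
qed

text \<open>There are \<open>L - k + 1\<close> stages, each costing 1 minus its reward. Passing
  through \<open>enn2real\<close> is harmless because each reward is a finite number.\<close>

lemma remaining_cost_eq:
  assumes kL: "k \<le> L" and \<tau>: "\<tau> \<in> space (\<mu> (L - k))"
  shows "remaining_cost S L k p \<tau> = real (Suc (L - k)) - enn2real (\<Sum>s\<le>L - k. reward (info k L \<tau>) s)"
proof -
  have \<iota>: "info k L \<tau> \<in> space (info_space S k L)"
    using traj_space_info[of "L - k" \<tau>] kL \<tau> by simp
  have "remaining_cost S L k p \<tau> = (\<Sum>s\<le>L - k. 1 - filt_sq (belief k p (info k L \<tau>) s)
      (fst (info k L \<tau> (k + s))) (snd (info k L \<tau> (k + s))))"
    unfolding remaining_cost_def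
  proof (rule sum.reindex_bij_witness[of _ "\<lambda>s. k + s" "\<lambda>t. t - k"])
    fix t assume t: "t \<in> {k..L}"
    have b: "prob_vec n (belief k p (info k L \<tau>) (t - k))"
      using measurable_space[OF measurable_belief[OF p, of k "t - k" L] \<iota>] t by simp
    have u: "fst (info k L \<tau> t) \<in> ctrls S"
      using measurable_space[OF measurable_info_component(1)[OF t] \<iota>] by simp
    have "predicted S k p \<tau> (t - k) = belief k p (info k L \<tau>) (t - k)"
      using t by (intro predicted_eq_belief) simp
    moreover have "info k L \<tau> t = snd (\<tau> t)" using t by (simp add: info_def)
    ultimately show "1 - filt_sq (belief k p (info k L \<tau>) (t - k)) (fst (info k L \<tau> (k + (t - k)))) (snd (info k L \<tau> (k + (t - k)))) =
        (case \<tau> t of (_, u, y) \<Rightarrow> stage_cost S (predicted S k p \<tau> (t - k)) u y)"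
      using t stage_cost_eq[OF b u] by (auto split: prod.split)
  qed (use kL in auto)
  also have "\<dots> = real (Suc (L - k)) - (\<Sum>s\<le>L - k. filt_sq (belief k p (info k L \<tau>) s)
      (fst (info k L \<tau> (k + s))) (snd (info k L \<tau> (k + s))))"
    by (simp add: sum_subtractf)
  finally show ?thesis
    by (simp add: reward_def sum_nonneg)
qed

text \<open>At the horizon no stage remains, \<open>value_fn 0\<close> is zero, and
  \<open>total_reward\<close> is the plain sum of rewards. The supermartingale bound makes its
  integral finite, so the cost is integrable although it may be unbounded.\<close>

lemma policy_cost:
  assumes kL: "k \<le> L"
  shows "integrable (\<mu> (L - k)) (remaining_cost S L k p)"
    and "expected_cost S L k p v \<eta> =
      real (Suc (L - k)) - enn2real (\<integral>\<^sup>+\<tau>. total_reward (L - k) 0 (info k L \<tau>) \<partial>\<mu> (L - k))"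
proof -
  have j: "k + (L - k) \<le> L" and kj: "k + (L - k) = L" using kL by auto
  interpret prob_space "\<mu> (L - k)" by (rule prob_space_traj_law[OF j])
  define R where "R = (\<lambda>\<tau>. \<Sum>s\<le>L - k. reward (info k L \<tau>) s)"
  have R_finite: "R \<tau> < \<top>" for \<tau>
    by (simp add: R_def reward_def sum_nonneg)
  have total: "total_reward (L - k) 0 (info k L \<tau>) = R \<tau>" for \<tau>
    by (simp add: total_reward_def R_def)
  have "(\<lambda>\<iota>. \<Sum>s\<le>L - k. reward \<iota> s) \<in> borel_measurable (info_space S k L)"
    by (intro borel_measurable_sum reward_measurable) (use kL in auto)
  then have "R \<in> borel_measurable (traj_space S k L)"
    unfolding R_def by (rule measurable_compose[OF info_measurable])
  then have R [measurable]: "R \<in> borel_measurable (\<mu> (L - k))"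
    using sets_traj_law[OF j] kj by (simp cong: measurable_cong_sets)
  have "(\<integral>\<^sup>+\<tau>. R \<tau> \<partial>\<mu> (L - k)) \<le> action_value (L - k) p v"
    using nn_integral_total_le[OF j] kj total by simp
  also have "\<dots> < \<top>" by (rule action_value_finite[OF p v])
  finally have fin: "(\<integral>\<^sup>+\<tau>. R \<tau> \<partial>\<mu> (L - k)) < \<top>" .
  have eR: "ennreal (enn2real (R \<tau>)) = R \<tau>" for \<tau> using R_finite[of \<tau>] by simp
  have I: "integrable (\<mu> (L - k)) (\<lambda>\<tau>. enn2real (R \<tau>))"
    using fin by (intro integrableI_nonneg) (auto simp: eR)
  then have "integrable (\<mu> (L - k)) (\<lambda>\<tau>. real (Suc (L - k)) - enn2real (R \<tau>))" by simp
  then show "integrable (\<mu> (L - k)) (remaining_cost S L k p)"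
    by (rule Bochner_Integration.integrable_cong[THEN iffD1, rotated -1])
      (simp_all add: remaining_cost_eq[OF kL] R_def)
  have "expected_cost S L k p v \<eta> = (\<integral>\<tau>. real (Suc (L - k)) - enn2real (R \<tau>) \<partial>\<mu> (L - k))"
    unfolding expected_cost_def
    by (rule Bochner_Integration.integral_cong) (simp_all add: remaining_cost_eq[OF kL] R_def)
  also have "\<dots> = real (Suc (L - k)) - (\<integral>\<tau>. enn2real (R \<tau>) \<partial>\<mu> (L - k))"
    using I prob_space by simp
  also have "(\<integral>\<tau>. enn2real (R \<tau>) \<partial>\<mu> (L - k)) = enn2real (\<integral>\<^sup>+\<tau>. R \<tau> \<partial>\<mu> (L - k))"
    by (subst integral_eq_nn_integral) (auto simp: eR)
  finally show "expected_cost S L k p v \<eta> =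
      real (Suc (L - k)) - enn2real (\<integral>\<^sup>+\<tau>. total_reward (L - k) 0 (info k L \<tau>) \<partial>\<mu> (L - k))"
    by (simp only: total)
qed

lemma expected_cost_ge:
  assumes kL: "k \<le> L"
  shows "real (Suc (L - k)) - enn2real (value_fn (Suc (L - k)) p) \<le> expected_cost S L k p v \<eta>"
proof -
  have "(\<integral>\<^sup>+\<tau>. total_reward (L - k) 0 (info k L \<tau>) \<partial>\<mu> (L - k)) \<le> value_fn (Suc (L - k)) p"
    using nn_integral_total_le[of "L - k"] action_value_le[OF v, of "L - k" p] kL
    by (auto intro: order_trans)
  then show ?thesis
    unfolding policy_cost(2)[OF kL]
    using enn2real_mono value_fn_finite[OF p] by (simp del: value_fn.simps)
qed

end

section \<open>Attainment of the minimum and the Bellman recursion\<close>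

context controlled_model
begin

text \<open>Maximizing the one-step value at the current belief is optimal.
  \<open>measurable_argmax\<close> makes each such choice a measurable function of the history, and
  the choices for different stages are independent of each other because each depends on the history
  only through the belief.\<close>

lemma greedy_policy:
  assumes p: "prob_vec n p" and kL: "k \<le> L"
  obtains v \<eta> where "admissible S L k v \<eta>"
    "expected_cost S L k p v \<eta> = real (Suc (L - k)) - enn2real (value_fn (Suc (L - k)) p)"
proof -
  have "Max (action_value (L - k) p ` ctrls S) \<in> action_value (L - k) p ` ctrls S"
    by (intro Max_in) auto
  then obtain v where opt: "v \<in> ctrls S" "action_value (L - k) p v = value_fn (Suc (L - k)) p"
    unfolding value_fn_Suc by (metis imageE)
  \<comment> \<open>The control chosen from the history up to \<open>t\<close> is used for stage
    \<open>t + 1\<close>: its belief has index \<open>Suc (t - k)\<close>, and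
    \<open>L - Suc t\<close> stages follow it.\<close>
  have "\<exists>g. g \<in> info_space S k t \<rightarrow>\<^sub>M count_space (ctrls S) \<and>
      (\<forall>\<iota>\<in>space (info_space S k t). \<forall>u\<in>ctrls S. action_value (L - Suc t) (belief k p \<iota> (Suc (t - k))) u \<le>
        action_value (L - Suc t) (belief k p \<iota> (Suc (t - k))) (g \<iota>))" if "k \<le> t" for t
  proof (rule measurable_argmax)
    have "k + Suc (t - k) \<le> Suc t" using that by simp
    then show "(\<lambda>\<iota>. action_value (L - Suc t) (belief k p \<iota> (Suc (t - k))) u) \<in> borel_measurable (info_space S k t)"
      if "u \<in> ctrls S" for u
      by (rule measurable_compose[OF measurable_belief[OF p] action_value_measurable[OF that]])
  qed auto
  then have "\<forall>t. \<exists>g. k \<le> t \<longrightarrow> g \<in> info_space S k t \<rightarrow>\<^sub>M count_space (ctrls S) \<and>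
      (\<forall>\<iota>\<in>space (info_space S k t). \<forall>u\<in>ctrls S. action_value (L - Suc t) (belief k p \<iota> (Suc (t - k))) u \<le>
        action_value (L - Suc t) (belief k p \<iota> (Suc (t - k))) (g \<iota>))"
    by blast
  from choice[OF this] obtain \<eta> where \<eta>max: "\<forall>t. k \<le> t \<longrightarrow> \<eta> t \<in> info_space S k t \<rightarrow>\<^sub>M count_space (ctrls S) \<and>
      (\<forall>\<iota>\<in>space (info_space S k t). \<forall>u\<in>ctrls S. action_value (L - Suc t) (belief k p \<iota> (Suc (t - k))) u \<le>
        action_value (L - Suc t) (belief k p \<iota> (Suc (t - k))) (\<eta> t \<iota>))"
    by blast
  then have \<eta>: "\<eta> t \<in> info_space S k t \<rightarrow>\<^sub>M count_space (ctrls S)" if "k \<le> t" for t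
    using that by blast
  from \<eta>max have max: "action_value (L - Suc t) (belief k p \<iota> (Suc (t - k))) u \<le>
      action_value (L - Suc t) (belief k p \<iota> (Suc (t - k))) (\<eta> t \<iota>)"
    if "k \<le> t" "\<iota> \<in> space (info_space S k t)" "u \<in> ctrls S" for t \<iota> u
    using that by blast
  have adm: "admissible S L k v \<eta>" using opt(1) \<eta> by (simp add: admissible_def)
  interpret controlled_policy S k L p v \<eta>
    by unfold_locales (use p adm in auto)
  have "action_value (L - Suc t) (belief k p \<iota> (Suc (t - k))) (\<eta> t \<iota>) = value_fn (L - t) (belief k p \<iota> (Suc (t - k)))"
    if t: "k \<le> t" "t < L" and \<iota>: "\<iota> \<in> space (info_space S k t)" for t \<iota>
  proof -
    have "L - t = Suc (L - Suc t)" using t by simp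
    then show ?thesis
      using max[OF t(1) \<iota>] policy_in_ctrls[OF t \<iota>]
      by (auto simp: value_fn_Suc simp del: value_fn.simps intro!: Max_eqI[symmetric])
  qed
  from nn_integral_total_eq[OF this, of "L - k"] kL
  have "(\<integral>\<^sup>+\<tau>. total_reward (L - k) 0 (info k L \<tau>) \<partial>\<mu> (L - k)) = value_fn (Suc (L - k)) p"
    using opt(2) by simp
  then show ?thesis
    using policy_cost(2)[OF kL] adm that by metis
qed

text \<open>The lower bound holds for every admissible policy and the greedy one meets it, so the
  infimum is attained and its value is explicit.\<close>

lemma cost_to_go_eq:
  assumes p: "prob_vec n p" and kL: "k \<le> L"
  shows "cost_to_go S L k p = real (Suc (L - k)) - enn2real (value_fn (Suc (L - k)) p)"
    and "cost_to_go_is_min S L k p"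
proof -
  obtain v \<eta> where opt: "admissible S L k v \<eta>"
    "expected_cost S L k p v \<eta> = real (Suc (L - k)) - enn2real (value_fn (Suc (L - k)) p)"
    by (rule greedy_policy[OF p kL])
  have pol: "controlled_policy S k L p v \<eta>" if "admissible S L k v \<eta>" for v \<eta>
    using valid p that by unfold_locales
  note ge = controlled_policy.expected_cost_ge[OF pol kL]
  show eq: "cost_to_go S L k p = real (Suc (L - k)) - enn2real (value_fn (Suc (L - k)) p)"
    unfolding cost_to_go_def
  proof (rule cInf_eq_minimum)
    show "real (Suc (L - k)) - enn2real (value_fn (Suc (L - k)) p) \<in>
        {expected_cost S L k p v \<eta> |v \<eta>. admissible S L k v \<eta>}"
      using opt by (metis (mono_tags, lifting) mem_Collect_eq)
  qed (use ge in auto)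
  show "cost_to_go_is_min S L k p"
    unfolding cost_to_go_is_min_def eq
    using ge controlled_policy.policy_cost(1)[OF pol kL] opt by blast
qed

text \<open>Passage from \<open>ennreal\<close> rewards back to real integrals against Lebesgue
  measure. The continuation value lies between 0 and \<open>m\<close>, hence is integrable under the
  predictive probability law; unfolding the density moves the likelihood into the integrand. The
  extra 1 in \<open>Suc m\<close> is absorbed by the mean stage cost, which is 1 minus the mean
  reward.\<close>

lemma stage_value:
  assumes p: "prob_vec n p" and u: "u \<in> ctrls S"
  shows "integrable (lborel_vec (odim S u)) (\<lambda>y. lik p u y * (real m - enn2real (value_fn m (bayes S p u y))))"
    and "p \<bullet> h_vec S p u + (\<integral>y. lik p u y * (real m - enn2real (value_fn m (bayes S p u y))) \<partial>lborel_vec (odim S u)) =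
      real (Suc m) - enn2real (action_value m p u)"
proof -
  interpret prob_space "mix_law p u" by (rule prob_space_mix_law[OF p u])
  note [measurable] = value_bayes_measurable[OF u p] lik_measurable1[OF u]
  have b: "prob_vec n (bayes S p u y)" for y by (rule bayes_prob_vec[OF p u])
  have V: "value_fn m (bayes S p u y) < \<top>" for y by (rule value_fn_finite[OF b])
  have le: "enn2real (value_fn m (bayes S p u y)) \<le> real m" for y
    using enn2real_mono[OF value_fn_bound[OF b, of m y]] by (simp add: ennreal_of_nat_eq_real_of_nat)
  have I: "integrable (mix_law p u) (\<lambda>y. enn2real (value_fn m (bayes S p u y)))"
    by (rule integrable_const_bound[of _ "real m"]) (use le in auto)
  then have I': "integrable (mix_law p u) (\<lambda>y. real m - enn2real (value_fn m (bayes S p u y)))"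
    by simp
  show "integrable (lborel_vec (odim S u)) (\<lambda>y. lik p u y * (real m - enn2real (value_fn m (bayes S p u y))))"
    using I' unfolding mix_law_def
    by (subst (asm) integrable_real_density) (auto intro: less_imp_le lik_pos[OF p u])
  have "(\<integral>y. lik p u y * (real m - enn2real (value_fn m (bayes S p u y))) \<partial>lborel_vec (odim S u)) =
      (\<integral>y. real m - enn2real (value_fn m (bayes S p u y)) \<partial>mix_law p u)"
    unfolding mix_law_def by (subst integral_real_density) (auto intro: less_imp_le lik_pos[OF p u])
  also have "\<dots> = real m - (\<integral>y. enn2real (value_fn m (bayes S p u y)) \<partial>mix_law p u)"
    using I prob_space by simp
  also have "(\<integral>y. enn2real (value_fn m (bayes S p u y)) \<partial>mix_law p u) =
      enn2real (\<integral>\<^sup>+y. value_fn m (bayes S p u y) \<partial>mix_law p u)"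
    using V by (subst integral_eq_nn_integral) auto
  finally have 1: "(\<integral>y. lik p u y * (real m - enn2real (value_fn m (bayes S p u y))) \<partial>lborel_vec (odim S u)) =
      real m - enn2real (\<integral>\<^sup>+y. value_fn m (bayes S p u y) \<partial>mix_law p u)" .
  have "(\<integral>\<^sup>+y. value_fn m (bayes S p u y) \<partial>mix_law p u) \<le> of_nat m"
    by (rule nn_integral_mix_law_bound[OF p u value_fn_bound[OF b]])
  then have "(\<integral>\<^sup>+y. value_fn m (bayes S p u y) \<partial>mix_law p u) < \<top>"
    by (rule le_less_trans) (rule of_nat_less_top)
  then have "enn2real (action_value m p u) =
      (1 - p \<bullet> h_vec S p u) + enn2real (\<integral>\<^sup>+y. value_fn m (bayes S p u y) \<partial>mix_law p u)"
    unfolding action_value_split[OF p u] using h_vec_le_1[OF p u] by (subst enn2real_plus) auto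
  with 1 show "p \<bullet> h_vec S p u + (\<integral>y. lik p u y * (real m - enn2real (value_fn m (bayes S p u y))) \<partial>lborel_vec (odim S u)) =
      real (Suc m) - enn2real (action_value m p u)"
    by simp
qed

text \<open>The recursion of \<open>value_fn\<close> read through \<open>cost_to_go_eq\<close>: the
  maximal reward becomes the minimal cost, and \<open>stage_value\<close> identifies the quantity
  being minimized.\<close>

lemma bellman_step:
  assumes p: "prob_vec n p" and kL: "k < L"
  shows "\<forall>u\<in>ctrls S. integrable (lborel_vec (odim S u))
      (\<lambda>y. (ones n \<bullet> (lik_mat S y u *\<^sub>v p)) * cost_to_go S L (k + 1) (bayes S p u y))"
    and "cost_to_go S L k p = Min ((\<lambda>u. p \<bullet> h_vec S p u +
      (\<integral>y. (ones n \<bullet> (lik_mat S y u *\<^sub>v p)) * cost_to_go S L (k + 1) (bayes S p u y) \<partial>lborel_vec (odim S u))) ` ctrls S)"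
proof -
  \<comment> \<open>From stage \<open>k + 1\<close> on there are \<open>L - k\<close> stages, so the
    same \<open>value_fn\<close> describes the continuation.\<close>
  have m: "Suc (L - (k + 1)) = L - k" using kL by simp
  have J: "cost_to_go S L (k + 1) (bayes S p u y) = real (L - k) - enn2real (value_fn (L - k) (bayes S p u y))"
    if "u \<in> ctrls S" for u y
    using cost_to_go_eq(1)[OF bayes_prob_vec[OF p that], of "k + 1" L y] kL unfolding m by simp
  show "\<forall>u\<in>ctrls S. integrable (lborel_vec (odim S u))
      (\<lambda>y. (ones n \<bullet> (lik_mat S y u *\<^sub>v p)) * cost_to_go S L (k + 1) (bayes S p u y))"
  proof
    fix u assume u: "u \<in> ctrls S"
    show "integrable (lborel_vec (odim S u))
      (\<lambda>y. (ones n \<bullet> (lik_mat S y u *\<^sub>v p)) * cost_to_go S L (k + 1) (bayes S p u y))"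
      unfolding ones_lik[OF p] J[OF u] by (rule stage_value(1)[OF p u])
  qed
  have "cost_to_go S L k p = real (Suc (L - k)) - enn2real (Max (action_value (L - k) p ` ctrls S))"
    using cost_to_go_eq(1)[OF p, of k L] kL by (simp add: value_fn_Suc del: value_fn.simps)
  also have "\<dots> = Min ((\<lambda>u. real (Suc (L - k)) - enn2real (action_value (L - k) p u)) ` ctrls S)"
    by (rule Min_diff_enn2real[symmetric]) (auto intro: action_value_finite[OF p])
  also have "\<dots> = Min ((\<lambda>u. p \<bullet> h_vec S p u +
      (\<integral>y. (ones n \<bullet> (lik_mat S y u *\<^sub>v p)) * cost_to_go S L (k + 1) (bayes S p u y) \<partial>lborel_vec (odim S u))) ` ctrls S)"
    by (intro arg_cong[where f = Min] image_cong refl)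
      (simp only: ones_lik[OF p] J stage_value(2)[OF p])
  finally show "cost_to_go S L k p = Min ((\<lambda>u. p \<bullet> h_vec S p u +
      (\<integral>y. (ones n \<bullet> (lik_mat S y u *\<^sub>v p)) * cost_to_go S L (k + 1) (bayes S p u y) \<partial>lborel_vec (odim S u))) ` ctrls S)" .
qed

text \<open>At the horizon \<open>value_fn 0\<close> is zero and only the mean stage cost is left to
  minimize.\<close>

lemma bellman_last:
  assumes p: "prob_vec n p"
  shows "cost_to_go S L L p = Min ((\<lambda>u. p \<bullet> h_vec S p u) ` ctrls S)"
proof -
  have "cost_to_go S L L p = 1 - enn2real (Max (action_value 0 p ` ctrls S))"
    using cost_to_go_eq(1)[OF p, of L L] by (simp add: value_fn_Suc del: value_fn.simps)
  also have "\<dots> = Min ((\<lambda>u. 1 - enn2real (action_value 0 p u)) ` ctrls S)"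
    by (rule Min_diff_enn2real[symmetric]) (auto intro: action_value_finite[OF p])
  also have "\<dots> = Min ((\<lambda>u. p \<bullet> h_vec S p u) ` ctrls S)"
    by (intro arg_cong[where f = Min] image_cong refl)
      (simp add: action_value_split[OF p] h_vec_le_1[OF p])
  finally show ?thesis .
qed

end

theorem theorem4:
  fixes S :: "'u model" and L :: nat
  assumes "valid_model S" and "1 \<le> L"
  shows "(\<forall>k\<in>{1..L}. \<forall>p. prob_vec (nstates S) p \<longrightarrow> cost_to_go_is_min S L k p) \<and>
    (\<forall>k\<in>{1..<L}. \<forall>p. prob_vec (nstates S) p \<longrightarrow>
       (\<forall>u\<in>ctrls S. integrable (lborel_vec (odim S u))
          (\<lambda>y. (ones (nstates S) \<bullet> (lik_mat S y u *\<^sub>v p)) * cost_to_go S L (k + 1) (bayes S p u y))) \<and>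
       cost_to_go S L k p =
         Min ((\<lambda>u. p \<bullet> h_vec S p u +
           (\<integral>y. (ones (nstates S) \<bullet> (lik_mat S y u *\<^sub>v p)) *
                 cost_to_go S L (k + 1)
                   ((1 / (ones (nstates S) \<bullet> (lik_mat S y u *\<^sub>v p))) \<cdot>\<^sub>v
                      (tmat S *\<^sub>v (lik_mat S y u *\<^sub>v p)))
             \<partial>lborel_vec (odim S u))) ` ctrls S)) \<and>
    (\<forall>p. prob_vec (nstates S) p \<longrightarrow>
       cost_to_go S L L p = Min ((\<lambda>u. p \<bullet> h_vec S p u) ` ctrls S))"
proof -
  interpret controlled_model S by unfold_locales (rule assms(1))
  show ?thesis
    \<comment> \<open>The normalized update written out in the recursion is folded back into
      \<open>bayes\<close>, the form in which the recursion was proved.\<close>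
    unfolding bayes_def[symmetric]
  proof (intro conjI ballI allI impI)
    fix k p assume "k \<in> {1..L}" "prob_vec (nstates S) p"
    then show "cost_to_go_is_min S L k p" by (intro cost_to_go_eq(2)) auto
  next
    fix k p u assume "k \<in> {1..<L}" and p: "prob_vec (nstates S) p" and u: "u \<in> ctrls S"
    then have k: "k < L" by simp
    show "integrable (lborel_vec (odim S u))
        (\<lambda>y. (ones (nstates S) \<bullet> (lik_mat S y u *\<^sub>v p)) * cost_to_go S L (k + 1) (bayes S p u y))"
      using bellman_step(1)[OF p k] u by (rule bspec)
  next
    fix k p assume "k \<in> {1..<L}" and p: "prob_vec (nstates S) p"
    then have k: "k < L" by simp
    show "cost_to_go S L k p = Min ((\<lambda>u. p \<bullet> h_vec S p u +
        (\<integral>y. (ones (nstates S) \<bullet> (lik_mat S y u *\<^sub>v p)) * cost_to_go S L (k + 1) (bayes S p u y)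
          \<partial>lborel_vec (odim S u))) ` ctrls S)"
      by (rule bellman_step(2)[OF p k])
  next
    fix p assume "prob_vec (nstates S) p"
    then show "cost_to_go S L L p = Min ((\<lambda>u. p \<bullet> h_vec S p u) ` ctrls S)"
      by (rule bellman_last)
  qed
qed

end
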